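(* Let $p\ge 3$ be a prime and $k$ a positive integer with $p\nmid k$, and let $\phi_{(p,k)}(x)=x^p+kpx^{p-1}-kp\in\mathbb{Z}[x]$. If $p\ge 5$ and $k\equiv 1 \pmod 3$, then $G_{\mathbb{Q}}(\phi_{(p,k)})=\mathrm{Aut}(T_\infty)$. Moreover, $G_{\mathbb{Q}}(\phi_{(3,2)})=\mathrm{Aut}(T_\infty)$, where $\phi_{(3,2)}(x)=x^3+6x^2-6$. Consequently, for every prime $\ell$ there exists a polynomial $\varphi\in\mathbb{Z}[x]$ of degree $\ell$ with $G_{\mathbb{Q}}(\varphi)=\mathrm{Aut}(T_\infty)$.
   Context: For a number field $K$ and $\varphi\in K[x]$ of degree $d\ge 2$ such that every iterate $\varphi^n$ ($n\ge1$, $\varphi^n$ the $n$-fold composition) is separable, the pre-image tree $T_\infty$ has vertex set $\bigsqcup_{n\ge 0}\varphi^{-n}(0)$ (with $\varphi^{-0}(0)=\{0\}$), and $\alpha\in\varphi^{-n}(0)$, $\beta\in\varphi^{-(n+1)}(0)$ are joined by an edge iff $\varphi(\beta)=\alpha$. $\mathrm{Aut}(T_\infty)$ is its graph automorphism group (isomorphic to the infinite iterated wreath product of $S_d$). The absolute Galois group $\mathrm{Gal}(\overline{K}/K)$ acts on $T_\infty$ through its action on the sets $\varphi^{-n}(0)$, giving a homomorphism $\rho:\mathrm{Gal}(\overline K/K)\to\mathrm{Aut}(T_\infty)$; $G_K(\varphi)$ denotes its image. *)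

theory Defs
  imports "HOL-Computational_Algebra.Polynomial" "HOL-Number_Theory.Cong"
begin

definition cpoly :: "int poly \<Rightarrow> complex poly" where
  "cpoly f = map_poly of_int f"

definition iter_poly :: "int poly \<Rightarrow> nat \<Rightarrow> complex poly" where
  "iter_poly f n = ((\<lambda>q. pcompose (cpoly f) q) ^^ n) [:0, 1:]"

definition iterates_separable :: "int poly \<Rightarrow> bool" where
  "iterates_separable f \<longleftrightarrow> (\<forall>n\<ge>1. rsquarefree (iter_poly f n))"

definition tree_verts :: "int poly \<Rightarrow> (nat \<times> complex) set" where
  "tree_verts f = {(n, a). poly (iter_poly f n) a = 0}"

definition tree_edge :: "int poly \<Rightarrow> nat \<times> complex \<Rightarrow> nat \<times> complex \<Rightarrow> bool" where
  "tree_edge f u v \<longleftrightarrow>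
     (fst v = fst u + 1 \<and> poly (cpoly f) (snd v) = snd u) \<or>
     (fst u = fst v + 1 \<and> poly (cpoly f) (snd u) = snd v)"

definition tree_aut :: "int poly \<Rightarrow> (nat \<times> complex \<Rightarrow> nat \<times> complex) \<Rightarrow> bool" where
  "tree_aut f t \<longleftrightarrow> bij_betw t (tree_verts f) (tree_verts f) \<and>
     (\<forall>u\<in>tree_verts f. \<forall>v\<in>tree_verts f. tree_edge f u v \<longleftrightarrow> tree_edge f (t u) (t v))"

text \<open>Elements of Gal(Qbar/Q): field automorphisms of the algebraic closure of Q in C
  (the field of algebraic numbers); values outside it are irrelevant.\<close>
definition qbar_aut :: "(complex \<Rightarrow> complex) \<Rightarrow> bool" where
  "qbar_aut s \<longleftrightarrow> bij_betw s {z. algebraic z} {z. algebraic z} \<and> s 1 = 1 \<and>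
     (\<forall>x y. algebraic x \<longrightarrow> algebraic y \<longrightarrow> s (x + y) = s x + s y \<and> s (x * y) = s x * s y)"

definition arboreal_surjective :: "int poly \<Rightarrow> bool" where
  "arboreal_surjective f \<longleftrightarrow> iterates_separable f \<and>
     (\<forall>t. tree_aut f t \<longrightarrow>
        (\<exists>s. qbar_aut s \<and> (\<forall>v\<in>tree_verts f. t v = (fst v, s (snd v)))))"

definition phi_pk :: "nat \<Rightarrow> nat \<Rightarrow> int poly" where
  "phi_pk p k = monom 1 p + monom (int k * int p) (p - 1) - [:int k * int p:]"

end

theory Submission
  imports Defs "Jordan_Normal_Form.Char_Poly"
    "HOL-Computational_Algebra.Fundamental_Theorem_Algebra"
    "HOL-Computational_Algebra.Nth_Powers" "HOL-Library.FuncSet"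
begin

text \<open>
  Let \<open>f = x^p + kp x^(p-1) - kp\<close>. Its critical points are \<open>0\<close> and \<open>c = -k(p-1)\<close>, and
  \<open>0\<close> is mapped to the fixed point \<open>-kp\<close>. Every iterate is Eisenstein at \<open>p\<close>, so the Galois
  group is transitive on each level of the tree. Write \<open>f^n(c) = k b_n\<close>. If \<open>|b_n|\<close> is not
  a square, some prime \<open>q\<close> not dividing \<open>kp\<close> divides \<open>f^n(c)\<close> to an odd power, and \<open>q\<close> divides no
  earlier \<open>f^j(c)\<close>, since otherwise \<open>f^n(c) = -kp\<close> modulo \<open>q\<close>. Modulo a prime \<open>Q\<close> above \<open>q\<close>,
  the only coincidence among the roots of \<open>f^n\<close> is one double root at \<open>c\<close>, so inertia at \<open>Q\<close>
  contains at most one nontrivial permutation of the roots, a transposition. If inertia were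
  trivial, then \<open>q\<close> would be a uniformizer at \<open>Q\<close>, but
  \<open>(\<alpha> - c)^2\<close> equals \<open>f^n(c)\<close> up to a unit at \<open>Q\<close> for a root \<open>\<alpha>\<close> reducing to \<open>c\<close>,
  which contradicts the odd power. The transposition acts inside one fibre
  of \<open>f\<close>; by transitivity and primality of \<open>p\<close>, its conjugates generate the full symmetric group
  of every fibre. Induction on the level gives all automorphisms of finite levels, and a pointwise
  limit gives those of the infinite tree. That \<open>b_n\<close> is not a square is a congruence: \<open>b_n\<close> is
  \<open>2\<close> modulo \<open>3\<close> in the first family, \<open>5\<close> modulo \<open>8\<close> for \<open>(p,k) = (3,2)\<close>, and \<open>3\<close> modulo \<open>4\<close>
  for \<open>x^2 + 6x - 6\<close>, which serves the prime \<open>2\<close>.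
\<close>

section \<open>Algebraic integers\<close>

text \<open>A transposition of the roots of the n-th iterate fixes level n - 1 pointwise, because it
  commutes with f and every fibre has at least two points. So the kernel of restriction to level n -
  1 is shown directly to contain every fibre permutation, without discriminants or degrees of field
  extensions. The obstacle is local. The primes Q live in the ring of all algebraic integers, where
  Q has no uniformizer. That q is one is therefore expressed in the subring R belonging to a level,
  as a divisibility: every z in R and Q satisfies u * z = q * t with t in R and some u in R outside
  Q. This comes from a trace computation with elements playing the role of dual bases; the traces
  that occur are rational integers lying in Q, hence multiples of q. The constants of the two
  isolated cases avoid squares: k = 1 gives b_1 = 1 for p = 3 and b_2 = 1 for p = 2, so k = 2 and k
  = 3 are the next values prime to p.\<close>

definition int_span :: "'i set \<Rightarrow> ('i \<Rightarrow> complex) \<Rightarrow> complex set" where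
  "int_span I v = {s. \<exists>c::'i \<Rightarrow> int. s = (\<Sum>i\<in>I. of_int (c i) * v i)}"

lemma int_span_0: "0 \<in> int_span I v"
  unfolding int_span_def by (auto intro!: exI[of _ "\<lambda>_. 0"])

lemma int_span_add: "a \<in> int_span I v \<Longrightarrow> b \<in> int_span I v \<Longrightarrow> a + b \<in> int_span I v"
proof -
  assume "a \<in> int_span I v" "b \<in> int_span I v"
  then obtain c d where "a = (\<Sum>i\<in>I. of_int (c i) * v i)" "b = (\<Sum>i\<in>I. of_int (d i) * v i)"
    unfolding int_span_def by blast
  then have "a + b = (\<Sum>i\<in>I. of_int (c i + d i) * v i)"
    by (simp add: algebra_simps sum.distrib)
  then show ?thesis unfolding int_span_def by (intro CollectI exI)
qed

lemma int_span_scale: "a \<in> int_span I v \<Longrightarrow> of_int m * a \<in> int_span I v"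
proof -
  assume "a \<in> int_span I v"
  then obtain c where "a = (\<Sum>i\<in>I. of_int (c i) * v i)"
    unfolding int_span_def by blast
  then have "of_int m * a = (\<Sum>i\<in>I. of_int (m * c i) * v i)"
    by (simp add: sum_distrib_left mult.assoc)
  then show ?thesis unfolding int_span_def by (intro CollectI exI)
qed

lemma int_span_base:
  assumes "finite I" "i \<in> I"
  shows "v i \<in> int_span I v"
proof -
  have "(\<Sum>j\<in>I. of_int (if j = i then 1 else 0) * v j) = (\<Sum>j\<in>I. if j = i then v j else 0)"
    by (intro sum.cong) auto
  then have "v i = (\<Sum>j\<in>I. of_int (if j = i then 1 else 0) * v j)"
    using assms by simp
  then show ?thesis unfolding int_span_def by (intro CollectI exI)
qed

lemma int_span_sum: "finite J \<Longrightarrow> (\<And>j. j \<in> J \<Longrightarrow> f j \<in> int_span I v) \<Longrightarrow> sum f J \<in> int_span I v"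
  by (induction J rule: finite_induct) (auto intro: int_span_0 int_span_add)

lemma int_span_stable:
  assumes "finite I" "\<And>i. i \<in> I \<Longrightarrow> z * v i \<in> int_span I v" "a \<in> int_span I v"
  shows "z * a \<in> int_span I v"
proof -
  obtain c where c: "a = (\<Sum>i\<in>I. of_int (c i) * v i)"
    using assms(3) unfolding int_span_def by blast
  have "z * a = (\<Sum>i\<in>I. of_int (c i) * (z * v i))"
    unfolding c sum_distrib_left by (intro sum.cong) auto
  then show ?thesis
    using assms by (auto intro!: int_span_sum int_span_scale)
qed

text \<open>\<open>z\<close> is a root of the characteristic polynomial of an integer matrix, which
  is monic with integer coefficients.\<close>

lemma algebraic_int_if_eigenvalue:
  fixes A :: "int mat" and v :: "complex vec"
  assumes A: "A \<in> carrier_mat n n" and v: "v \<in> carrier_vec n" "v \<noteq> 0\<^sub>v n"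
    and e: "map_mat of_int A *\<^sub>v v = z \<cdot>\<^sub>v v"
  shows "algebraic_int z"
proof -
  have "eigenvalue (map_mat of_int A) z"
    unfolding eigenvalue_def eigenvector_def using v e A by auto
  then have "poly (char_poly (map_mat of_int A)) z = 0"
    using eigenvalue_root_char_poly[of "map_mat of_int A" n z] A by auto
  then have "poly (map_poly of_int (char_poly A)) z = 0"
    by (simp add: of_int_hom.char_poly_hom[OF A])
  then show ?thesis
    unfolding algebraic_int_altdef_ipoly using degree_monic_char_poly[OF A] by blast
qed

text \<open>Multiplication by \<open>z\<close> acts on the generators through an integer matrix, and
  the column of the \<open>v i\<close> is an eigenvector of it; \<open>v i0\<close> makes this
  column nonzero.\<close>

lemma algebraic_int_if_stable_span:
  assumes fin: "finite I" and nz: "i0 \<in> I" "v i0 \<noteq> 0"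
    and st: "\<And>i. i \<in> I \<Longrightarrow> z * v i \<in> int_span I v"
  shows "algebraic_int z"
proof -
  obtain h where h: "bij_betw h {..<card I} I"
    using ex_bij_betw_nat_finite[OF fin] by (auto simp: atLeast0LessThan)
  have "\<forall>i\<in>I. \<exists>c::'a \<Rightarrow> int. z * v i = (\<Sum>j\<in>I. of_int (c j) * v j)"
    using st unfolding int_span_def by blast
  from bchoice[OF this] obtain c :: "'a \<Rightarrow> 'a \<Rightarrow> int"
    where c: "z * v i = (\<Sum>j\<in>I. of_int (c i j) * v j)" if "i \<in> I" for i by (elim exE) simp
  define n where "n = card I"
  define A where "A = mat n n (\<lambda>(i, j). c (h i) (h j))"
  define w where "w = vec n (\<lambda>i. v (h i))"
  have hI: "h i \<in> I" if "i < n" for i using h that unfolding n_def bij_betw_def by auto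
  obtain k where k: "k < n" "h k = i0"
    using h nz(1) unfolding n_def bij_betw_def by (metis imageE lessThan_iff)
  show ?thesis
  proof (rule algebraic_int_if_eigenvalue[of A n w])
    show "A \<in> carrier_mat n n" "w \<in> carrier_vec n" unfolding A_def w_def by auto
    show "w \<noteq> 0\<^sub>v n"
    proof
      assume "w = 0\<^sub>v n"
      then have "w $ k = 0" using k by simp
      then show False using k nz by (simp add: w_def)
    qed
    show "map_mat of_int A *\<^sub>v w = z \<cdot>\<^sub>v w"
    proof (rule eq_vecI)
      fix i assume "i < dim_vec (z \<cdot>\<^sub>v w)"
      then have i: "i < n" by (simp add: w_def)
      have "z * v (h i) = (\<Sum>j\<in>I. of_int (c (h i) j) * v j)" by (rule c[OF hI[OF i]])
      also have "\<dots> = (\<Sum>j<n. of_int (c (h i) (h j)) * v (h j))"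
        using sum.reindex_bij_betw[OF h, of "\<lambda>j. of_int (c (h i) j) * v j"] by (simp add: n_def)
      finally show "(map_mat of_int A *\<^sub>v w) $ i = (z \<cdot>\<^sub>v w) $ i"
        using i by (simp add: A_def w_def scalar_prod_def atLeast0LessThan)
    qed (simp add: A_def w_def)
  qed
qed

lemma algebraic_int_power_relation:
  assumes "algebraic_int (x::complex)"
  obtains d :: nat and c :: "nat \<Rightarrow> int" where "d > 0" "x ^ d = (\<Sum>i<d. of_int (c i) * x ^ i)"
proof -
  obtain p where p: "poly (map_poly of_int p) x = 0" "lead_coeff p = 1"
    using assms unfolding algebraic_int_altdef_ipoly by blast
  define d where "d = degree p"
  have "0 = (\<Sum>i\<le>d. of_int (coeff p i) * x ^ i)"
    using p(1) by (simp add: poly_altdef d_def)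
  also have "\<dots> = (\<Sum>i<d. of_int (coeff p i) * x ^ i) + x ^ d"
    using p(2) by (simp add: d_def lessThan_Suc_atMost[symmetric])
  finally have *: "x ^ d = (\<Sum>i<d. of_int (- coeff p i) * x ^ i)"
    by (simp add: sum_negf add_eq_0_iff)
  have "d > 0"
  proof (rule ccontr)
    assume "\<not> d > 0"
    then have "degree p = 0" by (simp add: d_def)
    then show False using p by (auto elim!: degree_eq_zeroE)
  qed
  then show ?thesis using * by (rule that)
qed

text \<open>The monomials \<open>x ^ i * y ^ j\<close> with exponents below the degrees of two monic
  relations span a module stable under both \<open>x\<close> and \<open>y\<close>: the relations
  rewrite the powers that overflow.\<close>

lemma algebraic_int_add_mult:
  assumes "algebraic_int (x::complex)" "algebraic_int y"
  shows "algebraic_int (x + y)" "algebraic_int (x * y)"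
proof -
  obtain d c where d: "d > 0" "x ^ d = (\<Sum>i<d. of_int (c i) * x ^ i)"
    by (rule algebraic_int_power_relation[OF assms(1)])
  obtain e c' where e: "e > 0" "y ^ e = (\<Sum>i<e. of_int (c' i) * y ^ i)"
    by (rule algebraic_int_power_relation[OF assms(2)])
  define I where "I = {..<d} \<times> {..<e}"
  define v where "v = (\<lambda>(i::nat, j::nat). x ^ i * y ^ j)"
  have fin: "finite I" by (simp add: I_def)
  have X: "x * v i \<in> int_span I v" if iI: "i \<in> I" for i
  proof -
    obtain a b where i: "i = (a, b)" "a < d" "b < e" using iI unfolding I_def by (elim SigmaE) auto
    show ?thesis
    proof (cases "Suc a < d")
      case True
      then have "x * v i = v (Suc a, b)" using i by (simp add: v_def)
      then show ?thesis using True i fin by (simp add: int_span_base I_def)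
    next
      case False
      then have "d = Suc a" using i by simp
      then have "x * v i = x ^ d * y ^ b" using i by (simp add: v_def)
      also have "\<dots> = (\<Sum>k<d. of_int (c k) * v (k, b))"
        by (simp add: d(2) v_def sum_distrib_right mult.assoc)
      also have "\<dots> \<in> int_span I v"
        using i fin by (intro int_span_sum int_span_scale int_span_base) (auto simp: I_def)
      finally show ?thesis .
    qed
  qed
  have Y: "y * v i \<in> int_span I v" if iI: "i \<in> I" for i
  proof -
    obtain a b where i: "i = (a, b)" "a < d" "b < e" using iI unfolding I_def by (elim SigmaE) auto
    show ?thesis
    proof (cases "Suc b < e")
      case True
      then have "y * v i = v (a, Suc b)" using i by (simp add: v_def)
      then show ?thesis using True i fin by (simp add: int_span_base I_def)
    next
      case False
      then have "e = Suc b" using i by simp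
      then have "y * v i = x ^ a * y ^ e" using i by (simp add: v_def)
      also have "\<dots> = (\<Sum>k<e. of_int (c' k) * v (a, k))"
        by (simp add: e(2) v_def sum_distrib_left mult_ac)
      also have "\<dots> \<in> int_span I v"
        using i fin by (intro int_span_sum int_span_scale int_span_base) (auto simp: I_def)
      finally show ?thesis .
    qed
  qed
  have i0: "(0, 0) \<in> I" "v (0, 0) \<noteq> 0" using d e by (auto simp: I_def v_def)
  show "algebraic_int (x + y)"
    by (rule algebraic_int_if_stable_span[where v = v, OF fin i0]) (auto simp: distrib_right intro!: int_span_add X Y)
  show "algebraic_int (x * y)"
    by (rule algebraic_int_if_stable_span[where v = v, OF fin i0]) (auto simp: mult.assoc intro!: int_span_stable[OF fin X] Y)
qed

lemma algebraic_int_diff: "algebraic_int (x::complex) \<Longrightarrow> algebraic_int y \<Longrightarrow> algebraic_int (x - y)"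
  using algebraic_int_add_mult(1)[of x "- y"] by simp

lemma algebraic_int_power: "algebraic_int (x::complex) \<Longrightarrow> algebraic_int (x ^ n)"
  by (induction n) (auto intro: algebraic_int_add_mult(2) int_imp_algebraic_int)

lemma algebraic_int_sum: "(\<And>i. i \<in> A \<Longrightarrow> algebraic_int (f i :: complex)) \<Longrightarrow> algebraic_int (sum f A)"
  by (induction A rule: infinite_finite_induct) (auto intro: algebraic_int_add_mult)

section \<open>Clearing denominators of algebraic numbers\<close>

lemma algebraic_int_multiple:
  assumes "algebraic (x::complex)"
  obtains m :: int where "m \<noteq> 0" "algebraic_int (of_int m * x)"
proof -
  obtain p where p: "\<And>i. coeff p i \<in> \<int>" "p \<noteq> 0" "poly p x = 0"
    using assms unfolding algebraic_def by blast
  obtain m where m: "lead_coeff p = of_int m" using p(1)[of "degree p"] by (auto elim: Ints_cases)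
  define n where "n = degree p"
  define d where "d = n - 1"
  have n: "n = Suc d"
  proof -
    have "n \<noteq> 0" using p(2,3) unfolding n_def by (auto elim!: degree_eq_zeroE)
    then show ?thesis by (simp add: d_def)
  qed
  have m0: "m \<noteq> 0" using m p(2) by auto
  define z where "z = of_int m * x"
  define I where "I = {..<n}"
  define v where "v = (\<lambda>i. z ^ i)"
  have "algebraic_int z"
  proof (rule algebraic_int_if_stable_span[of I 0 v])
    show "finite I" "0 \<in> I" "v 0 \<noteq> 0" using n by (auto simp: I_def v_def)
    fix i assume i: "i \<in> I"
    show "z * v i \<in> int_span I v"
    proof (cases "Suc i < n")
      case True
      then have "z * v i = v (Suc i)" by (simp add: v_def)
      then show ?thesis using True by (simp add: I_def int_span_base)
    next
      case False
      then have e: "i = d" using i n by (simp add: I_def)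
      have "\<forall>i. \<exists>k. coeff p i = of_int k" using p(1) by (auto simp: Ints_def)
      from choice[OF this] obtain c where c: "\<And>i. coeff p i = of_int (c i)" by (elim exE) simp
      have "0 = (\<Sum>i\<le>n. of_int (c i) * x ^ i)"
        using p(3) c by (simp add: poly_altdef n_def)
      also have "\<dots> = (\<Sum>i<n. of_int (c i) * x ^ i) + of_int m * x ^ n"
        using m c by (simp add: n_def lessThan_Suc_atMost[symmetric])
      finally have "of_int m * x ^ n = - (\<Sum>i<n. of_int (c i) * x ^ i)"
        by (simp add: eq_neg_iff_add_eq_0 add.commute)
      \<comment> \<open>Scaling by \<open>m ^ d\<close>, where n = d + 1, makes the relation monic
        in \<open>z = m * x\<close>: splitting \<open>m ^ d\<close> as
        \<open>m ^ (d - i) * m ^ i\<close> leaves integral lower coefficients.\<close>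
      then have "of_int m ^ d * (of_int m * x ^ n) = - (\<Sum>i<n. of_int m ^ d * (of_int (c i) * x ^ i))"
        by (simp add: sum_distrib_left)
      also have "\<dots> = - (\<Sum>i<n. of_int (c i * m ^ (d - i)) * z ^ i)"
      proof -
        have "of_int m ^ d * (of_int (c i) * x ^ i) = of_int (c i * m ^ (d - i)) * z ^ i" if "i < n" for i
        proof -
          have "m ^ d = m ^ (d - i) * m ^ i" using that n by (simp add: power_add[symmetric])
          then have "(of_int m :: complex) ^ d = of_int m ^ (d - i) * of_int m ^ i" by (metis of_int_mult of_int_power)
          then show ?thesis by (simp add: z_def power_mult_distrib)
        qed
        then show ?thesis by (intro arg_cong[where f = uminus] sum.cong) auto
      qed
      finally have "z ^ n = (\<Sum>i<n. of_int (- (c i * m ^ (d - i))) * v i)"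
        by (simp add: z_def n power_mult_distrib sum_negf v_def mult_ac)
      moreover have "z * v i = z ^ n" using e n by (simp add: v_def)
      ultimately have "z * v i = (\<Sum>i<n. of_int (- (c i * m ^ (d - i))) * v i)" by (rule trans[rotated])
      then show ?thesis unfolding int_span_def I_def by (intro CollectI exI)
    qed
  qed
  then show ?thesis using that m0 z_def by blast
qed

lemma algebraic_divide_int:
  assumes "algebraic_int (of_int m * x :: complex)" "m \<noteq> 0"
  shows "algebraic x"
proof -
  obtain p :: "int poly" where p: "poly (map_poly of_int p) (of_int m * x) = 0" "lead_coeff p = 1"
    using assms unfolding algebraic_int_altdef_ipoly by blast
  have p0: "p \<noteq> 0" using p(2) by auto
  have "poly (pcompose (map_poly of_int p) [:0, of_int m:]) x = 0"
    using p(1) by (simp add: poly_pcompose mult.commute)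
  then have "poly (map_poly of_int (pcompose p [:0, m:])) x = 0"
    using assms(2) by (simp only: of_int_hom.map_poly_pcompose) (simp add: map_poly_pCons)
  moreover have "pcompose p [:0, m:] \<noteq> 0"
    using assms(2) p0 by (simp add: pcompose_eq_0_iff)
  ultimately show ?thesis
    by (intro algebraicI[of "map_poly of_int (pcompose p [:0, m:])"]) (simp_all add: coeff_map_poly del: of_int_hom.map_poly_pcompose)
qed

lemma algebraic_add_mult:
  assumes "algebraic (x::complex)" "algebraic y"
  shows "algebraic (x + y)" "algebraic (x * y)"
proof -
  obtain m where m: "m \<noteq> 0" "algebraic_int (of_int m * x)" using algebraic_int_multiple[OF assms(1)] .
  obtain k where k: "k \<noteq> 0" "algebraic_int (of_int k * y)" using algebraic_int_multiple[OF assms(2)] .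
  have "algebraic_int (of_int (m * k) * (x + y))"
    using algebraic_int_add_mult(1)[OF algebraic_int_add_mult(2)[OF algebraic_int_of_int[of k] m(2)]
        algebraic_int_add_mult(2)[OF algebraic_int_of_int[of m] k(2)]] by (simp add: algebra_simps)
  then show "algebraic (x + y)" by (rule algebraic_divide_int) (use m k in auto)
  have "algebraic_int (of_int (m * k) * (x * y))"
    using algebraic_int_add_mult(2)[OF m(2) k(2)] by (simp add: algebra_simps)
  then show "algebraic (x * y)" by (rule algebraic_divide_int) (use m k in auto)
qed

section \<open>Extension of partial isomorphisms\<close>

text \<open>Partial isomorphisms are represented by their graphs, so that Zorn's lemma applies to set
  inclusion and passing to the inverse is taking the converse relation.\<close>
definition iso_graph :: "(complex \<times> complex) set \<Rightarrow> bool" where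
  "iso_graph r \<longleftrightarrow> (1, 1) \<in> r \<and>
     (\<forall>x y x' y'. (x, y) \<in> r \<longrightarrow> (x', y') \<in> r \<longrightarrow> (x - x', y - y') \<in> r \<and> (x * x', y * y') \<in> r) \<and>
     (\<forall>x y. (x, y) \<in> r \<longrightarrow> (x = 0 \<longleftrightarrow> y = 0))"

lemma iso_graph_1: "iso_graph r \<Longrightarrow> (1, 1) \<in> r"
  and iso_graph_diff: "iso_graph r \<Longrightarrow> (x, y) \<in> r \<Longrightarrow> (x', y') \<in> r \<Longrightarrow> (x - x', y - y') \<in> r"
  and iso_graph_mult: "iso_graph r \<Longrightarrow> (x, y) \<in> r \<Longrightarrow> (x', y') \<in> r \<Longrightarrow> (x * x', y * y') \<in> r"
  and iso_graph_eq_0: "iso_graph r \<Longrightarrow> (x, y) \<in> r \<Longrightarrow> x = 0 \<longleftrightarrow> y = 0"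
  unfolding iso_graph_def by blast+

lemma iso_graph_0: "iso_graph r \<Longrightarrow> (0, 0) \<in> r"
  using iso_graph_diff[of r 1 1 1 1] iso_graph_1 by simp

lemma iso_graph_minus: "iso_graph r \<Longrightarrow> (x, y) \<in> r \<Longrightarrow> (- x, - y) \<in> r"
  using iso_graph_diff[of r 0 0 x y] iso_graph_0 by simp

lemma iso_graph_add: "iso_graph r \<Longrightarrow> (x, y) \<in> r \<Longrightarrow> (x', y') \<in> r \<Longrightarrow> (x + x', y + y') \<in> r"
  using iso_graph_diff[of r x y "- x'" "- y'"] iso_graph_minus by simp

text \<open>The difference of the two pairs is \<open>(0, y - y')\<close>, to which the zero
  condition applies. That single condition thus makes the relation single-valued, and by symmetry
  injective.\<close>

lemma iso_graph_fun: "iso_graph r \<Longrightarrow> (x, y) \<in> r \<Longrightarrow> (x, y') \<in> r \<Longrightarrow> y = y'"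
  using iso_graph_diff[of r x y x y'] iso_graph_eq_0[of r 0 "y - y'"] by simp

lemma iso_graph_inj: "iso_graph r \<Longrightarrow> (x, y) \<in> r \<Longrightarrow> (x', y) \<in> r \<Longrightarrow> x = x'"
  using iso_graph_diff[of r x y x' y] iso_graph_eq_0[of r "x - x'" 0] by simp

lemma iso_graph_converse: "iso_graph r \<Longrightarrow> iso_graph (r\<inverse>)"
  unfolding iso_graph_def by auto

lemma iso_graph_of_nat: "iso_graph r \<Longrightarrow> (of_nat n, of_nat n) \<in> r"
  by (induction n) (auto intro: iso_graph_add iso_graph_1 iso_graph_0)

lemma iso_graph_of_int: "iso_graph r \<Longrightarrow> (of_int m, of_int m) \<in> r"
  by (cases m rule: int_diff_cases) (auto intro: iso_graph_diff iso_graph_of_nat)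

lemma iso_graph_sum:
  "iso_graph r \<Longrightarrow> (\<And>i. i \<in> A \<Longrightarrow> (f i, g i) \<in> r) \<Longrightarrow> (sum f A, sum g A) \<in> r"
  by (induction A rule: infinite_finite_induct) (auto intro: iso_graph_0 iso_graph_add)

lemma iso_graph_Union:
  assumes "subset.chain {r. iso_graph r \<and> r0 \<subseteq> r} C" "C \<noteq> {}"
  shows "iso_graph (\<Union>C)" "r0 \<subseteq> \<Union>C"
proof -
  have C: "iso_graph r" "r0 \<subseteq> r" if "r \<in> C" for r
    using assms that by (auto simp: subset.chain_def)
  have lin: "r \<subseteq> r' \<or> r' \<subseteq> r" if "r \<in> C" "r' \<in> C" for r r'
    using assms(1) that unfolding subset.chain_def by blast
  have two: "\<exists>r\<in>C. u \<in> r \<and> v \<in> r" if uv: "u \<in> \<Union>C" "v \<in> \<Union>C" for u v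
  proof -
    from uv obtain r r' where "r \<in> C" "u \<in> r" "r' \<in> C" "v \<in> r'" by auto
    then show ?thesis using lin[of r r'] by auto
  qed
  obtain r where r: "r \<in> C" using assms(2) by auto
  show "r0 \<subseteq> \<Union>C" using C(2)[OF r] r by auto
  have "(x - x', y - y') \<in> \<Union>C \<and> (x * x', y * y') \<in> \<Union>C"
    if xy: "(x, y) \<in> \<Union>C" "(x', y') \<in> \<Union>C" for x y x' y'
    using two[OF xy] C(1) iso_graph_diff iso_graph_mult by blast
  moreover have "x = 0 \<longleftrightarrow> y = 0" if xy: "(x, y) \<in> \<Union>C" for x y
    using xy C(1) iso_graph_eq_0 by blast
  moreover have "(1, 1) \<in> \<Union>C" using r iso_graph_1[OF C(1)[OF r]] by auto
  ultimately show "iso_graph (\<Union>C)" unfolding iso_graph_def by simp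
qed

lemma iso_graph_maximal:
  assumes "iso_graph r0"
  obtains M where "iso_graph M" "r0 \<subseteq> M" "\<And>r. iso_graph r \<Longrightarrow> M \<subseteq> r \<Longrightarrow> r = M"
proof -
  have "\<exists>M\<in>{r. iso_graph r \<and> r0 \<subseteq> r}. \<forall>X\<in>{r. iso_graph r \<and> r0 \<subseteq> r}. M \<subseteq> X \<longrightarrow> X = M"
    by (rule subset_Zorn_nonempty) (use assms iso_graph_Union in auto)
  then show ?thesis using that by auto
qed

text \<open>The induced isomorphism of fraction fields. Applied to a maximal graph it shows that the
  domain is a field, so that minimal polynomials over it can be made monic.\<close>

lemma iso_graph_fractions:
  assumes "iso_graph r"
  shows "iso_graph {(x / u, y / v) |x y u v. (x, y) \<in> r \<and> (u, v) \<in> r \<and> u \<noteq> 0}"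
    (is "iso_graph ?f")
  unfolding iso_graph_def
proof (intro conjI allI impI)
  have "(1 / 1, 1 / 1) \<in> ?f" using iso_graph_1[OF assms] zero_neq_one[symmetric] by blast
  then show "(1, 1) \<in> ?f" by simp
next
  fix a b a' b' assume "(a, b) \<in> ?f" "(a', b') \<in> ?f"
  then obtain x y u v x' y' u' v' where h: "a = x / u" "b = y / v" "a' = x' / u'" "b' = y' / v'"
    "(x, y) \<in> r" "(u, v) \<in> r" "u \<noteq> 0" "(x', y') \<in> r" "(u', v') \<in> r" "u' \<noteq> 0" by blast
  have nz: "v \<noteq> 0" "v' \<noteq> 0" using h(7,10) iso_graph_eq_0[OF assms h(6)] iso_graph_eq_0[OF assms h(9)] by simp_all
  have "a - a' = (x * u' - x' * u) / (u * u')" "b - b' = (y * v' - y' * v) / (v * v')"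
    using h nz by (auto simp: field_simps)
  moreover have "(x * u' - x' * u, y * v' - y' * v) \<in> r" "(u * u', v * v') \<in> r" "u * u' \<noteq> 0"
    using h by (auto intro!: iso_graph_diff[OF assms] iso_graph_mult[OF assms])
  ultimately show "(a - a', b - b') \<in> ?f" by blast
  have "a * a' = (x * x') / (u * u')" "b * b' = (y * y') / (v * v')"
    using h by auto
  moreover have "(x * x', y * y') \<in> r" "(u * u', v * v') \<in> r" "u * u' \<noteq> 0"
    using h by (auto intro!: iso_graph_mult[OF assms])
  ultimately show "(a * a', b * b') \<in> ?f" by blast
next
  fix a b assume "(a, b) \<in> ?f"
  then obtain x y u v where h: "a = x / u" "b = y / v" "(x, y) \<in> r" "(u, v) \<in> r" "u \<noteq> 0" by blast
  then show "a = 0 \<longleftrightarrow> b = 0"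
    using iso_graph_eq_0[OF assms h(3)] iso_graph_eq_0[OF assms h(4)] by simp
qed

text \<open>The graph of the isomorphism of polynomial rings that \<open>r\<close> induces on
  coefficients.\<close>

definition poly_pairs :: "(complex \<times> complex) set \<Rightarrow> (complex poly \<times> complex poly) set" where
  "poly_pairs r = {(p, q). \<forall>i. (coeff p i, coeff q i) \<in> r}"

lemma poly_pairsD: "(p, q) \<in> poly_pairs r \<Longrightarrow> (coeff p i, coeff q i) \<in> r"
  by (simp add: poly_pairs_def)

lemma poly_pairs_degree: "iso_graph r \<Longrightarrow> (p, q) \<in> poly_pairs r \<Longrightarrow> degree p = degree q"
  unfolding poly_pairs_def degree_def
  by (rule arg_cong[where f = Least]) (use iso_graph_eq_0 in blast)

lemma poly_pairs_eq_0: "iso_graph r \<Longrightarrow> (p, q) \<in> poly_pairs r \<Longrightarrow> p = 0 \<longleftrightarrow> q = 0"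
  by (metis iso_graph_eq_0 poly_pairsD poly_eq_iff coeff_0)

lemma poly_pairs_diff:
  "iso_graph r \<Longrightarrow> (p, q) \<in> poly_pairs r \<Longrightarrow> (p', q') \<in> poly_pairs r \<Longrightarrow> (p - p', q - q') \<in> poly_pairs r"
  by (auto simp: poly_pairs_def intro: iso_graph_diff)

lemma poly_pairs_add:
  "iso_graph r \<Longrightarrow> (p, q) \<in> poly_pairs r \<Longrightarrow> (p', q') \<in> poly_pairs r \<Longrightarrow> (p + p', q + q') \<in> poly_pairs r"
  by (auto simp: poly_pairs_def intro: iso_graph_add)

lemma poly_pairs_mult:
  "iso_graph r \<Longrightarrow> (p, q) \<in> poly_pairs r \<Longrightarrow> (p', q') \<in> poly_pairs r \<Longrightarrow> (p * p', q * q') \<in> poly_pairs r"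
  by (auto simp: poly_pairs_def coeff_mult intro!: iso_graph_sum iso_graph_mult)

lemma poly_pairs_monom: "iso_graph r \<Longrightarrow> (c, d) \<in> r \<Longrightarrow> (monom c n, monom d n) \<in> poly_pairs r"
  by (auto simp: poly_pairs_def iso_graph_0)

lemma poly_pairs_const: "iso_graph r \<Longrightarrow> (c, d) \<in> r \<Longrightarrow> ([:c:], [:d:]) \<in> poly_pairs r"
  using poly_pairs_monom[of r c d 0] by (simp add: monom_0)

text \<open>Long division by a monic polynomial uses only ring operations on the coefficients;
  performed on both sides at once, it keeps quotients and remainders paired.\<close>

lemma poly_pairs_division:
  assumes r: "iso_graph r" and m: "(m, n) \<in> poly_pairs r" "lead_coeff m = 1" "lead_coeff n = 1"
    and p: "(p, q) \<in> poly_pairs r" and d: "degree m > 0"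
  shows "\<exists>s s' t t'. (t, t') \<in> poly_pairs r \<and> p = m * s + t \<and> q = n * s' + t' \<and> (s, s') \<in> poly_pairs r
           \<and> degree t < degree m"
  using p
proof (induction "degree p" arbitrary: p q rule: less_induct)
  case less
  have z: "(0, 0) \<in> poly_pairs r" by (simp add: poly_pairs_def iso_graph_0[OF r])
  show ?case
  proof (cases "degree p < degree m")
    case True
    then show ?thesis using less.prems z by (intro exI[of _ 0] exI[of _ p] exI[of _ q]) auto
  next
    case False
    define k where "k = degree p - degree m"
    define u where "u = monom (lead_coeff p) k"
    define u' where "u' = monom (lead_coeff q) k"
    have deq: "degree p = degree q" "degree m = degree n"
      using poly_pairs_degree[OF r] less.prems m by auto
    have u: "(u, u') \<in> poly_pairs r"
      unfolding u_def u'_def using deq poly_pairsD[OF less.prems, of "degree p"] by (auto intro!: poly_pairs_monom[OF r])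
    have P: "(p - m * u, q - n * u') \<in> poly_pairs r"
      by (intro poly_pairs_diff poly_pairs_mult r less.prems m u)
    have p0: "lead_coeff p \<noteq> 0" using False d by auto
    have "degree (m * u) = degree p"
      using p0 m(2) False unfolding u_def k_def
      by (subst degree_mult_eq) (auto simp: degree_monom_eq)
    moreover have "lead_coeff (m * u) = lead_coeff p"
      using m(2) p0 by (simp only: lead_coeff_mult) (simp add: u_def degree_monom_eq)
    moreover have "degree p \<noteq> 0" using False d by simp
    ultimately have "degree (p - m * u) < degree p"
      using degree_diff_le[of p "degree p" "m * u"]
      by (metis cancel_comm_monoid_add_class.diff_cancel coeff_diff le_refl leading_coeff_0_iff
          less_le degree_0)
    from less.hyps[OF this P] obtain s s' t t' where h: "(t, t') \<in> poly_pairs r" "p - m * u = m * s + t"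
        "q - n * u' = n * s' + t'" "(s, s') \<in> poly_pairs r" "degree t < degree m" by blast
    show ?thesis
      using h u by (intro exI[of _ "s + u"] exI[of _ "s' + u'"] exI[of _ t] exI[of _ t'])
        (auto intro: poly_pairs_add[OF r] simp: algebra_simps)
  qed
qed

lemma poly_pairs_scale:
  assumes "iso_graph r" "(p, q) \<in> poly_pairs r" "(c, d) \<in> r"
  shows "(Polynomial.smult c p, Polynomial.smult d q) \<in> poly_pairs r"
  using assms by (auto simp: poly_pairs_def intro: iso_graph_mult)

text \<open>The hypotheses say that \<open>m\<close> is the minimal polynomial of \<open>a\<close> over the domain of \<open>r\<close>.\<close>
lemma iso_graph_adjoin:
  assumes r: "iso_graph r" and inv: "\<And>x y. (x, y) \<in> r \<Longrightarrow> (inverse x, inverse y) \<in> r"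
    and m: "(m, n) \<in> poly_pairs r" "lead_coeff m = 1" "poly m a = 0" "poly n b = 0"
    and min: "\<And>p q. (p, q) \<in> poly_pairs r \<Longrightarrow> poly p a = 0 \<Longrightarrow> p \<noteq> 0 \<Longrightarrow> degree m \<le> degree p"
  shows "\<exists>r'. iso_graph r' \<and> r \<subseteq> r' \<and> (a, b) \<in> r'"
proof -
  have n1: "lead_coeff n = 1"
  proof -
    have "(1, lead_coeff n) \<in> r"
      using poly_pairsD[OF m(1), of "degree m"] m(2) poly_pairs_degree[OF r m(1)] by simp
    then show ?thesis using iso_graph_fun[OF r iso_graph_1[OF r]] by metis
  qed
  have d: "degree m > 0"
    using m(2,3) by (cases "degree m = 0") (auto elim!: degree_eq_zeroE)
  have minb: "degree m \<le> degree p" if pq: "(p, q) \<in> poly_pairs r" "poly q b = 0" "p \<noteq> 0" for p q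
  proof -
    let ?P = "\<lambda>k. \<exists>p q. (p, q) \<in> poly_pairs r \<and> poly q b = 0 \<and> p \<noteq> 0 \<and> degree p = k"
    define k where "k = (LEAST k. ?P k)"
    have ex: "?P (degree p)" using pq by blast
    have k: "?P k" unfolding k_def using ex by (rule LeastI)
    have kmin: "k \<le> degree p'" if "(p', q') \<in> poly_pairs r" "poly q' b = 0" "p' \<noteq> 0" for p' q'
      unfolding k_def by (rule Least_le) (use that in blast)
    obtain t t' where t: "(t, t') \<in> poly_pairs r" "poly t' b = 0" "t \<noteq> 0" "degree t = k" using k by blast
    define c where "c = inverse (lead_coeff t)"
    define c' where "c' = inverse (lead_coeff t')"
    have t'0: "t' \<noteq> 0" using poly_pairs_eq_0[OF r t(1)] t(3) by simp
    have cc: "(c, c') \<in> r"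
      unfolding c_def c'_def using inv poly_pairsD[OF t(1), of "degree t"] poly_pairs_degree[OF r t(1)] by simp
    have c0: "c \<noteq> 0" "c' \<noteq> 0" using t(3) t'0 by (auto simp: c_def c'_def)
    define w where "w = Polynomial.smult c t"
    define w' where "w' = Polynomial.smult c' t'"
    have w: "(w, w') \<in> poly_pairs r" "poly w' b = 0" "w \<noteq> 0" "degree w = k" "lead_coeff w = 1" "lead_coeff w' = 1"
      using t c0 t'0 poly_pairs_scale[OF r t(1) cc] by (auto simp: w_def w'_def c_def c'_def)
    have "degree w > 0"
    proof (rule ccontr)
      assume "\<not> degree w > 0"
      then have "degree w' = 0" using poly_pairs_degree[OF r w(1)] by simp
      then show False using w(2,6) by (auto elim!: degree_eq_zeroE)
    qed
    from poly_pairs_division[OF r w(1,5,6) m(1) this] obtain s s' u u' where h: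
      "(u, u') \<in> poly_pairs r" "m = w * s + u" "n = w' * s' + u'" "(s, s') \<in> poly_pairs r" "degree u < degree w" by blast
    have "poly u' b = 0" using m(4) w(2) h(3) by simp
    with kmin[OF h(1)] h(5) w(4) have "u = 0" by linarith
    then have ms: "m = w * s" using h(2) by simp
    have m0: "m \<noteq> 0" using m(2) by auto
    then have ws: "w \<noteq> 0" "s \<noteq> 0" using ms by auto
    then have dm: "degree m = degree w + degree s" using ms by (simp add: degree_mult_eq)
    have "poly w a = 0 \<or> poly s a = 0" using m(3) ms by simp
    then have "degree m \<le> degree w"
    proof
      assume "poly w a = 0" then show ?thesis using min[OF w(1)] ws by simp
    next
      assume "poly s a = 0" then have "degree m \<le> degree s" using min[OF h(4)] ws by simp
      with dm \<open>degree w > 0\<close> show ?thesis by simp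
    qed
    then show ?thesis using w(4) kmin[OF pq] by simp
  qed
  \<comment> \<open>Reduction modulo \<open>m\<close> and \<open>n\<close> leaves paired remainders
    of lower degree, which vanish at \<open>a\<close> or \<open>b\<close> only if they are zero.
    This is the zero condition for the graph \<open>r'\<close> of values at \<open>a\<close> and
    \<open>b\<close>.\<close>
  have key: "poly p a = 0 \<longleftrightarrow> poly q b = 0" if pq: "(p, q) \<in> poly_pairs r" for p q
  proof -
    obtain s s' u u' where h: "(u, u') \<in> poly_pairs r" "p = m * s + u" "q = n * s' + u'" "degree u < degree m"
      using poly_pairs_division[OF r m(1,2) n1 pq d] by blast
    have "poly u a = 0 \<Longrightarrow> u = 0" using min[OF h(1)] h(4) by fastforce
    moreover have "poly u' b = 0 \<Longrightarrow> u = 0" using minb[OF h(1)] h(4) by fastforce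
    moreover have "u = 0 \<longleftrightarrow> u' = 0" by (rule poly_pairs_eq_0[OF r h(1)])
    moreover have "poly p a = poly u a" "poly q b = poly u' b" using h m by auto
    ultimately show ?thesis by (metis poly_0)
  qed
  define r' where "r' = {(poly p a, poly q b) |p q. (p, q) \<in> poly_pairs r}"
  have rr': "(poly p a, poly q b) \<in> r'" if "(p, q) \<in> poly_pairs r" for p q using that unfolding r'_def by blast
  have "iso_graph r'"
    unfolding iso_graph_def
  proof (intro conjI allI impI)
    show "(1, 1) \<in> r'" using rr'[OF poly_pairs_const[OF r iso_graph_1[OF r]]] by simp
  next
    fix x y x' y' assume "(x, y) \<in> r'" "(x', y') \<in> r'"
    then obtain p q p' q' where h: "(p, q) \<in> poly_pairs r" "(p', q') \<in> poly_pairs r"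
      "x = poly p a" "y = poly q b" "x' = poly p' a" "y' = poly q' b" unfolding r'_def by blast
    show "(x - x', y - y') \<in> r'" using rr'[OF poly_pairs_diff[OF r h(1,2)]] h by simp
    show "(x * x', y * y') \<in> r'" using rr'[OF poly_pairs_mult[OF r h(1,2)]] h by simp
  next
    fix x y assume "(x, y) \<in> r'"
    then obtain p q where "(p, q) \<in> poly_pairs r" "x = poly p a" "y = poly q b" unfolding r'_def by blast
    then show "x = 0 \<longleftrightarrow> y = 0" using key by simp
  qed
  moreover have "r \<subseteq> r'"
  proof
    fix u assume "u \<in> r"
    then show "u \<in> r'" using rr'[OF poly_pairs_const[OF r, of "fst u" "snd u"]] by simp
  qed
  moreover have "(a, b) \<in> r'"
    using rr'[OF poly_pairs_monom[OF r iso_graph_1[OF r], of 1]] by (simp add: poly_monom)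
  ultimately show ?thesis by blast
qed

text \<open>The minimal polynomial of \<open>a\<close> over the domain of \<open>M\<close> is
  transported along \<open>M\<close>; its image has a complex root \<open>b\<close>, so
  \<open>M\<close> extends to a graph containing \<open>(a, b)\<close>, which by maximality is
  \<open>M\<close>.\<close>

lemma iso_graph_maximal_algebraic:
  assumes M: "iso_graph M" and mx: "\<And>r. iso_graph r \<Longrightarrow> M \<subseteq> r \<Longrightarrow> r = M"
    and a: "algebraic a"
  shows "\<exists>b. (a, b) \<in> M"
proof -
  have inv: "(inverse x, inverse y) \<in> M" if xy: "(x, y) \<in> M" for x y
  proof (cases "x = 0")
    case True
    then show ?thesis using iso_graph_eq_0[OF M xy] xy by simp
  next
    case False
    let ?f = "{(x / u, y / v) |x y u v. (x, y) \<in> M \<and> (u, v) \<in> M \<and> u \<noteq> 0}"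
    have "(x / 1, y / 1) \<in> ?f" if "(x, y) \<in> M" for x y
      using that iso_graph_1[OF M] zero_neq_one[symmetric] by blast
    then have "M \<subseteq> ?f" by (intro subrelI) simp
    then have "?f = M" using mx[OF iso_graph_fractions[OF M]] by blast
    moreover have "(1 / x, 1 / y) \<in> ?f" using xy False iso_graph_1[OF M] by blast
    ultimately show ?thesis by (simp add: inverse_eq_divide)
  qed
  obtain f where f: "\<And>i. coeff f i \<in> \<int>" "f \<noteq> 0" "poly f a = 0"
    using a unfolding algebraic_def by blast
  let ?P = "\<lambda>k. \<exists>p q. (p, q) \<in> poly_pairs M \<and> poly p a = 0 \<and> p \<noteq> 0 \<and> degree p = k"
  have "(f, f) \<in> poly_pairs M"
    unfolding poly_pairs_def using f(1) by (auto elim!: Ints_cases intro: iso_graph_of_int[OF M] split: prod.split) (metis Ints_cases f(1) iso_graph_of_int[OF M])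
  then have ex: "?P (degree f)" using f by blast
  define k where "k = (LEAST k. ?P k)"
  have k: "?P k" unfolding k_def using ex by (rule LeastI)
  obtain t t' where t: "(t, t') \<in> poly_pairs M" "poly t a = 0" "t \<noteq> 0" "degree t = k" using k by blast
  have kmin: "k \<le> degree p" if "(p, q) \<in> poly_pairs M" "poly p a = 0" "p \<noteq> 0" for p q
    unfolding k_def by (rule Least_le) (use that in blast)
  define c where "c = inverse (lead_coeff t)"
  define c' where "c' = inverse (lead_coeff t')"
  have cc: "(c, c') \<in> M"
    unfolding c_def c'_def using inv poly_pairsD[OF t(1), of "degree t"] poly_pairs_degree[OF M t(1)] by simp
  have c0: "c \<noteq> 0" using t(3) by (auto simp: c_def)
  define m where "m = Polynomial.smult c t"
  define n where "n = Polynomial.smult c' t'"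
  have m: "(m, n) \<in> poly_pairs M" "lead_coeff m = 1" "poly m a = 0" "degree m = k"
    using t c0 poly_pairs_scale[OF M t(1) cc] by (auto simp: m_def n_def c_def)
  have "degree m > 0"
    using m(2,3) by (cases "degree m = 0") (auto elim!: degree_eq_zeroE)
  then have "degree n > 0" using poly_pairs_degree[OF M m(1)] by simp
  then have "\<not> constant (poly n)" by (simp add: constant_degree)
  then obtain b where b: "poly n b = 0" using fundamental_theorem_of_algebra by blast
  obtain r' where "iso_graph r'" "M \<subseteq> r'" "(a, b) \<in> r'"
    using iso_graph_adjoin[OF M inv m(1,2,3) b] kmin m(4) by blast
  then show ?thesis using mx by blast
qed

text \<open>A maximal extension of \<open>r0\<close> has every algebraic number in its domain and,
  by the same argument for the converse, in its range. Paired numbers satisfy the same integer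
  polynomial equations, so the extension restricts to a bijection of the algebraic numbers, whatever
  it does to transcendental ones.\<close>

lemma qbar_aut_extending:
  assumes "iso_graph r0"
  shows "\<exists>s. qbar_aut s \<and> (\<forall>x y. (x, y) \<in> r0 \<longrightarrow> algebraic x \<longrightarrow> s x = y)"
proof -
  obtain M where M: "iso_graph M" "r0 \<subseteq> M" and mx: "\<And>r. iso_graph r \<Longrightarrow> M \<subseteq> r \<Longrightarrow> r = M"
    using iso_graph_maximal[OF assms] by blast
  have dom: "\<exists>y. (x, y) \<in> M" if "algebraic x" for x
    by (rule iso_graph_maximal_algebraic[OF M(1) _ that]) (rule mx)
  have ran: "\<exists>x. (x, y) \<in> M" if "algebraic y" for y
  proof -
    have "\<exists>x. (y, x) \<in> M\<inverse>"
    proof (rule iso_graph_maximal_algebraic[OF iso_graph_converse[OF M(1)] _ that])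
      fix r assume "iso_graph r" "M\<inverse> \<subseteq> r"
      then have "r\<inverse> = M" by (intro mx iso_graph_converse) auto
      then show "r = M\<inverse>" by auto
    qed
    then show ?thesis by blast
  qed
  have alg: "algebraic x \<longleftrightarrow> algebraic y" if xy: "(x, y) \<in> M" for x y
  proof -
    have pw: "(x ^ i, y ^ i) \<in> M" for i
      by (induction i) (auto intro: iso_graph_1[OF M(1)] iso_graph_mult[OF M(1)] xy)
    have "poly p x = 0 \<longleftrightarrow> poly p y = 0" if p: "\<And>i. coeff p i \<in> \<int>" for p
    proof -
      have "(poly p x, poly p y) \<in> M"
        unfolding poly_altdef
      proof (intro iso_graph_sum[OF M(1)] iso_graph_mult[OF M(1)] pw)
        show "(coeff p i, coeff p i) \<in> M" for i
          using p[of i] iso_graph_of_int[OF M(1)] by (auto elim!: Ints_cases)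
      qed
      then show ?thesis by (rule iso_graph_eq_0[OF M(1)])
    qed
    then show ?thesis unfolding algebraic_def by blast
  qed
  define s where "s = (\<lambda>x. SOME y. (x, y) \<in> M)"
  have sM: "(x, s x) \<in> M" if "algebraic x" for x
    unfolding s_def by (rule someI_ex[OF dom[OF that]])
  have sI: "s x = y" if "(x, y) \<in> M" "algebraic x" for x y
    using iso_graph_fun[OF M(1) sM[OF that(2)] that(1)] .
  have "qbar_aut s"
    unfolding qbar_aut_def
  proof (intro conjI allI impI)
    show "s 1 = 1" by (rule sI[OF iso_graph_1[OF M(1)]]) (simp add: rat_imp_algebraic)
    show "bij_betw s {z. algebraic z} {z. algebraic z}"
      unfolding bij_betw_def
    proof
      show "inj_on s {z. algebraic z}"
        by (intro inj_onI) (metis iso_graph_inj[OF M(1)] sM mem_Collect_eq)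
      show "s ` {z. algebraic z} = {z. algebraic z}"
      proof safe
        fix x :: complex assume "algebraic x" then show "algebraic (s x)" using alg sM by blast
      next
        fix y :: complex assume y: "algebraic y"
        then obtain x where x: "(x, y) \<in> M" using ran by blast
        then have "algebraic x" using alg y by blast
        then show "y \<in> s ` {z. algebraic z}" using sI[OF x] by blast
      qed
    qed
    fix x y :: complex assume xy: "algebraic x" "algebraic y"
    show "s (x + y) = s x + s y"
      using xy by (intro sI iso_graph_add[OF M(1)] sM algebraic_add_mult)
    show "s (x * y) = s x * s y"
      using xy by (intro sI iso_graph_mult[OF M(1)] sM algebraic_add_mult)
  qed
  moreover have "s x = y" if "(x, y) \<in> r0" "algebraic x" for x y
    using that M(2) sI by blast
  ultimately show ?thesis by blast
qed

section \<open>Automorphisms of the field of algebraic numbers\<close>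

lemma qbar_aut_algebraic: "qbar_aut s \<Longrightarrow> algebraic x \<Longrightarrow> algebraic (s x)"
  unfolding qbar_aut_def bij_betw_def by blast

lemma qbar_aut_add: "qbar_aut s \<Longrightarrow> algebraic x \<Longrightarrow> algebraic y \<Longrightarrow> s (x + y) = s x + s y"
  and qbar_aut_mult: "qbar_aut s \<Longrightarrow> algebraic x \<Longrightarrow> algebraic y \<Longrightarrow> s (x * y) = s x * s y"
  and qbar_aut_1: "qbar_aut s \<Longrightarrow> s 1 = 1"
  unfolding qbar_aut_def by blast+

lemma qbar_aut_inj: "qbar_aut s \<Longrightarrow> algebraic x \<Longrightarrow> algebraic y \<Longrightarrow> s x = s y \<longleftrightarrow> x = y"
  unfolding qbar_aut_def bij_betw_def inj_on_def by blast

lemma qbar_aut_surj: "qbar_aut s \<Longrightarrow> algebraic y \<Longrightarrow> \<exists>x. algebraic x \<and> s x = y"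
  unfolding qbar_aut_def bij_betw_def by (metis imageE mem_Collect_eq)

lemma algebraic_diff: "algebraic (x::complex) \<Longrightarrow> algebraic y \<Longrightarrow> algebraic (x - y)"
  using algebraic_add_mult(1)[of x "- y"] by simp

lemma qbar_aut_0: "qbar_aut s \<Longrightarrow> s 0 = 0"
  using qbar_aut_add[of s 0 0] by simp

lemma qbar_aut_diff: "qbar_aut s \<Longrightarrow> algebraic x \<Longrightarrow> algebraic y \<Longrightarrow> s (x - y) = s x - s y"
  using qbar_aut_add[of s "x - y" y] algebraic_diff by simp

lemma qbar_aut_eq_0: "qbar_aut s \<Longrightarrow> algebraic x \<Longrightarrow> s x = 0 \<longleftrightarrow> x = 0"
  using qbar_aut_inj[of s x 0] by (simp add: qbar_aut_0)

lemma qbar_aut_graph: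
  assumes "qbar_aut s"
  shows "iso_graph {(x, s x) |x. algebraic x}"
proof -
  let ?r = "{(x, s x) |x. algebraic x}"
  have I: "(x, y) \<in> ?r \<longleftrightarrow> algebraic x \<and> y = s x" for x y by blast
  show ?thesis
    unfolding iso_graph_def I
    by (simp add: qbar_aut_eq_0[OF assms] qbar_aut_1[OF assms] qbar_aut_diff[OF assms]
        qbar_aut_mult[OF assms] rat_imp_algebraic algebraic_diff algebraic_add_mult)
qed

lemma qbar_aut_of_int: "qbar_aut s \<Longrightarrow> s (of_int m) = of_int m"
  using iso_graph_of_int[OF qbar_aut_graph, of s m] by auto

lemma qbar_aut_sum:
  assumes "qbar_aut s" "\<And>i. i \<in> A \<Longrightarrow> algebraic (f i)"
  shows "s (sum f A) = (\<Sum>i\<in>A. s (f i)) \<and> algebraic (sum f A)"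
  using assms(2)
proof (induction A rule: infinite_finite_induct)
  case (insert a A)
  then have "s (sum f A) = (\<Sum>i\<in>A. s (f i))" "algebraic (sum f A)" "algebraic (f a)" by auto
  then show ?case
    using insert.hyps by (simp add: qbar_aut_add[OF assms(1)] algebraic_add_mult)
qed (simp_all add: qbar_aut_0[OF assms(1)])

lemma algebraic_power: "algebraic (x::complex) \<Longrightarrow> algebraic (x ^ n)"
  by (induction n) (auto intro: algebraic_add_mult rat_imp_algebraic)

lemma qbar_aut_power: "qbar_aut s \<Longrightarrow> algebraic x \<Longrightarrow> s (x ^ n) = s x ^ n"
  by (induction n) (auto simp: qbar_aut_1 qbar_aut_mult algebraic_power)

lemma qbar_aut_poly:
  assumes "qbar_aut s" "algebraic x"
  shows "s (poly (map_poly of_int p) x) = poly (map_poly of_int p) (s x)"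
proof -
  have "algebraic (of_int (coeff p i) * x ^ i)" for i
    by (intro algebraic_add_mult algebraic_of_int algebraic_power assms)
  then show ?thesis
    unfolding poly_altdef
    by (simp add: qbar_aut_sum[OF assms(1)] qbar_aut_mult[OF assms(1)] algebraic_of_int
        qbar_aut_of_int[OF assms(1)] qbar_aut_power[OF assms(1)] algebraic_power assms(2))
qed

lemma qbar_aut_algebraic_int:
  assumes "qbar_aut s" "algebraic_int x"
  shows "algebraic_int (s x)"
proof -
  obtain p where "poly (map_poly of_int p) x = 0" "lead_coeff p = 1"
    using assms(2) unfolding algebraic_int_altdef_ipoly by blast
  moreover from this have "poly (map_poly of_int p) (s x) = 0"
    using qbar_aut_poly[OF assms(1), of x p] qbar_aut_0[OF assms(1)] assms(2) by auto
  ultimately show ?thesis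
    unfolding algebraic_int_altdef_ipoly by blast
qed

lemma qbar_aut_id: "qbar_aut id"
  unfolding qbar_aut_def by auto

lemma qbar_aut_comp:
  assumes "qbar_aut s" "qbar_aut t"
  shows "qbar_aut (s \<circ> t)"
  unfolding qbar_aut_def
proof (intro conjI allI impI)
  show "bij_betw (s \<circ> t) {z. algebraic z} {z. algebraic z}"
    by (rule bij_betw_trans) (use assms in \<open>auto simp: qbar_aut_def\<close>)
qed (use assms in \<open>auto simp: qbar_aut_1 qbar_aut_add qbar_aut_mult qbar_aut_algebraic\<close>)

lemma qbar_aut_inverse:
  assumes "qbar_aut s"
  shows "\<exists>t. qbar_aut t \<and> (\<forall>x. algebraic x \<longrightarrow> t (s x) = x \<and> s (t x) = x)"
proof -
  obtain t where t: "qbar_aut t" "\<And>x y. (x, y) \<in> {(x, s x) |x. algebraic x}\<inverse> \<Longrightarrow> algebraic x \<Longrightarrow> t x = y"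
    using qbar_aut_extending[OF iso_graph_converse[OF qbar_aut_graph[OF assms]]] by blast
  have *: "t (s x) = x" if "algebraic x" for x
    using that qbar_aut_algebraic[OF assms that] by (intro t(2) converseI CollectI exI) simp_all
  have "s (t x) = x" if x: "algebraic x" for x
    using qbar_aut_surj[OF assms x] * by metis
  with t(1) * show ?thesis by blast
qed

text \<open>Stands in for compactness of the Galois group: the pairs \<open>(x, y)\<close> with
  \<open>S n x = y\<close> for all large \<open>n\<close> form a partial isomorphism, and any
  extension of it is a limit.\<close>

lemma qbar_aut_limit:
  fixes S :: "nat \<Rightarrow> complex \<Rightarrow> complex"
  assumes S: "\<And>n. qbar_aut (S n)"
  shows "\<exists>s. qbar_aut s \<and> (\<forall>x y N. algebraic x \<longrightarrow> (\<forall>n\<ge>N. S n x = y) \<longrightarrow> s x = y)"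
proof -
  define r where "r = {(x, y). algebraic x \<and> eventually (\<lambda>n. S n x = y) sequentially}"
  have "iso_graph r"
    unfolding iso_graph_def
  proof (intro conjI allI impI)
    show "(1, 1) \<in> r" by (simp add: r_def qbar_aut_1[OF S] rat_imp_algebraic)
  next
    fix x y x' y' assume "(x, y) \<in> r" "(x', y') \<in> r"
    then have h: "algebraic x" "algebraic x'" "eventually (\<lambda>n. S n x = y \<and> S n x' = y') sequentially"
      by (auto simp: r_def eventually_conj)
    show "(x - x', y - y') \<in> r"
      using h(1,2)
      by (auto simp: r_def qbar_aut_diff[OF S] intro!: algebraic_diff eventually_mono[OF h(3)])
    show "(x * x', y * y') \<in> r"
      using h(1,2)
      by (auto simp: r_def qbar_aut_mult[OF S] intro!: algebraic_add_mult eventually_mono[OF h(3)])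
  next
    fix x y assume "(x, y) \<in> r"
    then have "algebraic x" "eventually (\<lambda>n. S n x = y) sequentially" by (auto simp: r_def)
    then obtain n where "S n x = y" by (auto simp: eventually_sequentially)
    then show "x = 0 \<longleftrightarrow> y = 0" using qbar_aut_eq_0[OF S[of n] \<open>algebraic x\<close>] by auto
  qed
  from qbar_aut_extending[OF this]
  obtain s where s: "qbar_aut s" "\<And>x y. (x, y) \<in> r \<Longrightarrow> algebraic x \<Longrightarrow> s x = y" by metis
  have "s x = y" if "algebraic x" "\<forall>n\<ge>N. S n x = y" for x y N
    by (rule s(2)) (use that in \<open>auto simp: r_def eventually_sequentially\<close>)
  with s(1) show ?thesis by blast
qed

section \<open>Conjugates and fixed elements over the rationals\<close>

lemma rat_poly_clear_denominators:
  fixes p :: "complex poly"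
  assumes "\<And>i. coeff p i \<in> \<rat>"
  shows "\<exists>c q. c \<noteq> 0 \<and> Polynomial.smult (of_int c) p = map_poly of_int q"
  using assms
proof (induction p rule: pCons_induct)
  case 0
  show ?case by (intro exI[of _ 1] exI[of _ 0]) simp
next
  case (pCons a p)
  have "coeff p i \<in> \<rat>" for i using pCons.prems[of "Suc i"] by simp
  from pCons.IH[OF this] obtain c q where cq: "c \<noteq> 0" "Polynomial.smult (of_int c) p = map_poly of_int q" by blast
  have "a \<in> \<rat>" using pCons.prems[of 0] by simp
  then obtain u v where uv: "v > 0" "a = of_int u / of_int v" by (rule Rats_cases')
  have "Polynomial.smult (of_int (v * c)) (pCons a p) = pCons (of_int (c * u)) (Polynomial.smult (of_int v) (Polynomial.smult (of_int c) p))"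
    using uv by simp
  also have "\<dots> = map_poly of_int (pCons (c * u) (Polynomial.smult v q))"
    unfolding cq(2) by (intro poly_eqI) (simp add: coeff_map_poly coeff_pCons split: nat.split)
  finally have "Polynomial.smult (of_int (v * c)) (pCons a p) = map_poly of_int (pCons (c * u) (Polynomial.smult v q))" .
  moreover have "v * c \<noteq> 0" using cq(1) uv(1) by simp
  ultimately show ?case by blast
qed

lemma iso_graph_rat: "iso_graph {(x, x) |x. x \<in> \<rat>}"
  unfolding iso_graph_def by auto

lemma qbar_aut_conjugate:
  assumes m: "\<And>i. coeff m i \<in> \<rat>" "lead_coeff m = 1" "poly m x = 0" "poly m y = 0"
    and min: "\<And>p. (\<And>i. coeff p i \<in> \<rat>) \<Longrightarrow> poly p x = 0 \<Longrightarrow> p \<noteq> 0 \<Longrightarrow> degree m \<le> degree p"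
  obtains s where "qbar_aut s" "s x = y"
proof -
  let ?r = "{(x, x) |x::complex. x \<in> \<rat>}"
  have "\<exists>r'. iso_graph r' \<and> ?r \<subseteq> r' \<and> (x, y) \<in> r'"
  proof (rule iso_graph_adjoin[OF iso_graph_rat _ _ m(2,3,4)])
    show "(m, m) \<in> poly_pairs ?r" using m(1) by (auto simp: poly_pairs_def)
    show "degree m \<le> degree p" if "(p, q) \<in> poly_pairs ?r" "poly p x = 0" "p \<noteq> 0" for p q
      using min[of p] that by (auto simp: poly_pairs_def)
  qed auto
  then obtain r' where r': "iso_graph r'" "(x, y) \<in> r'" by blast
  obtain s where s: "qbar_aut s" "\<And>x y. (x, y) \<in> r' \<Longrightarrow> algebraic x \<Longrightarrow> s x = y"
    using qbar_aut_extending[OF r'(1)] by metis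
  have "algebraic x" using m by (intro algebraicI'[of m]) auto
  then show ?thesis using that[OF s(1)] s(2)[OF r'(2)] by simp
qed

text \<open>If the minimal polynomial \<open>m\<close> of \<open>x\<close> had degree above 1, it
  would have a second root \<open>y\<close>. It differs from \<open>x\<close>, because the
  derivative of \<open>m\<close> has smaller degree and cannot vanish at \<open>x\<close>. Some
  automorphism then moves \<open>x\<close> to \<open>y\<close>.\<close>

lemma rational_if_qbar_aut_fixed:
  assumes x: "algebraic x" and fix_x: "\<And>s. qbar_aut s \<Longrightarrow> s x = x"
  shows "x \<in> \<rat>"
proof -
  let ?P = "\<lambda>k. \<exists>p. (\<forall>i. coeff p i \<in> \<rat>) \<and> poly p x = 0 \<and> p \<noteq> 0 \<and> degree p = k"
  define k where "k = (LEAST k. ?P k)"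
  have "?P k"
    unfolding k_def by (rule LeastI_ex) (use x in \<open>auto simp: algebraic_altdef\<close>)
  then obtain t where t: "\<And>i. coeff t i \<in> \<rat>" "poly t x = 0" "t \<noteq> 0" "degree t = k" by blast
  have kmin: "k \<le> degree p" if "\<And>i. coeff p i \<in> \<rat>" "poly p x = 0" "p \<noteq> 0" for p
    unfolding k_def by (rule Least_le) (use that in blast)
  define m where "m = Polynomial.smult (inverse (lead_coeff t)) t"
  have m: "coeff m i \<in> \<rat>" "poly m x = 0" "m \<noteq> 0" "lead_coeff m = 1" "degree m = k" for i
    using t by (auto simp: m_def)
  define d where "d = pderiv m"
  have k0: "k > 0"
    using m(2,4,5) by (cases "degree m = 0") (auto elim!: degree_eq_zeroE)
  show ?thesis
  proof (cases "k = 1")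
    case True
    have "poly m x = coeff m 0 + coeff m 1 * x"
      using True m(5) by (simp add: poly_altdef)
    then have "x = - coeff m 0" using m True by (simp add: eq_neg_iff_add_eq_0 add.commute)
    then show ?thesis using m(1) by simp
  next
    case False
    have "\<forall>i. coeff d i \<in> \<rat>" using m(1) by (simp add: d_def coeff_pderiv)
    moreover have "degree d = k - 1" by (simp add: d_def degree_pderiv m(5))
    moreover have "d \<noteq> 0" using k0 m(5) by (simp add: d_def pderiv_eq_0_iff)
    ultimately have dx: "poly d x \<noteq> 0" using kmin[of d] k0 by fastforce
    obtain h where h: "m = [:- x, 1:] * h" using m(2) by (auto simp: poly_eq_0_iff_dvd)
    have hx: "poly h x \<noteq> 0" using dx unfolding d_def h pderiv_mult by auto
    have h0: "h \<noteq> 0" using m(3) h by auto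
    have "degree m = Suc (degree h)" unfolding h by (subst degree_mult_eq) (use h0 in auto)
    then have "degree h > 0" using False m(5) k0 by simp
    then have "\<not> constant (poly h)" by (simp add: constant_degree)
    then obtain y where y: "poly h y = 0" using fundamental_theorem_of_algebra by blast
    have "poly m y = 0" using y h by simp
    moreover have "degree m \<le> degree p" if "\<And>i. coeff p i \<in> \<rat>" "poly p x = 0" "p \<noteq> 0" for p
      using kmin[OF that] m(5) by simp
    ultimately obtain s where "qbar_aut s" "s x = y"
      using qbar_aut_conjugate[OF m(1) m(4) m(2)] by blast
    then show ?thesis using fix_x[of s] hx y by simp
  qed
qed

section \<open>Primes above a rational prime\<close>

text \<open>A prime ideal containing \<open>q\<close> in the ring of all algebraic integers. One
  such ideal serves all levels of the tree, with no number field to be chosen.\<close>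

definition prime_above :: "nat \<Rightarrow> complex set \<Rightarrow> bool" where
  "prime_above q Q \<longleftrightarrow> (\<forall>x\<in>Q. algebraic_int x) \<and> of_nat q \<in> Q \<and> 1 \<notin> Q
     \<and> (\<forall>x\<in>Q. \<forall>y\<in>Q. x + y \<in> Q) \<and> (\<forall>x\<in>Q. \<forall>y. algebraic_int y \<longrightarrow> y * x \<in> Q)
     \<and> (\<forall>x y. algebraic_int x \<longrightarrow> algebraic_int y \<longrightarrow> x * y \<in> Q \<longrightarrow> x \<in> Q \<or> y \<in> Q)"

text \<open>The multiples of \<open>q\<close> form a proper ideal since 1/q is rational but not an
  integer; Zorn's lemma enlarges it to a maximal ideal, which is prime.\<close>

lemma prime_above_exists:
  assumes q: "prime (q::nat)"
  shows "\<exists>Q. prime_above q Q"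
proof -
  define ideal where "ideal = (\<lambda>I::complex set. (\<forall>x\<in>I. algebraic_int x) \<and> of_nat q \<in> I \<and> 1 \<notin> I
     \<and> (\<forall>x\<in>I. \<forall>y\<in>I. x + y \<in> I) \<and> (\<forall>x\<in>I. \<forall>y. algebraic_int y \<longrightarrow> y * x \<in> I))"
  define P where "P = {of_nat q * z |z::complex. algebraic_int z}"
  have "1 \<notin> P"
  proof
    assume "(1::complex) \<in> P"
    then obtain z :: complex where z: "algebraic_int z" "1 = of_nat q * z" unfolding P_def by blast
    have q0: "q > 1" using q prime_gt_1_nat by blast
    then have "z = inverse (of_nat q)" using z(2) by (simp add: field_simps)
    then have "z \<in> \<rat>" by simp
    then have "z \<in> \<int>" using z(1) rational_algebraic_int_is_int by blast
    then obtain m where "z = of_int m" by (elim Ints_cases)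
    then have "of_int 1 = (of_int (int q * m) :: complex)" using z(2) by simp
    then have "1 = int q * m" unfolding of_int_eq_iff .
    then have "int q dvd 1" by (metis dvd_triv_left)
    then show False using q0 by auto
  qed
  have IP: "ideal P"
    unfolding ideal_def
  proof (intro conjI ballI allI impI)
    fix x assume "x \<in> P"
    then obtain z where z: "algebraic_int z" "x = of_nat q * z" unfolding P_def by blast
    then show "algebraic_int x" using algebraic_int_add_mult(2)[OF algebraic_int_of_int[of "int q"]] by simp
    fix y :: complex
    { assume "y \<in> P"
      then obtain z' where z': "algebraic_int z'" "y = of_nat q * z'" unfolding P_def by blast
      have "x + y = of_nat q * (z + z')" using z z' by (simp add: algebra_simps)
      then show "x + y \<in> P" unfolding P_def using algebraic_int_add_mult(1)[OF z(1) z'(1)] by blast }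
    { assume y: "algebraic_int y"
      have "y * x = of_nat q * (y * z)" using z by simp
      then show "y * x \<in> P" unfolding P_def using algebraic_int_add_mult(2)[OF y z(1)] by blast }
  next
    have "of_nat q * 1 \<in> P" unfolding P_def by (intro CollectI exI[of _ 1]) simp
    then show "of_nat q \<in> P" by simp
  qed (rule \<open>1 \<notin> P\<close>)
  have "\<exists>M\<in>Collect ideal. \<forall>X\<in>Collect ideal. M \<subseteq> X \<longrightarrow> X = M"
  proof (rule subset_Zorn_nonempty)
    show "Collect ideal \<noteq> {}" using IP by auto
    fix C assume ne: "C \<noteq> {}" and ch: "subset.chain (Collect ideal) C"
    have C: "ideal I" if "I \<in> C" for I using ch that unfolding subset.chain_def by blast
    have lin: "I \<subseteq> J \<or> J \<subseteq> I" if "I \<in> C" "J \<in> C" for I J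
      using ch that unfolding subset.chain_def by blast
    have "ideal (\<Union>C)"
      unfolding ideal_def
    proof (intro conjI ballI allI impI)
      fix x assume "x \<in> \<Union>C"
      then obtain I where I: "I \<in> C" "x \<in> I" by blast
      then show "algebraic_int x" using C unfolding ideal_def by blast
      fix y :: complex
      { assume "y \<in> \<Union>C"
        then obtain J where J: "J \<in> C" "y \<in> J" by blast
        from lin[OF I(1) J(1)] show "x + y \<in> \<Union>C"
        proof
          assume "I \<subseteq> J"
          then have "x + y \<in> J" using C[OF J(1)] I J unfolding ideal_def by blast
          then show ?thesis using J by blast
        next
          assume "J \<subseteq> I"
          then have "x + y \<in> I" using C[OF I(1)] I J unfolding ideal_def by blast
          then show ?thesis using I by blast
        qed }
      { assume "algebraic_int y"
        then have "y * x \<in> I" using C[OF I(1)] I unfolding ideal_def by blast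
        then show "y * x \<in> \<Union>C" using I by blast }
    next
      show "of_nat q \<in> \<Union>C" using ne C unfolding ideal_def by blast
      show "1 \<notin> \<Union>C" using C unfolding ideal_def by blast
    qed
    then show "\<Union>C \<in> Collect ideal" by simp
  qed
  then obtain M where M: "ideal M" and mx: "\<And>X. ideal X \<Longrightarrow> M \<subseteq> X \<Longrightarrow> X = M" by auto
  note MD = M[unfolded ideal_def]
  have "x \<in> M \<or> y \<in> M" if xy: "algebraic_int x" "algebraic_int y" "x * y \<in> M" for x y :: complex
  proof (rule ccontr)
    assume n: "\<not> (x \<in> M \<or> y \<in> M)"
    \<comment> \<open>The ideal generated by \<open>M\<close> and \<open>x\<close>. By maximality of
      \<open>M\<close> it contains 1, and multiplying that relation by \<open>y\<close> puts
      \<open>y\<close> into \<open>M\<close>.\<close>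
    define N where "N = {m + a * x |m a. m \<in> M \<and> algebraic_int a}"
    have NI: "m + a * x \<in> N" if "m \<in> M" "algebraic_int a" for m a :: complex using that unfolding N_def by blast
    have "M \<subseteq> N"
    proof
      fix m assume "m \<in> M"
      then show "m \<in> N" using NI[of m 0] by simp
    qed
    moreover have "x \<in> N"
    proof -
      have "0 * of_nat q \<in> M" using MD algebraic_int_0 by blast
      then show ?thesis using NI[of 0 1] by (simp add: int_imp_algebraic_int)
    qed
    ultimately have "\<not> ideal N" using mx[of N] n by blast
    moreover have "\<forall>x\<in>N. algebraic_int x"
      unfolding N_def using MD xy(1) algebraic_int_add_mult by blast
    moreover have "of_nat q \<in> N" using \<open>M \<subseteq> N\<close> MD by blast
    moreover have "u + v \<in> N" if uv: "u \<in> N" "v \<in> N" for u v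
    proof -
      obtain m a m' a' where h: "u = m + a * x" "m \<in> M" "algebraic_int a" "v = m' + a' * x" "m' \<in> M" "algebraic_int a'"
        using uv unfolding N_def by blast
      then have "u + v = (m + m') + (a + a') * x" by (simp add: algebra_simps)
      moreover have "m + m' \<in> M" using MD h by blast
      ultimately show ?thesis using NI algebraic_int_add_mult(1)[OF h(3,6)] by simp
    qed
    moreover have "v * u \<in> N" if uv: "u \<in> N" "algebraic_int v" for u v :: complex
    proof -
      obtain m a where h: "u = m + a * x" "m \<in> M" "algebraic_int a"
        using uv unfolding N_def by blast
      then have "v * u = v * m + (v * a) * x" by (simp add: algebra_simps)
      moreover have "v * m \<in> M" using MD h uv by blast
      ultimately show ?thesis using NI algebraic_int_add_mult(2)[OF uv(2) h(3)] by simp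
    qed
    ultimately have "1 \<in> N" unfolding ideal_def by blast
    then obtain m a where h: "1 = m + a * x" "m \<in> M" "algebraic_int a" unfolding N_def by blast
    have "y = y * (m + a * x)" using h(1) by simp
    also have "\<dots> = y * m + a * (x * y)" by (simp add: algebra_simps)
    also have "\<dots> \<in> M" using MD h xy by blast
    finally show False using n by blast
  qed
  then have "prime_above q M" unfolding prime_above_def using MD by blast
  then show ?thesis by blast
qed

locale prime_ideal =
  fixes q :: nat and Q :: "complex set"
  assumes q: "prime q" and Q: "prime_above q Q"
begin

lemma q_in: "of_nat q \<in> Q"
  and one_notin: "1 \<notin> Q"
  and add_in: "x \<in> Q \<Longrightarrow> y \<in> Q \<Longrightarrow> x + y \<in> Q"
  and mult_in: "x \<in> Q \<Longrightarrow> algebraic_int y \<Longrightarrow> y * x \<in> Q"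
  and primeD: "x * y \<in> Q \<Longrightarrow> algebraic_int x \<Longrightarrow> algebraic_int y \<Longrightarrow> x \<in> Q \<or> y \<in> Q"
  using Q unfolding prime_above_def by blast+

lemma mult_in_right: "x \<in> Q \<Longrightarrow> algebraic_int y \<Longrightarrow> x * y \<in> Q"
  using mult_in[of x y] by (simp add: mult.commute)

lemma zero_in: "0 \<in> Q"
  using mult_in[OF q_in algebraic_int_0] by simp

lemma minus_in: "x \<in> Q \<Longrightarrow> - x \<in> Q"
  using mult_in[of x "of_int (- 1)"] algebraic_int_of_int by fastforce

lemma minus_in_iff: "- x \<in> Q \<longleftrightarrow> x \<in> Q"
  using minus_in[of x] minus_in[of "- x"] by auto

lemma diff_in: "x \<in> Q \<Longrightarrow> y \<in> Q \<Longrightarrow> x - y \<in> Q"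
  using add_in[of x "- y"] minus_in by simp

lemma sum_in: "(\<And>i. i \<in> A \<Longrightarrow> f i \<in> Q) \<Longrightarrow> sum f A \<in> Q"
  by (induction A rule: infinite_finite_induct) (auto intro: zero_in add_in)

lemma power_in: "x ^ n \<in> Q \<Longrightarrow> algebraic_int x \<Longrightarrow> x \<in> Q"
proof (induction n)
  case 0 then show ?case using one_notin by simp
next
  case (Suc n) then show ?case using primeD[of x "x ^ n"] algebraic_int_power by auto
qed

text \<open>If \<open>q\<close> did not divide \<open>m\<close>, a Bezout relation between them
  would put 1 into \<open>Q\<close>. This translates local statements at \<open>Q\<close> back into
  integer divisibility.\<close>

lemma of_int_in_iff: "of_int m \<in> Q \<longleftrightarrow> int q dvd m"
proof
  assume "int q dvd m"
  then obtain k where "m = int q * k" by blast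
  then show "of_int m \<in> Q" using mult_in_right[OF q_in algebraic_int_of_int[of k]] by simp
next
  assume m: "of_int m \<in> Q"
  show "int q dvd m"
  proof (rule ccontr)
    assume "\<not> int q dvd m"
    then have "coprime (int q) m" using q by (intro prime_imp_coprime) auto
    then obtain u v where "u * int q + v * m = 1" by (metis bezout_int coprime_iff_gcd_eq_1)
    then have "of_int (u * int q + v * m) = (1::complex)" by simp
    then have "of_int u * of_nat q + of_int v * of_int m = (1::complex)" by simp
    moreover have "of_int u * of_nat q + of_int v * of_int m \<in> Q"
      by (intro add_in mult_in q_in m algebraic_int_of_int)
    ultimately show False using one_notin by simp
  qed
qed

end

section \<open>Inertia\<close>

text \<open>By Galois theory this is the ring of integers of the field generated by \<open>V\<close>, at least
  when \<open>V\<close> is finite and stable under conjugation.\<close>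
definition fixed_ring :: "complex set \<Rightarrow> complex set" where
  "fixed_ring V = {x. algebraic_int x \<and> (\<forall>s. qbar_aut s \<longrightarrow> (\<forall>v\<in>V. s v = v) \<longrightarrow> s x = x)}"

locale galois_set =
  fixes V :: "complex set"
  assumes fin: "finite V" and alg_V: "\<And>v. v \<in> V \<Longrightarrow> algebraic_int v"
    and stable: "\<And>s v. qbar_aut s \<Longrightarrow> v \<in> V \<Longrightarrow> s v \<in> V"
begin

abbreviation "R \<equiv> fixed_ring V"

lemma R_alg: "x \<in> R \<Longrightarrow> algebraic_int x"
  by (simp add: fixed_ring_def)

lemma R_algebraic: "x \<in> R \<Longrightarrow> algebraic x"
  using R_alg by blast

lemma V_subset_R: "V \<subseteq> R"
  by (auto simp: fixed_ring_def alg_V)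

lemma R_of_int: "of_int m \<in> R"
  by (simp add: fixed_ring_def algebraic_int_of_int qbar_aut_of_int)

lemma R_add: "x \<in> R \<Longrightarrow> y \<in> R \<Longrightarrow> x + y \<in> R"
  by (auto simp: fixed_ring_def algebraic_int_add_mult qbar_aut_add algebraic_int_imp_algebraic)

lemma R_mult: "x \<in> R \<Longrightarrow> y \<in> R \<Longrightarrow> x * y \<in> R"
  by (auto simp: fixed_ring_def algebraic_int_add_mult qbar_aut_mult algebraic_int_imp_algebraic)

lemma R_diff: "x \<in> R \<Longrightarrow> y \<in> R \<Longrightarrow> x - y \<in> R"
  by (auto simp: fixed_ring_def algebraic_int_diff qbar_aut_diff algebraic_int_imp_algebraic)

lemma R_sum_list: "(\<And>x. x \<in> set xs \<Longrightarrow> x \<in> R) \<Longrightarrow> sum_list xs \<in> R"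
  by (induction xs) (use R_of_int[of 0] R_add in auto)

text \<open>Composing \<open>s\<close> with the inverse of \<open>t\<close> gives an automorphism
  fixing \<open>V\<close> pointwise, which by definition acts trivially on \<open>R\<close>. So the
  action on \<open>R\<close> factors through the finite group of permutations of
  \<open>V\<close>.\<close>

lemma R_agree:
  assumes "qbar_aut s" "qbar_aut t" "\<And>v. v \<in> V \<Longrightarrow> s v = t v" "x \<in> R"
  shows "s x = t x"
proof -
  obtain t' where t': "qbar_aut t'" "\<And>x. algebraic x \<Longrightarrow> t' (t x) = x" "\<And>x. algebraic x \<Longrightarrow> t (t' x) = x"
    using qbar_aut_inverse[OF assms(2)] by blast
  have "(t' \<circ> s) v = v" if "v \<in> V" for v
    using that assms(3) t'(2)[of v] alg_V[of v] by auto
  then have "(t' \<circ> s) x = x"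
    using assms(4) qbar_aut_comp[OF t'(1) assms(1)] unfolding fixed_ring_def by blast
  then have "t (t' (s x)) = t x" by simp
  then show ?thesis
    using t'(3)[of "s x"] qbar_aut_algebraic[OF assms(1) R_algebraic[OF assms(4)]] by simp
qed

lemma R_stable:
  assumes s: "qbar_aut s" and x: "x \<in> R"
  shows "s x \<in> R"
proof -
  have "h (s x) = s x" if h: "qbar_aut h" "\<forall>v\<in>V. h v = v" for h
    using R_agree[OF qbar_aut_comp[OF h(1) s] s _ x] h(2) stable[OF s] by simp
  then show ?thesis
    using x s by (simp add: fixed_ring_def qbar_aut_algebraic_int)
qed

text \<open>The Galois group of the field generated by \<open>V\<close>, as a group of permutations of \<open>V\<close>.\<close>
definition actions :: "(complex \<Rightarrow> complex) set" where
  "actions = (\<lambda>s. restrict s V) ` Collect qbar_aut"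

text \<open>Many automorphisms induce \<open>a\<close>, but by \<open>R_agree\<close> they all have
  the same values on \<open>R\<close>.\<close>

definition lift :: "(complex \<Rightarrow> complex) \<Rightarrow> complex \<Rightarrow> complex" where
  "lift a = (SOME s. qbar_aut s \<and> restrict s V = a)"

lemma finite_actions: "finite actions"
proof -
  have "actions \<subseteq> PiE V (\<lambda>_. V)"
    unfolding actions_def using stable by auto
  then show ?thesis
    by (rule finite_subset) (simp add: fin finite_PiE)
qed

lemma lift:
  assumes "a \<in> actions"
  shows "qbar_aut (lift a)" "restrict (lift a) V = a"
proof -
  have "\<exists>s. qbar_aut s \<and> restrict s V = a"
    using assms unfolding actions_def by auto
  then have "qbar_aut (lift a) \<and> restrict (lift a) V = a"
    unfolding lift_def by (rule someI_ex)
  then show "qbar_aut (lift a)" "restrict (lift a) V = a" by auto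
qed

lemma lift_R: "a \<in> actions \<Longrightarrow> x \<in> R \<Longrightarrow> lift a x \<in> R"
  by (rule R_stable[OF lift(1)])

lemma lift_mult: "a \<in> actions \<Longrightarrow> x \<in> R \<Longrightarrow> y \<in> R \<Longrightarrow> lift a (x * y) = lift a x * lift a y"
  by (rule qbar_aut_mult[OF lift(1) R_algebraic R_algebraic])

lemma lift_restrict:
  assumes s: "qbar_aut s" and x: "x \<in> R"
  shows "lift (restrict s V) x = s x"
proof (rule R_agree[OF _ s _ x])
  have a: "restrict s V \<in> actions" using s unfolding actions_def by auto
  show "qbar_aut (lift (restrict s V))" by (rule lift[OF a])
  fix v assume "v \<in> V"
  then show "lift (restrict s V) v = s v"
    using fun_cong[OF lift(2)[OF a], of v] by simp
qed

definition id_action :: "complex \<Rightarrow> complex" where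
  "id_action = restrict id V"

lemma id_action_in: "id_action \<in> actions"
  unfolding id_action_def actions_def using qbar_aut_id by blast

lemma lift_id_action: "x \<in> R \<Longrightarrow> lift id_action x = x"
  unfolding id_action_def using lift_restrict[OF qbar_aut_id] by simp

definition trace :: "complex \<Rightarrow> complex" where
  "trace x = (\<Sum>a\<in>actions. lift a x)"

text \<open>Composition with \<open>h\<close> permutes the finite set \<open>actions\<close>, hence
  the summands of the trace.\<close>

lemma trace_fixed:
  assumes h: "qbar_aut h" and x: "x \<in> R"
  shows "h (trace x) = trace x"
proof -
  define \<tau> where "\<tau> = (\<lambda>a. restrict (h \<circ> lift a) V)"
  have \<tau>_in: "\<tau> a \<in> actions" if "a \<in> actions" for a
    unfolding \<tau>_def actions_def using qbar_aut_comp[OF h lift(1)[OF that]] by blast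
  have inj: "inj_on \<tau> actions"
  proof (rule inj_onI)
    fix a b assume ab: "a \<in> actions" "b \<in> actions" "\<tau> a = \<tau> b"
    have "lift a v = lift b v" if v: "v \<in> V" for v
    proof -
      have "h (lift a v) = h (lift b v)"
        using fun_cong[OF ab(3), of v] v by (simp add: \<tau>_def)
      moreover have "algebraic (lift a v)" "algebraic (lift b v)"
        using R_algebraic lift_R ab(1,2) v V_subset_R by blast+
      ultimately show ?thesis using qbar_aut_inj[OF h, of "lift a v" "lift b v"] by simp
    qed
    then have "restrict (lift a) V = restrict (lift b) V" by (auto simp: restrict_def)
    then show "a = b" using lift(2) ab by simp
  qed
  have img: "\<tau> ` actions = actions"
    by (rule endo_inj_surj[OF finite_actions _ inj]) (use \<tau>_in in auto)
  have alg: "algebraic (lift a x)" if "a \<in> actions" for a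
    by (rule R_algebraic[OF lift_R[OF that x]])
  have "h (trace x) = (\<Sum>a\<in>actions. h (lift a x))"
    unfolding trace_def using qbar_aut_sum[OF h, of actions "\<lambda>a. lift a x"] alg by simp
  also have "\<dots> = (\<Sum>a\<in>actions. lift (\<tau> a) x)"
  proof (rule sum.cong)
    fix a assume "a \<in> actions"
    then show "h (lift a x) = lift (\<tau> a) x"
      unfolding \<tau>_def using lift_restrict[OF qbar_aut_comp[OF h lift(1)] x] by simp
  qed simp
  also have "\<dots> = (\<Sum>a\<in>\<tau> ` actions. lift a x)"
    using sum.reindex[OF inj, of "\<lambda>a. lift a x"] by simp
  finally show ?thesis unfolding img trace_def .
qed

lemma trace_int:
  assumes x: "x \<in> R"
  obtains m where "trace x = of_int m"
proof -
  have alg: "algebraic_int (trace x)"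
    unfolding trace_def by (intro algebraic_int_sum R_alg lift_R x)
  then have "trace x \<in> \<rat>"
    using trace_fixed[OF _ x] by (intro rational_if_qbar_aut_fixed) auto
  then have "trace x \<in> \<int>" using alg rational_algebraic_int_is_int by blast
  then show ?thesis by (elim Ints_cases) (rule that)
qed

text \<open>The iterates of \<open>s\<close> induce only finitely many actions on \<open>V\<close>,
  so two of them agree at \<open>x\<close>, and injectivity cancels the smaller power.\<close>

lemma orbit_return:
  assumes s: "qbar_aut s" and x: "x \<in> R"
  obtains m where "m > 0" "(s ^^ m) x = x"
proof -
  have aut: "qbar_aut (s ^^ i)" for i
    by (induction i) (simp_all only: funpow.simps s qbar_aut_comp qbar_aut_id)
  have "range (\<lambda>i. (s ^^ i) x) \<subseteq> (\<lambda>a. lift a x) ` actions"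
  proof
    fix y assume "y \<in> range (\<lambda>i. (s ^^ i) x)"
    then obtain i where "y = (s ^^ i) x" by blast
    then have "y = lift (restrict (s ^^ i) V) x" using lift_restrict[OF aut x] by simp
    moreover have "restrict (s ^^ i) V \<in> actions" unfolding actions_def using aut by blast
    ultimately show "y \<in> (\<lambda>a. lift a x) ` actions" by blast
  qed
  then have "finite (range (\<lambda>i. (s ^^ i) x))"
    using finite_actions finite_surj by blast
  then have "\<not> inj (\<lambda>i. (s ^^ i) x)" using finite_imageD infinite_UNIV_nat by blast
  then obtain i j where "i \<noteq> j" "(s ^^ i) x = (s ^^ j) x" by (auto simp: inj_on_def)
  then obtain i j where ij: "i < j" "(s ^^ i) x = (s ^^ j) x" by (metis linorder_neqE_nat)
  have "(s ^^ j) x = (s ^^ i) ((s ^^ (j - i)) x)"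
    using ij(1) by (metis add_diff_inverse_nat comp_apply funpow_add less_imp_not_less)
  then have "(s ^^ (j - i)) x = x"
    using qbar_aut_inj[OF aut[of i], of "(s ^^ (j - i)) x" x] ij(2)
      qbar_aut_algebraic[OF aut R_algebraic[OF x]] R_algebraic[OF x] by simp
  then show ?thesis using that[of "j - i"] ij(1) by simp
qed

end

section \<open>Conjugates of a prime ideal, and the consequences of trivial inertia\<close>

locale galois_prime = galois_set V + prime_ideal q Q for V q Q
begin

text \<open>Without a \<open>b\<close> as in the second alternative, membership in \<open>Q\<close>
  can be pulled back along \<open>s\<close>. Orbits being finite, \<open>x\<close> equals
  \<open>s ^^ m\<close> at \<open>x\<close> for some positive \<open>m\<close>, and pulling back
  from there down to exponent 1 puts \<open>s x\<close> into \<open>Q\<close>.\<close>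

lemma conjugate_prime:
  assumes s: "qbar_aut s"
  shows "(\<forall>x\<in>R. x \<in> Q \<longrightarrow> s x \<in> Q) \<or> (\<exists>b\<in>R. b \<notin> Q \<and> s b \<in> Q)"
proof (rule disjCI)
  assume "\<not> (\<exists>b\<in>R. b \<notin> Q \<and> s b \<in> Q)"
  then have pull: "x \<in> Q" if "x \<in> R" "s x \<in> Q" for x using that by blast
  show "\<forall>x\<in>R. x \<in> Q \<longrightarrow> s x \<in> Q"
  proof (intro ballI impI)
    fix x assume x: "x \<in> R" "x \<in> Q"
    obtain m where m: "m > 0" "(s ^^ m) x = x" by (rule orbit_return[OF s x(1)])
    have inR: "(s ^^ i) x \<in> R" for i by (induction i) (auto simp: x R_stable[OF s])
    have "(s ^^ Suc (m - 1 - i)) x \<in> Q" if "i < m" for i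
      using that
    proof (induction i)
      case 0
      then show ?case using m x by simp
    next
      case (Suc i)
      then have "m - 1 - i = Suc (m - 1 - Suc i)" by simp
      then have "s ((s ^^ Suc (m - 1 - Suc i)) x) \<in> Q" using Suc by simp
      then show ?case by (rule pull[OF inR])
    qed
    from this[of "m - 1"] m show "s x \<in> Q" by simp
  qed
qed

text \<open>Replaces the Chinese remainder theorem. A product with one witness from
  \<open>conjugate_prime\<close> per action stays outside the prime \<open>Q\<close>, while each
  action that does not preserve \<open>Q\<close> sends the product into it. For \<open>z\<close> in
  \<open>Q\<close>, all conjugates of \<open>z * b\<close> then lie in \<open>Q\<close>.\<close>

lemma avoid_conjugates:
  assumes "finite S" "S \<subseteq> actions"
  shows "\<exists>b\<in>R. b \<notin> Q \<and> (\<forall>a\<in>S. (\<forall>x\<in>R. x \<in> Q \<longrightarrow> lift a x \<in> Q) \<or> lift a b \<in> Q)"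
  using assms
proof (induction S rule: finite_induct)
  case empty
  show ?case using R_of_int[of 1] one_notin by (intro bexI[of _ 1]) auto
next
  case (insert a S)
  then obtain b where b: "b \<in> R" "b \<notin> Q"
    "\<And>a. a \<in> S \<Longrightarrow> (\<forall>x\<in>R. x \<in> Q \<longrightarrow> lift a x \<in> Q) \<or> lift a b \<in> Q" by blast
  have a: "qbar_aut (lift a)" using lift(1) insert.prems by blast
  obtain c where c: "c \<in> R" "c \<notin> Q" "(\<forall>x\<in>R. x \<in> Q \<longrightarrow> lift a x \<in> Q) \<or> lift a c \<in> Q"
  proof (cases "\<forall>x\<in>R. x \<in> Q \<longrightarrow> lift a x \<in> Q")
    case True
    then show ?thesis using that[OF b(1,2)] by blast
  next
    case False
    then show ?thesis using conjugate_prime[OF a] that by blast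
  qed
  have alg: "algebraic_int b" "algebraic_int c" using b c R_alg by blast+
  have m: "lift a' (b * c) = lift a' b * lift a' c" if "a' \<in> insert a S" for a'
    using that insert.prems lift_mult b(1) c(1) by blast
  have s: "algebraic_int (lift a' b)" "algebraic_int (lift a' c)" if "a' \<in> insert a S" for a'
    using that insert.prems R_alg lift_R b(1) c(1) by blast+
  show ?case
  proof (intro bexI[of _ "b * c"] conjI ballI)
    show "b * c \<in> R" using b c R_mult by blast
    show "b * c \<notin> Q" using primeD[of b c] alg b c by blast
    fix a' assume a': "a' \<in> insert a S"
    have "(\<forall>x\<in>R. x \<in> Q \<longrightarrow> lift a' x \<in> Q) \<or> lift a' b \<in> Q \<or> lift a' c \<in> Q"
      using a' b(3) c(3) by blast
    then show "(\<forall>x\<in>R. x \<in> Q \<longrightarrow> lift a' x \<in> Q) \<or> lift a' (b * c) \<in> Q"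
      unfolding m[OF a'] using mult_in mult_in_right s[OF a'] by blast
  qed
qed

text \<open>If the inertia group is trivial, the Galois algebra splits locally at \<open>Q\<close>:
  the pairs represent a separating idempotent up to an element outside \<open>Q\<close>.\<close>
lemma separating_pairs:
  assumes triv: "\<And>s. qbar_aut s \<Longrightarrow> \<exists>v\<in>V. s v \<noteq> v \<Longrightarrow> \<exists>x\<in>R. s x - x \<notin> Q"
    and "finite S" "S \<subseteq> actions - {id_action}"
  shows "\<exists>L. set L \<subseteq> R \<times> R \<and> (\<forall>a\<in>S. (\<Sum>(x, y)\<leftarrow>L. x * lift a y) = 0) \<and> (\<Sum>(x, y)\<leftarrow>L. x * y) \<notin> Q"
  using assms(2,3)
proof (induction S rule: finite_induct)
  case empty
  show ?case using R_of_int[of 1] one_notin by (intro exI[of _ "[(1, 1)]"]) auto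
next
  case (insert b S)
  then obtain L where L: "set L \<subseteq> R \<times> R" "\<And>a. a \<in> S \<Longrightarrow> (\<Sum>(x, y)\<leftarrow>L. x * lift a y) = 0"
    "(\<Sum>(x, y)\<leftarrow>L. x * y) \<notin> Q" by blast
  have b: "b \<in> actions" "b \<noteq> id_action" using insert.prems by auto
  have "\<exists>v\<in>V. lift b v \<noteq> v"
  proof (rule ccontr)
    assume "\<not> (\<exists>v\<in>V. lift b v \<noteq> v)"
    then have "restrict (lift b) V = restrict id V" by (auto simp: restrict_def)
    then show False using b lift(2)[OF b(1)] by (simp add: id_action_def)
  qed
  then obtain z where z: "z \<in> R" "lift b z - z \<notin> Q" using triv[OF lift(1)[OF b(1)]] by blast
  define w where "w = lift b z"
  have w: "w \<in> R" unfolding w_def by (rule R_stable[OF lift(1)[OF b(1)] z(1)])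
  have nw: "- w \<in> R" using R_diff[OF R_of_int[of 0] w] by simp
  \<comment> \<open>Read as a tensor, \<open>L\<close> is multiplied by 1 (x) z - w (x) 1. Under the
    map sending x (x) y to x * a(y) this contributes the factor a(z) - w, which is 0 for a = b
    because w = b(z), and z - w, outside \<open>Q\<close>, for the identity.\<close>
  define L' where "L' = map (\<lambda>(x, y). (x, y * z)) L @ map (\<lambda>(x, y). (- w * x, y)) L"
  have key: "(\<Sum>(x, y)\<leftarrow>L'. x * f y) = (f z - w) * (\<Sum>(x, y)\<leftarrow>L. x * f y)"
    if f: "\<And>y. y \<in> R \<Longrightarrow> f (y * z) = f y * f z" for f
  proof -
    have "(\<Sum>(x, y)\<leftarrow>map (\<lambda>(x, y). (x, y * z)) L. x * f y) = f z * (\<Sum>(x, y)\<leftarrow>L. x * f y)"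
      using L(1) f by (induction L) (auto simp: algebra_simps)
    moreover have "(\<Sum>(x, y)\<leftarrow>map (\<lambda>(x, y). (- w * x, y)) L. x * f y) = - w * (\<Sum>(x, y)\<leftarrow>L. x * f y)"
      by (induction L) (auto simp: algebra_simps)
    ultimately show ?thesis unfolding L'_def by (simp add: algebra_simps)
  qed
  show ?case
  proof (intro exI[of _ L'] conjI ballI)
    show "set L' \<subseteq> R \<times> R"
    proof -
      have "(x, y * z) \<in> R \<times> R" "(- w * x, y) \<in> R \<times> R" if "(x, y) \<in> set L" for x y
        using that L(1) R_mult z(1) nw by blast+
      then show ?thesis unfolding L'_def by auto
    qed
    fix a assume a: "a \<in> insert b S"
    then have "a \<in> actions" using insert.prems by auto
    then have "(\<Sum>(x, y)\<leftarrow>L'. x * lift a y) = (lift a z - w) * (\<Sum>(x, y)\<leftarrow>L. x * lift a y)"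
      using key[of "lift a"] lift_mult z(1) by simp
    also have "\<dots> = 0" using a L(2) by (auto simp: w_def)
    finally show "(\<Sum>(x, y)\<leftarrow>L'. x * lift a y) = 0" .
  next
    have "algebraic_int (\<Sum>(x, y)\<leftarrow>L. x * y)"
      by (rule R_alg[OF R_sum_list]) (use L(1) R_mult in auto)
    moreover have "z - w \<notin> Q" using z(2) minus_in_iff[of "z - w"] by (simp add: w_def)
    moreover have "algebraic_int (z - w)" using R_alg R_diff z w by blast
    ultimately have "(z - w) * (\<Sum>(x, y)\<leftarrow>L. x * y) \<notin> Q" using primeD L(3) by blast
    then show "(\<Sum>(x, y)\<leftarrow>L'. x * y) \<notin> Q" using key[of "\<lambda>y. y"] by simp
  qed
qed

text \<open>The pairs of \<open>separating_pairs\<close> behave like dual bases up to a factor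
  outside \<open>Q\<close>. In the sum of \<open>x * trace (y * (z * b))\<close> over
  \<open>L\<close> every action except the identity cancels, leaving \<open>u * z\<close>. By the
  choice of \<open>b\<close> all conjugates of \<open>z * b\<close> lie in \<open>Q\<close>, so each
  of these traces is a rational integer in \<open>Q\<close>, that is, a multiple of
  \<open>q\<close>.\<close>

lemma uniformizer_if_inertia_trivial:
  assumes triv: "\<And>s. qbar_aut s \<Longrightarrow> \<exists>v\<in>V. s v \<noteq> v \<Longrightarrow> \<exists>x\<in>R. s x - x \<notin> Q"
    and z: "z \<in> R" "z \<in> Q"
  shows "\<exists>u\<in>R. \<exists>t\<in>R. u \<notin> Q \<and> u * z = of_nat q * t"
proof -
  obtain L where L: "set L \<subseteq> R \<times> R" "\<And>a. a \<in> actions - {id_action} \<Longrightarrow> (\<Sum>(x, y)\<leftarrow>L. x * lift a y) = 0"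
    "(\<Sum>(x, y)\<leftarrow>L. x * y) \<notin> Q"
    using separating_pairs[of "actions - {id_action}", OF triv] finite_actions by auto
  obtain b where b: "b \<in> R" "b \<notin> Q"
    "\<And>a. a \<in> actions \<Longrightarrow> (\<forall>x\<in>R. x \<in> Q \<longrightarrow> lift a x \<in> Q) \<or> lift a b \<in> Q"
    using avoid_conjugates[OF finite_actions] by blast
  have zb: "lift a (z * b) \<in> Q" if a: "a \<in> actions" for a
  proof -
    have "lift a (z * b) = lift a z * lift a b"
      by (rule lift_mult[OF a z(1) b(1)])
    moreover have "algebraic_int (lift a z)" "algebraic_int (lift a b)"
      using R_alg lift_R[OF a] z(1) b(1) by blast+
    ultimately show ?thesis using b(3)[OF a] z mult_in[of "lift a b" "lift a z"] mult_in_right[of "lift a z" "lift a b"] by auto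
  qed
  have tr: "\<exists>m. trace (y * (z * b)) = of_nat q * of_int m" if y: "y \<in> R" for y
  proof -
    have yzb: "y * (z * b) \<in> R" using y z b R_mult by blast
    obtain k where k: "trace (y * (z * b)) = of_int k" by (rule trace_int[OF yzb])
    have "lift a (y * (z * b)) \<in> Q" if a: "a \<in> actions" for a
    proof -
      have "lift a (y * (z * b)) = lift a y * lift a (z * b)"
        by (rule lift_mult[OF a y R_mult[OF z(1) b(1)]])
      then show ?thesis
        using mult_in[OF zb[OF a] R_alg[OF lift_R[OF a y]]] by simp
    qed
    then have "of_int k \<in> Q" unfolding k[symmetric] trace_def by (rule sum_in)
    then obtain m where "k = int q * m" unfolding of_int_in_iff by (elim dvdE)
    then show ?thesis using k by auto
  qed
  then have "\<forall>y\<in>R. \<exists>m. trace (y * (z * b)) = of_nat q * of_int m" by blast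
  from bchoice[OF this] obtain m
    where m: "\<forall>y\<in>R. trace (y * (z * b)) = of_nat q * of_int (m y)" ..
  define u where "u = b * (\<Sum>(x, y)\<leftarrow>L. x * y)"
  define t where "t = (\<Sum>(x, y)\<leftarrow>L. x * of_int (m y))"
  have swap: "(\<Sum>(x, y)\<leftarrow>L. x * trace (y * (z * b))) = (\<Sum>a\<in>actions. \<Sum>(x, y)\<leftarrow>L. x * lift a (y * (z * b)))"
    by (induction L) (auto simp: trace_def sum.distrib sum_distrib_left)
  have "(\<Sum>(x, y)\<leftarrow>L. x * lift a (y * (z * b))) = (\<Sum>(x, y)\<leftarrow>L. x * lift a y) * lift a (z * b)"
    if a: "a \<in> actions" for a
  proof -
    have "lift a (y * (z * b)) = lift a y * lift a (z * b)" if "y \<in> R" for y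
      by (rule lift_mult[OF a that R_mult[OF z(1) b(1)]])
    then show ?thesis using L(1) by (induction L) (auto simp: algebra_simps)
  qed
  then have "(\<Sum>(x, y)\<leftarrow>L. x * trace (y * (z * b))) = (\<Sum>a\<in>actions. (\<Sum>(x, y)\<leftarrow>L. x * lift a y) * lift a (z * b))"
    unfolding swap by (intro sum.cong) auto
  also have "\<dots> = (\<Sum>a\<in>{id_action}. (\<Sum>(x, y)\<leftarrow>L. x * lift a y) * lift a (z * b))"
    by (rule sum.mono_neutral_right) (use finite_actions id_action_in L(2) in auto)
  also have "\<dots> = (\<Sum>(x, y)\<leftarrow>L. x * lift id_action y) * (z * b)"
    using lift_id_action[OF R_mult[OF z(1) b(1)]] by simp
  also have "(\<Sum>(x, y)\<leftarrow>L. x * lift id_action y) = (\<Sum>(x, y)\<leftarrow>L. x * y)"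
    using L(1) by (intro arg_cong[where f = sum_list] map_cong) (auto simp: lift_id_action)
  also have "\<dots> * (z * b) = u * z" by (simp add: u_def mult_ac)
  finally have "u * z = (\<Sum>(x, y)\<leftarrow>L. x * trace (y * (z * b)))" by simp
  also have "\<dots> = of_nat q * t"
    unfolding t_def using L(1) m by (induction L) (auto simp: distrib_left)
  finally have "u * z = of_nat q * t" .
  moreover have S: "(\<Sum>(x, y)\<leftarrow>L. x * y) \<in> R"
    by (rule R_sum_list) (use L(1) R_mult in auto)
  then have "u \<in> R" unfolding u_def using b R_mult by blast
  moreover have "t \<in> R" unfolding t_def
    by (rule R_sum_list) (use L(1) R_mult R_of_int in auto)
  moreover have "u \<notin> Q" unfolding u_def using primeD[of b] R_alg[OF S] R_alg[OF b(1)] b(2) L(3) by blast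
  ultimately show ?thesis by blast
qed

text \<open>With trivial inertia, \<open>y\<close> could be replaced by \<open>t\<close> where
  \<open>u * y\<close> is \<open>q * t\<close> and \<open>u\<close> is outside \<open>Q\<close>.
  Each replacement lowers the exponent of \<open>q\<close> by two; from exponent 1 it would put
  \<open>u\<^sup>2 * m\<close>, a product of elements outside \<open>Q\<close>, into
  \<open>Q\<close>.\<close>

lemma inertia_nontrivial:
  assumes y: "y \<in> R" and w: "algebraic_int w" "w \<notin> Q" and m: "algebraic_int m" "m \<notin> Q"
    and eq: "y\<^sup>2 * w = of_nat q ^ n * m" and n: "odd n"
  shows "\<exists>s. qbar_aut s \<and> (\<exists>v\<in>V. s v \<noteq> v) \<and> (\<forall>x\<in>R. s x - x \<in> Q)"
proof (rule ccontr)
  assume "\<not> ?thesis"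
  then have triv: "\<exists>x\<in>R. s x - x \<notin> Q" if "qbar_aut s" "\<exists>v\<in>V. s v \<noteq> v" for s
    using that by blast
  have False if "y \<in> R" "algebraic_int m" "m \<notin> Q" "y\<^sup>2 * w = of_nat q ^ Suc (2 * k) * m" for k y m
    using that
  proof (induction k arbitrary: y m)
    case 0
    note p = 0
    show ?case
    proof -
      have alg_y: "algebraic_int y" "algebraic_int (y\<^sup>2)" using p(1) R_alg algebraic_int_power by blast+
      have "y\<^sup>2 * w \<in> Q" using p(4) mult_in_right[OF q_in p(2)] by simp
      then have yQ: "y \<in> Q" using primeD alg_y w power_in by blast
      obtain u t where ut: "u \<in> R" "t \<in> R" "u \<notin> Q" "u * y = of_nat q * t"
        using uniformizer_if_inertia_trivial[OF triv p(1) yQ] by blast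
      have "of_nat q * (of_nat q * (t\<^sup>2 * w)) = (of_nat q * t)\<^sup>2 * w" by (simp add: power2_eq_square)
      also have "\<dots> = u\<^sup>2 * (y\<^sup>2 * w)" by (simp add: ut(4)[symmetric] power2_eq_square)
      also have "\<dots> = of_nat q * (u\<^sup>2 * m)" using p(4) by simp
      finally have "of_nat q * (t\<^sup>2 * w) = u\<^sup>2 * m" using q prime_gt_0_nat by simp
      moreover have "of_nat q * (t\<^sup>2 * w) \<in> Q"
        using ut(2) R_alg w by (intro mult_in_right q_in algebraic_int_add_mult algebraic_int_power) auto
      ultimately have "u\<^sup>2 * m \<in> Q" by simp
      then show False using primeD algebraic_int_power R_alg ut(1,3) p(2,3) power_in by blast
    qed
  next
    case (Suc k)
    note p = Suc.prems
    have alg_y: "algebraic_int y" "algebraic_int (y\<^sup>2)" using p(1) R_alg algebraic_int_power by blast+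
    have "algebraic_int (of_nat q :: complex)" using algebraic_int_of_int[of "int q"] by simp
    then have "y\<^sup>2 * w \<in> Q"
      using p(4) mult_in_right[OF q_in algebraic_int_add_mult(2)[OF algebraic_int_power p(2)], of "of_nat q" "2 * Suc k"]
      by (simp add: mult_ac)
    then have yQ: "y \<in> Q" using primeD alg_y w power_in by blast
    obtain u t where ut: "u \<in> R" "t \<in> R" "u \<notin> Q" "u * y = of_nat q * t"
      using uniformizer_if_inertia_trivial[OF triv p(1) yQ] by blast
    have "of_nat q * (of_nat q * (t\<^sup>2 * w)) = (of_nat q * t)\<^sup>2 * w" by (simp add: power2_eq_square)
    also have "\<dots> = u\<^sup>2 * (y\<^sup>2 * w)" by (simp add: ut(4)[symmetric] power2_eq_square)
    also have "\<dots> = of_nat q * (of_nat q * (of_nat q ^ Suc (2 * k) * (u\<^sup>2 * m)))" using p(4) by simp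
    finally have eq: "t\<^sup>2 * w = of_nat q ^ Suc (2 * k) * (u\<^sup>2 * m)" using q prime_gt_0_nat by simp
    have "u\<^sup>2 * m \<notin> Q" using primeD algebraic_int_power R_alg ut(1,3) p(2,3) power_in by blast
    moreover have "algebraic_int (u\<^sup>2 * m)"
      using ut(1) R_alg p(2) by (intro algebraic_int_add_mult algebraic_int_power) auto
    ultimately show False using Suc.IH[OF ut(2) _ _ eq] by blast
  qed
  moreover obtain k where "n = Suc (2 * k)" using n by (auto elim: oddE)
  ultimately show False using y m eq by blast
qed

end

section \<open>Eisenstein polynomials\<close>

abbreviation ipoly :: "int poly \<Rightarrow> complex \<Rightarrow> complex" where
  "ipoly g x \<equiv> poly (map_poly of_int g) x"

lemma ipoly_altdef: "ipoly g x = (\<Sum>i\<le>degree g. of_int (coeff g i) * x ^ i)"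
  by (simp add: poly_altdef coeff_map_poly)

lemma algebraic_int_ipoly: "algebraic_int x \<Longrightarrow> algebraic_int (ipoly g x)"
  unfolding ipoly_altdef
  by (intro algebraic_int_sum algebraic_int_add_mult algebraic_int_of_int algebraic_int_power)

lemma (in prime_ideal) ipoly_cong:
  assumes "algebraic_int x" "algebraic_int y" "x - y \<in> Q"
  shows "ipoly g x - ipoly g y \<in> Q"
proof (induction g)
  case 0
  show ?case by (simp add: zero_in)
next
  case (pCons a g)
  have "ipoly (pCons a g) x - ipoly (pCons a g) y = x * (ipoly g x - ipoly g y) + (x - y) * ipoly g y"
    using pCons.hyps by (simp add: map_poly_pCons algebra_simps)
  moreover have "x * (ipoly g x - ipoly g y) + (x - y) * ipoly g y \<in> Q"
    by (intro add_in mult_in mult_in_right pCons assms algebraic_int_ipoly)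
  ultimately show ?case by simp
qed

text \<open>At a prime \<open>Q\<close> above \<open>P\<close>, the number \<open>x\<close> has d-th
  power \<open>P * E\<close> with \<open>E\<close> outside \<open>Q\<close>, so it behaves like an
  element of valuation 1/d. The terms of a polynomial of degree below d then have distinct
  valuations modulo 1 and cannot cancel. The proof makes this precise without valuations.\<close>

lemma eisenstein_degree_minimal:
  fixes F g :: "int poly"
  assumes P: "prime (P::nat)" and F: "lead_coeff F = 1" "\<And>i. i < degree F \<Longrightarrow> int P dvd coeff F i"
    "\<not> (int P)\<^sup>2 dvd coeff F 0"
    and x: "ipoly F x = 0" and g: "g \<noteq> 0" "ipoly g x = 0"
  shows "degree F \<le> degree g"
proof (rule ccontr)
  assume "\<not> degree F \<le> degree g"
  define d where "d = degree F"
  define h where "h = primitive_part g"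
  have dg: "degree h < d" using \<open>\<not> degree F \<le> degree g\<close> by (simp add: h_def d_def)
  then have d0: "d > 0" by simp
  have "ipoly g x = of_int (content g) * ipoly h x"
  proof -
    have "g = Polynomial.smult (content g) h" by (simp add: h_def)
    then have "map_poly of_int g = Polynomial.smult (of_int (content g)) (map_poly of_int h :: complex poly)"
      by (metis of_int_hom.map_poly_hom_smult)
    then show ?thesis by simp
  qed
  then have hx: "ipoly h x = 0" using g by simp
  have "content h = 1" using g by (simp add: h_def)
  have "\<exists>i. \<not> int P dvd coeff h i"
  proof (rule ccontr)
    assume "\<not> ?thesis"
    then have "int P dvd content h"
      by (simp add: const_poly_dvd_iff_dvd_content[symmetric] const_poly_dvd_iff)
    with \<open>content h = 1\<close> P show False by auto
  qed
  define i where "i = (LEAST i. \<not> int P dvd coeff h i)"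
  have i: "\<not> int P dvd coeff h i" unfolding i_def by (rule LeastI_ex) fact
  have imin: "int P dvd coeff h j" if "j < i" for j using not_less_Least that unfolding i_def by blast
  have ideg: "i \<le> degree h" using i by (intro le_degree) auto
  obtain Q where Q: "prime_above P Q" using prime_above_exists[OF P] by blast
  interpret prime_ideal P Q by unfold_locales (rule P Q)+
  have algx: "algebraic_int x"
    using F(1) x unfolding algebraic_int_altdef_ipoly by blast
  have "\<forall>j. \<exists>c. j < d \<longrightarrow> coeff F j = int P * c" using F(2) by (auto simp: d_def dvd_def)
  from choice[OF this] obtain c where c: "\<forall>j. j < d \<longrightarrow> coeff F j = int P * c j" ..
  define E where "E = - (\<Sum>j<d. of_int (c j) * x ^ j)"
  have xd: "x ^ d = of_nat P * E"
  proof -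
    have "0 = (\<Sum>j\<le>d. of_int (coeff F j) * x ^ j)" using x by (simp add: ipoly_altdef d_def)
    also have "\<dots> = (\<Sum>j<d. of_int (coeff F j) * x ^ j) + x ^ d"
      using F(1) by (simp add: d_def lessThan_Suc_atMost[symmetric])
    also have "(\<Sum>j<d. of_int (coeff F j) * x ^ j) = (\<Sum>j<d. of_nat P * (of_int (c j) * x ^ j))"
      using c by (intro sum.cong) auto
    also have "\<dots> = - (of_nat P * E)" by (simp add: E_def sum_distrib_left)
    finally show ?thesis by simp
  qed
  have algE: "algebraic_int E"
    unfolding E_def algebraic_int_minus_iff
    by (intro algebraic_int_sum algebraic_int_add_mult algebraic_int_of_int algebraic_int_power algx)
  have xQ: "x \<in> Q" using xd mult_in_right[OF q_in algE] power_in algx by metis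
  have EQ: "E \<notin> Q"
  proof
    assume "E \<in> Q"
    obtain d' where d': "d = Suc d'" using d0 gr0_implies_Suc by blast
    have "E = - of_int (c 0) - x * (\<Sum>j<d'. of_int (c (Suc j)) * x ^ j)"
      unfolding E_def d' sum.lessThan_Suc_shift by (simp add: sum_distrib_left mult_ac)
    then have "of_int (c 0) = - E - x * (\<Sum>j<d'. of_int (c (Suc j)) * x ^ j)" by simp
    also have "\<dots> \<in> Q"
      by (intro diff_in minus_in \<open>E \<in> Q\<close> mult_in_right xQ algebraic_int_sum algebraic_int_add_mult algebraic_int_of_int algebraic_int_power algx)
    finally have "int P dvd c 0" unfolding of_int_in_iff .
    then show False using F(3) c d0 by (auto simp: power2_eq_square)
  qed
  \<comment> \<open>After multiplication by \<open>x ^ (d - 1 - i)\<close> every term but the i-th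
    is a multiple of \<open>P\<close>: the earlier ones by the choice of \<open>i\<close>, the later
    ones because their exponent reaches \<open>d\<close>.\<close>
  have summand: "\<exists>u. algebraic_int u \<and> of_int (coeff h j) * x ^ (j + (d - 1 - i)) = of_nat P * u"
    if j: "j \<noteq> i" for j
  proof (cases "j < i")
    case True
    then obtain m where "coeff h j = int P * m" using imin by (auto simp: dvd_def)
    then have "of_int (coeff h j) * x ^ (j + (d - 1 - i)) = of_nat P * (of_int m * x ^ (j + (d - 1 - i)))" by simp
    moreover have "algebraic_int (of_int m * x ^ (j + (d - 1 - i)))"
      by (intro algebraic_int_add_mult algebraic_int_of_int algebraic_int_power algx)
    ultimately show ?thesis by blast
  next
    case False
    then have "j + (d - 1 - i) = (j - i - 1) + d" using j ideg dg by simp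
    then have "of_int (coeff h j) * x ^ (j + (d - 1 - i)) = of_nat P * (of_int (coeff h j) * (x ^ (j - i - 1) * E))"
      by (simp add: power_add xd)
    moreover have "algebraic_int (of_int (coeff h j) * (x ^ (j - i - 1) * E))"
      by (intro algebraic_int_add_mult algebraic_int_of_int algebraic_int_power algx algE)
    ultimately show ?thesis by blast
  qed
  then have "\<forall>j. \<exists>u. j \<noteq> i \<longrightarrow> algebraic_int u \<and> of_int (coeff h j) * x ^ (j + (d - 1 - i)) = of_nat P * u" by blast
  from choice[OF this] obtain u
    where u: "\<forall>j. j \<noteq> i \<longrightarrow> algebraic_int (u j) \<and> of_int (coeff h j) * x ^ (j + (d - 1 - i)) = of_nat P * u j" ..
  define \<theta> where "\<theta> = - (\<Sum>j\<in>{..degree h} - {i}. u j)"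
  have alg\<theta>: "algebraic_int \<theta>" unfolding \<theta>_def algebraic_int_minus_iff using u by (intro algebraic_int_sum) auto
  have "0 = ipoly h x * x ^ (d - 1 - i)" using hx by simp
  also have "\<dots> = (\<Sum>j\<le>degree h. of_int (coeff h j) * x ^ (j + (d - 1 - i)))"
    by (simp add: ipoly_altdef sum_distrib_right power_add mult.assoc)
  also have "\<dots> = of_int (coeff h i) * x ^ (i + (d - 1 - i)) + (\<Sum>j\<in>{..degree h} - {i}. of_int (coeff h j) * x ^ (j + (d - 1 - i)))"
    by (rule sum.remove) (use ideg in auto)
  also have "(\<Sum>j\<in>{..degree h} - {i}. of_int (coeff h j) * x ^ (j + (d - 1 - i))) = (\<Sum>j\<in>{..degree h} - {i}. of_nat P * u j)"
    using u by (intro sum.cong) auto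
  also have "\<dots> = - (of_nat P * \<theta>)" by (simp add: \<theta>_def sum_distrib_left)
  also have "i + (d - 1 - i) = d - 1" using ideg dg by simp
  finally have "of_int (coeff h i) * x ^ (d - 1) = of_nat P * \<theta>" by simp
  \<comment> \<open>The d-th power turns x into \<open>P * E\<close>: the left side carries
    \<open>P ^ (d - 1)\<close>, the right side \<open>P ^ d\<close>, and the surplus factor
    \<open>P\<close> gives the contradiction.\<close>
  then have "(of_int (coeff h i) * x ^ (d - 1)) ^ d = (of_nat P * \<theta>) ^ d" by simp
  then have "of_int (coeff h i) ^ d * (x ^ d) ^ (d - 1) = of_nat P ^ d * \<theta> ^ d"
    by (simp add: power_mult_distrib power_mult[symmetric] mult.commute)
  then have "of_nat P ^ (d - 1) * (of_int (coeff h i) ^ d * E ^ (d - 1)) = of_nat P ^ (d - 1) * (of_nat P * \<theta> ^ d)"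
    using power_minus_mult[OF d0, of "of_nat P :: complex"] unfolding xd power_mult_distrib by (metis mult.assoc mult.left_commute)
  then have "of_int (coeff h i) ^ d * E ^ (d - 1) = of_nat P * \<theta> ^ d"
    using P prime_gt_0_nat by simp
  then have "of_int (coeff h i) ^ d * E ^ (d - 1) \<in> Q"
    using mult_in_right[OF q_in algebraic_int_power[OF alg\<theta>, of d]] by simp
  moreover have "algebraic_int (of_int (coeff h i) ^ d :: complex)" "algebraic_int (E ^ (d - 1))"
    by (intro algebraic_int_power algebraic_int_of_int algE)+
  ultimately have "of_int (coeff h i) ^ d \<in> Q \<or> E ^ (d - 1) \<in> Q" by (intro primeD)
  then have "of_int (coeff h i) \<in> Q \<or> E \<in> Q" using power_in algebraic_int_of_int algE by blast
  then show False using EQ i of_int_in_iff by blast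
qed

section \<open>Roots that coincide modulo a prime ideal\<close>

lemma synthetic_div_algebraic_int:
  fixes c :: complex
  assumes "algebraic_int c" "\<And>i. algebraic_int (coeff p i)"
  shows "algebraic_int (poly p c) \<and> (\<forall>i. algebraic_int (coeff (synthetic_div p c) i))"
  using assms(2)
proof (induction p)
  case (pCons a p)
  have "algebraic_int (coeff p i)" for i using pCons.prems[of "Suc i"] by simp
  note IH = pCons.IH[OF this]
  have "algebraic_int a" using pCons.prems[of 0] by simp
  then show ?case
    using IH assms(1) by (auto simp: coeff_pCons split: nat.split intro!: algebraic_int_add_mult)
qed simp

text \<open>Division by the monic \<open>[:- c, 1:]\<close> keeps the coefficients algebraic
  integers, so several roots can be split off in turn without denominators.\<close>

lemma factor_root_algebraic_int:
  fixes c :: complex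
  assumes "algebraic_int c" "\<And>i. algebraic_int (coeff p i)" "poly p c = 0"
  shows "\<exists>h. p = [:- c, 1:] * h \<and> (\<forall>i. algebraic_int (coeff h i))"
proof -
  have "p = [:- c, 1:] * synthetic_div p c"
    using synthetic_div_correct'[of c p] assms(3) by simp
  then show ?thesis using synthetic_div_algebraic_int[OF assms(1,2)] by blast
qed

lemma algebraic_int_poly:
  assumes "algebraic_int (c::complex)" "\<And>i. algebraic_int (coeff p i)"
  shows "algebraic_int (poly p c)"
  using synthetic_div_algebraic_int[of c p] assms by simp

lemma algebraic_int_coeff_pderiv:
  assumes "\<And>i. algebraic_int (coeff (p :: complex poly) i)"
  shows "algebraic_int (coeff (pderiv p) i)"
  using algebraic_int_add_mult(2)[OF algebraic_int_of_int[of "int (Suc i)"] assms[of "Suc i"]]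
  by (simp add: coeff_pderiv)

lemma (in prime_ideal) pderiv_in_if_double:
  assumes p: "\<And>i. algebraic_int (coeff p i)" and r: "poly p a = 0" "poly p b = 0" "a \<noteq> b"
    and alg: "algebraic_int a" "algebraic_int b" and ab: "a - b \<in> Q"
  shows "poly (pderiv p) a \<in> Q"
proof -
  obtain h where h: "p = [:- a, 1:] * h" "\<And>i. algebraic_int (coeff h i)"
    using factor_root_algebraic_int[OF alg(1) p r(1)] by blast
  have "poly h b = 0" using r h(1) by simp
  obtain g where g: "h = [:- b, 1:] * g" "\<And>i. algebraic_int (coeff g i)"
    using factor_root_algebraic_int[OF alg(2) h(2) \<open>poly h b = 0\<close>] by blast
  have "poly (pderiv p) a = (a - b) * poly g a"
    unfolding h(1) g(1) pderiv_mult by (simp add: pderiv_pCons algebra_simps)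
  then show ?thesis using mult_in_right[OF ab algebraic_int_poly[OF alg(1) g(2)]] by simp
qed

text \<open>Two differentiations remove at most two of the three linear factors at \<open>a\<close>,
  \<open>b\<close>, \<open>c\<close>, so every term of the second derivative at \<open>z\<close>
  keeps a factor in \<open>Q\<close>.\<close>

lemma (in prime_ideal) pderiv2_in_if_triple:
  assumes p: "\<And>i. algebraic_int (coeff p i)" and r: "poly p a = 0" "poly p b = 0" "poly p c = 0"
    and ne: "a \<noteq> b" "a \<noteq> c" "b \<noteq> c"
    and alg: "algebraic_int a" "algebraic_int b" "algebraic_int c" "algebraic_int z"
    and Q: "z - a \<in> Q" "z - b \<in> Q" "z - c \<in> Q"
  shows "poly (pderiv (pderiv p)) z \<in> Q"
proof -
  obtain h where h: "p = [:- a, 1:] * h" "\<And>i. algebraic_int (coeff h i)"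
    using factor_root_algebraic_int[OF alg(1) p r(1)] by blast
  have hb: "poly h b = 0" "poly h c = 0" using r ne h(1) by simp_all
  obtain g where g: "h = [:- b, 1:] * g" "\<And>i. algebraic_int (coeff g i)"
    using factor_root_algebraic_int[OF alg(2) h(2) hb(1)] by blast
  have gc: "poly g c = 0" using hb ne g(1) by simp
  obtain f where f: "g = [:- c, 1:] * f" "\<And>i. algebraic_int (coeff f i)"
    using factor_root_algebraic_int[OF alg(3) g(2) gc] by blast
  define f0 f1 f2 where "f0 = poly f z" and "f1 = poly (pderiv f) z" and "f2 = poly (pderiv (pderiv f)) z"
  have "poly (pderiv (pderiv p)) z =
      (z - a) * (2 * f0 + 2 * (z - b) * f1 + (z - b) * ((z - c) * f2))
    + (z - b) * (2 * f0 + 2 * (z - c) * f1) + (z - c) * (2 * f0 + 2 * (z - a) * f1)"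
    unfolding h(1) g(1) f(1) pderiv_mult pderiv_add poly_add poly_mult f0_def f1_def f2_def
    by (simp add: pderiv_pCons algebra_simps)
  moreover have two: "algebraic_int (2::complex)" using algebraic_int_of_int[of 2] by simp
  have "algebraic_int f0" "algebraic_int f1" "algebraic_int f2"
    unfolding f0_def f1_def f2_def
    by (intro algebraic_int_poly alg f algebraic_int_coeff_pderiv)+
  then have "(z - a) * (2 * f0 + 2 * (z - b) * f1 + (z - b) * ((z - c) * f2))
    + (z - b) * (2 * f0 + 2 * (z - c) * f1) + (z - c) * (2 * f0 + 2 * (z - a) * f1) \<in> Q"
    by (intro add_in mult_in_right Q algebraic_int_add_mult algebraic_int_diff alg two)
  ultimately show ?thesis by simp
qed

section \<open>Conjugacy and simplicity of the roots of an Eisenstein polynomial\<close>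

lemma eisenstein_conjugate:
  fixes F :: "int poly"
  assumes P: "prime (P::nat)" and F: "lead_coeff F = 1" "\<And>i. i < degree F \<Longrightarrow> int P dvd coeff F i"
    "\<not> (int P)\<^sup>2 dvd coeff F 0"
    and x: "ipoly F x = 0" and y: "ipoly F y = 0"
  obtains s where "qbar_aut s" "s x = y"
proof (rule qbar_aut_conjugate[OF _ _ x y])
  show "coeff (map_poly of_int F) i \<in> \<rat>" for i by (simp add: coeff_map_poly)
  show "lead_coeff (map_poly of_int F) = (1::complex)" using F(1) by (simp add: coeff_map_poly)
  fix p :: "complex poly" assume p: "\<And>i. coeff p i \<in> \<rat>" "poly p x = 0" "p \<noteq> 0"
  obtain c q where cq: "c \<noteq> 0" "Polynomial.smult (of_int c) p = map_poly of_int q"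
    using rat_poly_clear_denominators[OF p(1)] by blast
  then have "q \<noteq> 0" using p(3) by auto
  moreover have "ipoly q x = 0" using p(2) cq(2)[symmetric] by simp
  ultimately have "degree F \<le> degree q" by (intro eisenstein_degree_minimal[OF P F x])
  also have "degree q = degree (map_poly of_int q :: complex poly)" by simp
  also have "\<dots> = degree p" unfolding cq(2)[symmetric] using cq(1) by simp
  finally show "degree (map_poly of_int F :: complex poly) \<le> degree p" by simp
qed (rule that)

lemma eisenstein_separable:
  fixes F :: "int poly"
  assumes P: "prime (P::nat)" and F: "lead_coeff F = 1" "\<And>i. i < degree F \<Longrightarrow> int P dvd coeff F i"
    "\<not> (int P)\<^sup>2 dvd coeff F 0"
    and d: "degree F > 0" and x: "ipoly F x = 0"
  shows "ipoly (pderiv F) x \<noteq> 0"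
proof
  assume 0: "ipoly (pderiv F) x = 0"
  have "pderiv F \<noteq> 0" using d by (simp add: pderiv_eq_0_iff)
  then have "degree F \<le> degree (pderiv F)"
    using 0 by (intro eisenstein_degree_minimal[OF P F x])
  then show False using d by (simp add: degree_pderiv)
qed

section \<open>Iterates of the polynomials\<close>

definition iter_int :: "int poly \<Rightarrow> nat \<Rightarrow> int poly" where
  "iter_int f n = ((\<lambda>q. pcompose f q) ^^ n) [:0, 1:]"

lemma iter_int_0 [simp]: "iter_int f 0 = [:0, 1:]"
  and iter_int_Suc: "iter_int f (Suc n) = pcompose f (iter_int f n)"
  by (simp_all add: iter_int_def)

lemma iter_poly_eq: "iter_poly f n = map_poly of_int (iter_int f n)"
  by (induction n) (simp_all add: iter_poly_def iter_int_def cpoly_def of_int_hom.map_poly_pcompose)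

lemma ipoly_iter_int: "ipoly (iter_int f n) x = (ipoly f ^^ n) x"
  by (induction n) (simp_all add: iter_int_Suc poly_pcompose of_int_hom.map_poly_pcompose)

lemma ipoly_of_int: "ipoly g (of_int z) = of_int (poly g z)"
  by simp

lemma pderiv_iter_int: "ipoly (pderiv (iter_int f n)) x = (\<Prod>i<n. ipoly (pderiv f) ((ipoly f ^^ i) x))"
proof (induction n)
  case (Suc n)
  have "ipoly (pderiv (iter_int f (Suc n))) x =
      ipoly (pderiv f) (ipoly (iter_int f n) x) * ipoly (pderiv (iter_int f n)) x"
    by (simp add: iter_int_Suc pderiv_pcompose of_int_poly_hom.hom_mult of_int_hom.map_poly_pcompose poly_pcompose)
  then show ?case by (simp add: Suc ipoly_iter_int mult.commute)
qed (simp add: pderiv_pCons)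

lemma power_congruence: "(a - b :: 'a::comm_ring_1) dvd a ^ n - b ^ n"
proof (induction n)
  case (Suc n)
  have "a ^ Suc n - b ^ Suc n = a * (a ^ n - b ^ n) + (a - b) * b ^ n" by (simp add: algebra_simps)
  then show ?case using Suc by simp
qed simp

lemma pcompose_monom: "pcompose (monom c n) q = Polynomial.smult c (q ^ n)"
  by (induction n) (simp_all add: monom_0 monom_Suc pcompose_pCons)

text \<open>The \<open>n\<close>-th iterate of \<open>phi_pk p k\<close> takes its critical point \<open>- k * (p - 1)\<close>
  to \<open>k\<close> times this number.\<close>
fun critical_quotient :: "nat \<Rightarrow> nat \<Rightarrow> nat \<Rightarrow> int" where
  "critical_quotient p k 0 = - (int p - 1)"
| "critical_quotient p k (Suc n) =
     int k ^ (p - 1) * critical_quotient p k n ^ (p - 1) * (critical_quotient p k n + int p) - int p"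

text \<open>Non-squareness is the arithmetic input left to each instance. Admitting
  \<open>p = 2\<close> lets the degree 2 example share the whole argument.\<close>

locale phi_family =
  fixes p k :: nat
  assumes p: "prime p" and k: "k > 0" and pk: "\<not> p dvd k"
    and nonsquare: "\<And>n m. n > 0 \<Longrightarrow> \<bar>critical_quotient p k n\<bar> \<noteq> m\<^sup>2"
begin

definition "f = phi_pk p k"
definition "F = iter_int f"
definition "c = - (int k * (int p - 1))"

lemma p2: "p \<ge> 2" by (rule prime_ge_2_nat[OF p])

lemma f_eq: "f = monom 1 p + monom (int k * int p) (p - 1) - [:int k * int p:]"
  by (simp add: f_def phi_pk_def)

lemma poly_f: "poly f z = z ^ (p - 1) * (z + int k * int p) - int k * int p"
proof -
  have "z ^ p = z ^ (p - 1) * z" using p2 power_minus_mult[of p z] by simp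
  then show ?thesis unfolding f_eq by (simp add: poly_monom algebra_simps)
qed

lemma pderiv_f: "pderiv f = Polynomial.smult (int p) (monom 1 (p - 2) * [:- c, 1:])"
proof -
  obtain r where r: "p = Suc (Suc r)" using p2 by (metis One_nat_def Suc_le_D Suc_1 Suc_le_mono)
  have 1: "[:- c, 1:] = monom (int k * (1 + int r)) 0 + monom 1 1"
    unfolding c_def by (simp add: monom_0 monom_Suc r)
  have "pderiv f = monom (int p) (Suc r) + monom (int (Suc r) * (int k * int p)) r"
    unfolding f_eq pderiv_add pderiv_diff pderiv_monom by (simp add: r)
  also have "\<dots> = Polynomial.smult (int p) (monom 1 (p - 2) * [:- c, 1:])"
    unfolding 1 distrib_left mult_monom smult_add_right smult_monom
    by (simp add: r algebra_simps)
  finally show ?thesis .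
qed

lemma degree_f: "degree f = p" and lead_f: "lead_coeff f = 1"
proof -
  have c: "coeff f i = (if i = p then 1 else if i = p - 1 then int k * int p else 0) - (if i = 0 then int k * int p else 0)" for i
    using p2 unfolding f_eq by (auto simp: coeff_pCons split: nat.split)
  show d: "degree f = p"
  proof (rule antisym)
    show "degree f \<le> p" by (rule degree_le) (auto simp: c)
    show "p \<le> degree f" by (rule le_degree) (use p2 in \<open>auto simp: c\<close>)
  qed
  show "lead_coeff f = 1" using p2 by (simp add: d c)
qed

lemma F_0: "F 0 = [:0, 1:]" and F_Suc: "F (Suc n) = pcompose f (F n)"
  by (simp_all add: F_def iter_int_Suc)

lemma degree_F: "degree (F n) = p ^ n"
  by (induction n) (simp_all add: F_0 F_Suc degree_pcompose degree_f)

lemma lead_F: "lead_coeff (F n) = 1"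
proof (induction n)
  case (Suc n)
  have "degree (F n) > 0" using p2 by (simp add: degree_F)
  from lead_coeff_comp[OF this, of f] show ?case
    using Suc by (simp add: F_Suc lead_f)
qed (simp add: F_0)

text \<open>Modulo \<open>p\<close> the polynomial \<open>f\<close> is the p-th power map, so its
  iterates are monomials.\<close>

lemma F_cong: "[:int p:] dvd F n - monom 1 (p ^ n)"
proof (induction n)
  case 0
  show ?case by (simp add: F_0 monom_Suc monom_0)
next
  case (Suc n)
  have "F (Suc n) - monom 1 (p ^ Suc n) = (F n ^ p - monom 1 (p ^ n) ^ p)
      + [:int p:] * (Polynomial.smult (int k) (F n ^ (p - 1)) - [:int k:])"
    unfolding F_Suc f_eq pcompose_add pcompose_diff pcompose_monom
    by (simp add: monom_power mult.commute algebra_simps)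
  moreover have "[:int p:] dvd F n ^ p - monom 1 (p ^ n) ^ p"
    using Suc power_congruence dvd_trans by blast
  ultimately show ?case by (metis dvd_add dvd_triv_left)
qed

lemma F_coeff_dvd: "i < degree (F n) \<Longrightarrow> int p dvd coeff (F n) i"
  using F_cong[of n] by (auto simp: const_poly_dvd_iff degree_F dest!: spec[of _ i])

lemma F_coeff_0: "n > 0 \<Longrightarrow> coeff (F n) 0 = - (int k * int p)"
proof (induction n)
  case (Suc n)
  have "coeff (F (Suc n)) 0 = poly f (coeff (F n) 0)"
    by (simp add: F_Suc poly_0_coeff_0[symmetric] poly_pcompose)
  also have "\<dots> = - (int k * int p)"
    using Suc p2 by (cases "n = 0") (auto simp: F_0 poly_f)
  finally show ?case .
qed simp

lemma F_coeff_0_not_dvd: "n > 0 \<Longrightarrow> \<not> (int p)\<^sup>2 dvd coeff (F n) 0"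
  using pk p2 by (simp add: F_coeff_0 power2_eq_square)

definition "V n = {x. ipoly (F n) x = 0}"

lemma F_nonzero: "(map_poly of_int (F n) :: complex poly) \<noteq> 0"
  using lead_F[of n] by auto

lemma finite_V: "finite (V n)"
  unfolding V_def using F_nonzero by (rule poly_roots_finite)

lemma V_algebraic_int: "x \<in> V n \<Longrightarrow> algebraic_int x"
  unfolding V_def algebraic_int_altdef_ipoly using lead_F by blast

lemma V_stable: "qbar_aut s \<Longrightarrow> x \<in> V n \<Longrightarrow> s x \<in> V n"
  using qbar_aut_poly[of s x "F n"] V_algebraic_int[of x n] qbar_aut_0[of s]
  by (auto simp: V_def)

lemma V_transitive:
  assumes "x \<in> V n" "y \<in> V n" "n > 0"
  obtains s where "qbar_aut s" "s x = y"
  using eisenstein_conjugate[OF p lead_F F_coeff_dvd F_coeff_0_not_dvd[OF assms(3)]] assms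
  unfolding V_def by blast

lemma V_separable: "x \<in> V n \<Longrightarrow> ipoly (pderiv (F n)) x \<noteq> 0"
proof (cases "n = 0")
  case True
  then show ?thesis by (simp add: F_0 pderiv_pCons)
next
  case False
  assume "x \<in> V n"
  moreover have "degree (F n) > 0" using p2 by (simp add: degree_F)
  ultimately show ?thesis
    using eisenstein_separable[OF p lead_F F_coeff_dvd F_coeff_0_not_dvd] False
    unfolding V_def by blast
qed

lemma F_rsquarefree: "rsquarefree (map_poly of_int (F n) :: complex poly)"
  unfolding rsquarefree_roots
  using V_separable[of _ n] by (auto simp: V_def of_int_hom.map_poly_pderiv)

lemma critical_value: "poly (F n) c = int k * critical_quotient p k n"
proof (induction n)
  case 0
  show ?case by (simp add: F_0 c_def algebra_simps)
next
  case (Suc n)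
  let ?b = "critical_quotient p k n"
  have "poly (F (Suc n)) c = (int k * ?b) ^ (p - 1) * (int k * ?b + int k * int p) - int k * int p"
    by (simp add: F_Suc poly_pcompose Suc poly_f)
  also have "\<dots> = int k * critical_quotient p k (Suc n)"
    by (simp add: power_mult_distrib algebra_simps)
  finally show ?case .
qed

text \<open>Modulo \<open>p\<close> the recursion sends b to k^(p-1) b^p, starting from 1, and
  \<open>p\<close> does not divide \<open>k\<close>.\<close>

lemma p_not_dvd_critical: "\<not> int p dvd critical_quotient p k n"
proof (induction n)
  case 0
  show ?case
  proof
    assume "int p dvd critical_quotient p k 0"
    then have "int p dvd 1 - int p" by simp
    from dvd_add[OF this dvd_refl] show False using p2 by simp
  qed
next
  case (Suc n)
  let ?b = "critical_quotient p k n"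
  have pp: "prime (int p)" using p by simp
  have "\<not> int p dvd int k ^ (p - 1)" using pk prime_dvd_power[OF pp, of "int k" "p - 1"] by (metis int_dvd_int_iff)
  moreover have "\<not> int p dvd ?b ^ (p - 1)" using Suc prime_dvd_power[OF pp, of ?b "p - 1"] by metis
  moreover have "\<not> int p dvd ?b + int p" using Suc by simp
  ultimately have "\<not> int p dvd int k ^ (p - 1) * ?b ^ (p - 1) * (?b + int p)"
    using pp by (simp add: prime_dvd_mult_iff)
  then show ?case by (simp add: dvd_diff_left_iff)
qed

text \<open>For positive \<open>n\<close> the recursion makes the number congruent to -p modulo
  \<open>k\<close>. The initial value -(p-1) may well share factors with \<open>k\<close>.\<close>

lemma coprime_k_critical: "n > 0 \<Longrightarrow> coprime (int k) (critical_quotient p k n)"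
proof (cases n)
  case (Suc m)
  have kp: "coprime (int k) (int p)"
    using prime_imp_coprime[OF p pk] by (simp add: coprime_commute)
  have "int k dvd int k ^ (p - 1)" using p2 by (intro dvd_power) auto
  then obtain j where "int k ^ (p - 1) = int k * j" by (elim dvdE)
  then have cq: "critical_quotient p k n = int k * (j * critical_quotient p k m ^ (p - 1) * (critical_quotient p k m + int p)) - int p"
    unfolding Suc by simp
  show ?thesis
  proof (rule coprimeI)
    fix d assume d: "d dvd int k" "d dvd critical_quotient p k n"
    then have "d dvd int p" unfolding cq by (simp add: dvd_diff_right_iff)
    then show "is_unit d" using kp d(1) coprime_common_divisor by blast
  qed
qed simp

text \<open>A non-square has a prime \<open>q\<close> of odd multiplicity. As the critical quotient
  is prime to \<open>k\<close> and \<open>p\<close>, so is \<open>q\<close>; hence the extra factor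
  \<open>k\<close> in the critical value leaves the exponent of \<open>q\<close> unchanged.\<close>

lemma ramified_prime:
  assumes "n > 0"
  obtains q v m where "prime q" "odd v" "poly (F n) c = int q ^ v * m" "\<not> int q dvd m" "\<not> q dvd k * p"
proof -
  define b where "b = critical_quotient p k n"
  define B where "B = nat \<bar>b\<bar>"
  have "\<not> is_nth_power 2 B"
  proof
    assume "is_nth_power 2 B"
    then obtain y where "B = y\<^sup>2" by (auto simp: is_nth_power_def)
    then have "\<bar>b\<bar> = (int y)\<^sup>2" by (simp add: B_def nat_eq_iff)
    then show False using nonsquare[OF assms] by (simp add: b_def)
  qed
  then obtain q where q: "prime q" "odd (multiplicity q B)"
    by (auto simp: is_nth_power_conv_multiplicity_nat)
  define v where "v = multiplicity q B"
  have b0: "b \<noteq> 0" using nonsquare[OF assms, of 0] by (auto simp: b_def)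
  have "B \<noteq> 0" "\<not> is_unit q" using b0 q(1) by (auto simp: B_def)
  from multiplicity_decompose'[OF this]
  obtain m where m: "B = q ^ v * m" "\<not> q dvd m" unfolding v_def by blast
  define m' where "m' = sgn b * int m"
  have "b = sgn b * \<bar>b\<bar>" by (simp add: sgn_mult_abs)
  also have "\<bar>b\<bar> = int q ^ v * int m"
    using arg_cong[OF m(1), of int] by (simp add: B_def)
  finally have b: "b = int q ^ v * m'" by (simp add: m'_def mult_ac)
  have m': "\<not> int q dvd m'"
    using m(2) b0 by (auto simp: m'_def sgn_if)
  have "v > 0" using q(2) by (simp add: v_def odd_pos)
  then have qb: "int q dvd b" unfolding b by simp
  have "\<not> int q dvd int k"
  proof
    assume "int q dvd int k"
    then have "is_unit (int q)"
      by (rule coprime_common_divisor[OF coprime_k_critical[OF assms]]) (use qb in \<open>simp add: b_def\<close>)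
    then show False using q(1) by auto
  qed
  then have qk: "\<not> q dvd k" by simp
  have "q \<noteq> p" using p_not_dvd_critical qb b_def by blast
  then have qp: "\<not> q dvd p" using p q(1) primes_dvd_imp_eq by blast
  show ?thesis
  proof (rule that[OF q(1)])
    show "odd v" using q(2) by (simp add: v_def)
    show "poly (F n) c = int q ^ v * (int k * m')"
      using b by (simp add: critical_value b_def[symmetric])
    show "\<not> int q dvd int k * m'" using qk m' q(1) by (simp add: prime_dvd_mult_iff)
    show "\<not> q dvd k * p" using qk qp q(1) by (simp add: prime_dvd_mult_iff)
  qed
qed

end

section \<open>Transpositions from ramification\<close>

lemma ipoly_simps:
  "ipoly (p + q) x = ipoly p x + ipoly q x" "ipoly (p - q) x = ipoly p x - ipoly q x"
  "ipoly (p * q) x = ipoly p x * ipoly q x" "ipoly (Polynomial.smult a p) x = of_int a * ipoly p x"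
  "ipoly (monom a n) x = of_int a * x ^ n" "ipoly [:a:] x = of_int a" "ipoly [:a, 1:] x = of_int a + x"
  by (simp_all add: of_int_poly_hom.hom_add of_int_poly_hom.hom_minus of_int_poly_hom.hom_mult
      of_int_hom.map_poly_hom_smult of_int_hom.map_poly_hom_monom poly_monom map_poly_pCons
      of_int_hom.map_poly_pCons_hom del: mult_pCons_left mult_pCons_right)

context phi_family
begin

definition "g = ipoly f"
definition C :: complex where "C = of_int c"
definition K :: complex where "K = of_int (int k * int p)"

lemma g_eq: "g x = x ^ (p - 1) * (x + K) - K"
proof -
  have "x ^ p = x ^ (p - 1) * x" using p2 power_minus_mult[of p x] by simp
  then show ?thesis
    unfolding g_def f_eq K_def ipoly_simps by (simp add: algebra_simps)
qed

lemma pderiv_g: "ipoly (pderiv f) x = of_int (int p) * (x ^ (p - 2) * (x - C))"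
  unfolding pderiv_f C_def ipoly_simps by simp

lemma pderiv2_g: "ipoly (pderiv (pderiv f)) C = of_int (int p) * C ^ (p - 2)"
proof -
  have "pderiv [:- c, 1:] = [:1:]" by (simp add: pderiv_pCons)
  then show ?thesis
    unfolding pderiv_f C_def pderiv_smult pderiv_mult ipoly_simps by (simp only: ipoly_simps) simp
qed

lemma ipoly_F: "ipoly (F n) x = (g ^^ n) x"
  unfolding F_def g_def by (rule ipoly_iter_int)

lemma V_iff: "x \<in> V n \<longleftrightarrow> (g ^^ n) x = 0"
  by (simp add: V_def ipoly_F)

lemma pderiv_F: "ipoly (pderiv (F n)) x = (\<Prod>i<n. ipoly (pderiv f) ((g ^^ i) x))"
  unfolding F_def g_def by (rule pderiv_iter_int)

lemma g_iterates_0: "n > 0 \<Longrightarrow> (g ^^ n) 0 = - K"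
proof (induction n)
  case (Suc n)
  show ?case using Suc p2 by (cases "n = 0") (simp_all add: g_eq)
qed simp

lemma pderiv_F_C: "n > 0 \<Longrightarrow> ipoly (pderiv (F n)) C = 0"
  unfolding pderiv_F by (rule prod_zero) (auto simp: pderiv_g intro!: bexI[of _ 0])

text \<open>\<open>C\<close> is critical for every iterate with positive index, so in the second
  derivative of a further composition only the term with the second derivative of the inner iterate
  survives at \<open>C\<close>.\<close>

lemma pderiv2_F_C:
  "ipoly (pderiv (pderiv (F (Suc n)))) C
     = ipoly (pderiv (pderiv f)) C * (\<Prod>i<n. ipoly (pderiv f) ((g ^^ Suc i) C))"
proof (induction n)
  case 0
  show ?case by (simp add: F_Suc F_0)
next
  case (Suc n)
  let ?G = "F (Suc n)"
  have "pderiv (F (Suc (Suc n))) = pcompose (pderiv f) ?G * pderiv ?G"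
    by (simp only: F_Suc pderiv_pcompose)
  then have "pderiv (pderiv (F (Suc (Suc n)))) =
      pcompose (pderiv f) ?G * pderiv (pderiv ?G) + pderiv ?G * (pcompose (pderiv (pderiv f)) ?G * pderiv ?G)"
    by (simp only: pderiv_mult pderiv_pcompose)
  then have "ipoly (pderiv (pderiv (F (Suc (Suc n))))) C =
      ipoly (pderiv f) (ipoly ?G C) * ipoly (pderiv (pderiv ?G)) C"
    using pderiv_F_C[of "Suc n"]
    by (simp only: of_int_poly_hom.hom_add of_int_poly_hom.hom_mult of_int_hom.map_poly_pcompose poly_add poly_mult poly_pcompose) simp
  then show ?case by (simp only: Suc ipoly_F prod.lessThan_Suc mult_ac)
qed

text \<open>Taylor expansion at the critical point with integral remainder \<open>W\<close>. At a
  root it says that \<open>(x - C)\<^sup>2 * ipoly W x\<close> is minus the critical value, the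
  equation to which \<open>inertia_nontrivial\<close> will be applied.\<close>

lemma F_taylor:
  assumes "n > 0"
  obtains W where "\<And>x. ipoly (F n) x = of_int (poly (F n) c) + (x - C)\<^sup>2 * ipoly W x"
    "ipoly (pderiv (pderiv (F n))) C = 2 * ipoly W C"
proof -
  let ?G = "F n - [:poly (F n) c:]"
  have "poly ?G c = 0" by simp
  then obtain H where H: "?G = [:- c, 1:] * H" unfolding poly_eq_0_iff_dvd by (elim dvdE)
  have "of_int (poly (pderiv (F n)) c) = (0::complex)"
    using pderiv_F_C[OF assms] unfolding C_def ipoly_of_int .
  then have "poly (pderiv (F n)) c = 0" by simp
  moreover have "pderiv (F n) = pderiv ?G" by (simp add: pderiv_diff pderiv_pCons)
  ultimately have "poly H c = 0" unfolding H pderiv_mult by (simp add: pderiv_pCons)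
  then obtain W where W: "H = [:- c, 1:] * W" unfolding poly_eq_0_iff_dvd by (elim dvdE)
  have Fn: "F n = [:poly (F n) c:] + [:- c, 1:] * ([:- c, 1:] * W)" using H W by simp
  show ?thesis
  proof (rule that[of W])
    fix x
    have "ipoly (F n) x = of_int (poly (F n) c) + (x - C) * ((x - C) * ipoly W x)"
      by (subst Fn) (simp only: ipoly_simps C_def of_int_minus add.commute[of "- of_int c"] diff_conv_add_uminus)
    then show "ipoly (F n) x = of_int (poly (F n) c) + (x - C)\<^sup>2 * ipoly W x"
      by (simp add: power2_eq_square)
    have "poly (pderiv (pderiv (F n))) c = 2 * poly W c"
      by (subst Fn, simp only: pderiv_add pderiv_mult poly_add poly_mult) (simp add: pderiv_pCons pderiv_mult)
    then show "ipoly (pderiv (pderiv (F n))) C = 2 * ipoly W C"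
      unfolding C_def ipoly_of_int by simp
  qed
qed

lemma g_algebraic_int: "algebraic_int x \<Longrightarrow> algebraic_int ((g ^^ n) x)"
  unfolding ipoly_F[symmetric] by (rule algebraic_int_ipoly)

lemma F_factorization: "ipoly (F n) x = (\<Prod>z\<in>V n. x - z)"
proof -
  have lc: "lead_coeff (map_poly of_int (F n)) = (1::complex)" using lead_F[of n] by simp
  have "map_poly of_int (F n) = (\<Prod>z\<in>V n. [:- z, 1:])"
    using complex_poly_decompose_rsquarefree[OF F_rsquarefree[of n]]
    unfolding lc V_def by simp
  then show ?thesis by (simp add: poly_prod)
qed

lemma transposition_exists:
  assumes n: "n > 0"
  shows "\<exists>s x y. qbar_aut s \<and> x \<in> V n \<and> y \<in> V n \<and> x \<noteq> y \<and> s x = y \<and> s y = x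
           \<and> (\<forall>v\<in>V n. v \<noteq> x \<longrightarrow> v \<noteq> y \<longrightarrow> s v = v)"
proof -
  obtain q v m where rp: "prime q" "odd v" "poly (F n) c = int q ^ v * m" "\<not> int q dvd m" "\<not> q dvd k * p"
    by (rule ramified_prime[OF n])
  obtain Q where Q: "prime_above q Q" using prime_above_exists[OF rp(1)] by blast
  interpret galois_prime "V n" q Q
    by unfold_locales (use finite_V V_algebraic_int V_stable rp(1) Q in simp_all)
  have algC: "algebraic_int C" by (simp add: C_def algebraic_int_of_int)
  have algK: "algebraic_int K" unfolding K_def by (rule algebraic_int_of_int)
  have "\<not> int q dvd int k * int p" using rp(5) by (metis int_dvd_int_iff of_nat_mult)
  then have KQ: "K \<notin> Q" unfolding K_def of_int_in_iff .
  have pQ: "(of_int (int p) :: complex) \<notin> Q" using rp(5) by (auto simp only: of_int_in_iff int_dvd_int_iff dvd_mult)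
  have v: "v > 0" using rp(2) by (simp add: odd_pos)
  have FC: "(g ^^ n) C = of_int (int q ^ v * m)"
    using ipoly_of_int[of "F n" c] rp(3) by (simp only: ipoly_F C_def)
  have FCQ: "(g ^^ n) C \<in> Q" unfolding FC of_int_in_iff using v by simp
  have cong: "(g ^^ i) x - (g ^^ i) y \<in> Q" if "algebraic_int x" "algebraic_int y" "x - y \<in> Q" for i x y
    unfolding ipoly_F[symmetric] by (rule ipoly_cong[OF that])
  have split: "(g ^^ n) x = (g ^^ (n - i)) ((g ^^ i) x)" if "i < n" for i x
    using that by (metis add.commute comp_apply funpow_add le_add_diff_inverse less_imp_le)
  \<comment> \<open>Modulo \<open>Q\<close>, 0 goes to the fixed point \<open>- K\<close>, which is
    nonzero since \<open>q\<close> does not divide \<open>k * p\<close>. An orbit that is at 0 at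
    time \<open>n\<close> was therefore never there before.\<close>
  have iter_notin: "(g ^^ i) x \<notin> Q" if x: "algebraic_int x" "(g ^^ n) x \<in> Q" "i < n" for x i
  proof
    assume "(g ^^ i) x \<in> Q"
    then have "(g ^^ i) x - 0 \<in> Q" by simp
    then have "(g ^^ (n - i)) ((g ^^ i) x) - (g ^^ (n - i)) 0 \<in> Q"
      by (intro cong g_algebraic_int x) simp_all
    then have "(g ^^ n) x + K \<in> Q" using x(3) by (simp add: split[OF x(3)] g_iterates_0)
    from diff_in[OF this x(2)] show False using KQ by simp
  qed
  \<comment> \<open>Reaching \<open>C\<close> at a time \<open>i > 0\<close> and 0 at time
    \<open>n\<close> would bring the orbit of \<open>C\<close> to 0 already at time
    \<open>n - i\<close>, against the previous fact.\<close>
  have iter_not_C: "i = 0" if x: "algebraic_int x" "(g ^^ n) x \<in> Q" "i < n" "(g ^^ i) x - C \<in> Q" for x i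
  proof (rule ccontr)
    assume i: "i \<noteq> 0"
    have "(g ^^ (n - i)) ((g ^^ i) x) - (g ^^ (n - i)) C \<in> Q"
      by (intro cong g_algebraic_int x algC)
    then have "(g ^^ n) x - (g ^^ (n - i)) C \<in> Q" by (simp add: split[OF x(3)])
    from diff_in[OF x(2) this] have "(g ^^ (n - i)) C \<in> Q" by simp
    moreover have "n - i < n" using i x(3) by simp
    ultimately show False using iter_notin[OF algC FCQ] by blast
  qed
  have deriv_notin: "ipoly (pderiv f) w \<notin> Q" if w: "algebraic_int w" "w \<notin> Q" "w - C \<notin> Q" for w
  proof
    assume "ipoly (pderiv f) w \<in> Q"
    then have "of_int (int p) * (w ^ (p - 2) * (w - C)) \<in> Q" by (simp only: pderiv_g)
    then have "w ^ (p - 2) * (w - C) \<in> Q"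
      using primeD pQ algebraic_int_of_int algebraic_int_add_mult(2) algebraic_int_power[OF w(1)] algebraic_int_diff[OF w(1) algC] by blast
    then have "w ^ (p - 2) \<in> Q"
      using primeD algebraic_int_power[OF w(1)] algebraic_int_diff[OF w(1) algC] w(3) by blast
    then show False using power_in w by blast
  qed
  have prod_in: "\<exists>i<l. h i \<in> Q" if "(\<Prod>i<l. h i) \<in> Q" "\<And>i. algebraic_int (h i)" for l :: nat and h
    using that
  proof (induction l)
    case 0
    then show ?case using one_notin by simp
  next
    case (Suc l)
    have "algebraic_int (\<Prod>i<l. h i)"
      using Suc.prems(2) by (induction l) (auto intro: algebraic_int_add_mult)
    then have "(\<Prod>i<l. h i) \<in> Q \<or> h l \<in> Q"
      using primeD[of "\<Prod>i<l. h i" "h l"] Suc.prems by simp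
    then show ?case using Suc.IH Suc.prems(2) less_Suc_eq by blast
  qed
  \<comment> \<open>A coincidence puts the derivative, a product over the orbit of \<open>x\<close>,
    into \<open>Q\<close>. Some factor then lies in \<open>Q\<close>, so that orbit point is 0 or
    \<open>C\<close> modulo \<open>Q\<close>; the two preceding facts leave only \<open>C\<close> at
    time 0.\<close>
  have double: "x - C \<in> Q" if xy: "x \<in> V n" "y \<in> V n" "x \<noteq> y" "x - y \<in> Q" for x y
  proof -
    have alg: "algebraic_int x" "algebraic_int y" using V_algebraic_int xy by blast+
    have co: "algebraic_int (coeff (map_poly of_int (F n) :: complex poly) i)" for i
      by (simp add: algebraic_int_of_int)
    have "poly (pderiv (map_poly of_int (F n))) x \<in> Q"
      by (rule pderiv_in_if_double[OF co _ _ xy(3) alg xy(4)]) (use xy in \<open>simp_all add: V_def\<close>)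
    then have "ipoly (pderiv (F n)) x \<in> Q" by (simp only: of_int_hom.map_poly_pderiv)
    then have "(\<Prod>i<n. ipoly (pderiv f) ((g ^^ i) x)) \<in> Q" unfolding pderiv_F .
    then obtain i where i: "i < n" "ipoly (pderiv f) ((g ^^ i) x) \<in> Q"
      using prod_in[of "\<lambda>i. ipoly (pderiv f) ((g ^^ i) x)" n] algebraic_int_ipoly g_algebraic_int[OF alg(1)] by blast
    have gx: "(g ^^ n) x \<in> Q" using xy(1) zero_in by (simp add: V_iff)
    have "(g ^^ i) x - C \<in> Q"
      using deriv_notin[OF g_algebraic_int[OF alg(1)]] iter_notin[OF alg(1) gx i(1)] i(2) by blast
    then show ?thesis using iter_not_C[OF alg(1) gx i(1)] by simp
  qed
  \<comment> \<open>The multiplicity of the root \<open>C\<close> modulo \<open>Q\<close> is exactly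
    two: the same two facts, for the orbit of \<open>C\<close> itself, keep all factors of the
    second derivative outside \<open>Q\<close>.\<close>
  have D2: "ipoly (pderiv (pderiv (F n))) C \<notin> Q"
  proof
    assume in_Q: "ipoly (pderiv (pderiv (F n))) C \<in> Q"
    obtain l where l: "n = Suc l" using n gr0_implies_Suc by blast
    have alg1: "algebraic_int (ipoly (pderiv (pderiv f)) C)" by (rule algebraic_int_ipoly[OF algC])
    have alg2: "algebraic_int (ipoly (pderiv f) ((g ^^ i) C))" for i
      by (intro algebraic_int_ipoly g_algebraic_int algC)
    have alg3: "algebraic_int (\<Prod>i<j. ipoly (pderiv f) ((g ^^ Suc i) C))" for j
      by (induction j) (use alg2 algebraic_int_add_mult(2) in \<open>simp_all del: funpow.simps\<close>)
    have "ipoly (pderiv (pderiv f)) C \<in> Q \<or> (\<Prod>i<l. ipoly (pderiv f) ((g ^^ Suc i) C)) \<in> Q"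
      using in_Q unfolding l pderiv2_F_C by (rule primeD[OF _ alg1 alg3])
    then show False
    proof
      assume "ipoly (pderiv (pderiv f)) C \<in> Q"
      then have "C ^ (p - 2) \<in> Q"
        using primeD[OF _ algebraic_int_of_int algebraic_int_power[OF algC]] pQ unfolding pderiv2_g by blast
      then have "C \<in> Q" using power_in algC by blast
      then show False using iter_notin[OF algC FCQ n] by simp
    next
      assume "(\<Prod>i<l. ipoly (pderiv f) ((g ^^ Suc i) C)) \<in> Q"
      then obtain i where i: "i < l" "ipoly (pderiv f) ((g ^^ Suc i) C) \<in> Q"
        using prod_in[of "\<lambda>i. ipoly (pderiv f) ((g ^^ Suc i) C)" l] alg2 by blast
      have il: "Suc i < n" using i(1) l by simp
      have "(g ^^ Suc i) C - C \<in> Q"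
        using deriv_notin[OF g_algebraic_int[OF algC]] iter_notin[OF algC FCQ il] i(2) by blast
      then show False using iter_not_C[OF algC FCQ il] by simp
    qed
  qed
  have triple: "x = y \<or> x = z \<or> y = z"
    if xyz: "x \<in> V n" "y \<in> V n" "z \<in> V n" "x - C \<in> Q" "y - C \<in> Q" "z - C \<in> Q" for x y z
  proof (rule ccontr)
    assume ne: "\<not> ?thesis"
    have alg: "algebraic_int x" "algebraic_int y" "algebraic_int z" using V_algebraic_int xyz by blast+
    have co: "algebraic_int (coeff (map_poly of_int (F n) :: complex poly) i)" for i
      by (simp add: algebraic_int_of_int)
    have sw: "C - w \<in> Q" if "w - C \<in> Q" for w using minus_in[OF that] by simp
    have "poly (pderiv (pderiv (map_poly of_int (F n)))) C \<in> Q"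
      by (rule pderiv2_in_if_triple[OF co _ _ _ _ _ _ alg algC sw[OF xyz(4)] sw[OF xyz(5)] sw[OF xyz(6)]])
        (use xyz ne in \<open>simp_all add: V_def\<close>)
    then show False using D2 unfolding of_int_hom.map_poly_pderiv by blast
  qed
  obtain W where W: "\<And>x. ipoly (F n) x = of_int (poly (F n) c) + (x - C)\<^sup>2 * ipoly W x"
    "ipoly (pderiv (pderiv (F n))) C = 2 * ipoly W C" by (rule F_taylor[OF n]) blast
  \<comment> \<open>Since twice this value is outside \<open>Q\<close>, so is the value itself; in
    passing, 2 is outside \<open>Q\<close> as well.\<close>
  have WC: "ipoly W C \<notin> Q"
    using D2 mult_in[of "ipoly W C" "of_int 2", OF _ algebraic_int_of_int] unfolding W(2) by auto
  \<comment> \<open>The value of the monic iterate at \<open>C\<close> is the product of the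
    differences from its roots and lies in the prime \<open>Q\<close>, so one difference
    does.\<close>
  have "\<exists>\<alpha>\<in>V n. C - \<alpha> \<in> Q"
  proof (rule ccontr)
    assume none: "\<not> ?thesis"
    have "algebraic_int (\<Prod>z\<in>S. C - z) \<and> (\<Prod>z\<in>S. C - z) \<notin> Q" if "finite S" "S \<subseteq> V n" for S
      using that
    proof (induction S rule: finite_induct)
      case empty
      show ?case using one_notin by (simp add: int_imp_algebraic_int)
    next
      case (insert a S)
      have a: "algebraic_int (C - a)" "C - a \<notin> Q"
        using insert.prems none V_algebraic_int algebraic_int_diff[OF algC] by blast+
      moreover have "algebraic_int (\<Prod>z\<in>S. C - z)" "(\<Prod>z\<in>S. C - z) \<notin> Q" using insert by auto
      ultimately have "(C - a) * (\<Prod>z\<in>S. C - z) \<notin> Q" "algebraic_int ((C - a) * (\<Prod>z\<in>S. C - z))"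
        using primeD algebraic_int_add_mult(2) by blast+
      then show ?case using insert.hyps by simp
    qed
    from this[OF finite_V subset_refl] show False
      using FCQ unfolding F_factorization[symmetric] ipoly_F by blast
  qed
  then obtain \<alpha> where \<alpha>: "\<alpha> \<in> V n" "C - \<alpha> \<in> Q" by blast
  have alg\<alpha>: "algebraic_int \<alpha>" by (rule V_algebraic_int[OF \<alpha>(1)])
  define y where "y = \<alpha> - C"
  have yR: "y \<in> R" unfolding y_def C_def using V_subset_R \<alpha>(1) R_of_int R_diff by blast
  have "ipoly W \<alpha> \<notin> Q"
  proof
    assume "ipoly W \<alpha> \<in> Q"
    then have "(ipoly W C - ipoly W \<alpha>) + ipoly W \<alpha> \<in> Q"
      by (intro add_in ipoly_cong algC alg\<alpha> \<alpha>(2))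
    then show False using WC by simp
  qed
  moreover have "algebraic_int (ipoly W \<alpha>)" by (rule algebraic_int_ipoly[OF alg\<alpha>])
  moreover have "y\<^sup>2 * ipoly W \<alpha> = of_nat q ^ v * of_int (- m)"
  proof -
    have "0 = of_int (poly (F n) c) + y\<^sup>2 * ipoly W \<alpha>"
      using \<alpha>(1) W(1)[of \<alpha>] by (simp add: V_def y_def)
    then have "y\<^sup>2 * ipoly W \<alpha> = - of_int (poly (F n) c)"
      by (simp add: eq_neg_iff_add_eq_0 add.commute)
    then show ?thesis by (simp add: rp(3))
  qed
  moreover have "of_int (- m) \<notin> Q" using rp(4) by (simp only: of_int_in_iff dvd_minus_iff not_False_eq_True)
  ultimately obtain s where s: "qbar_aut s" "\<exists>v\<in>V n. s v \<noteq> v" "\<forall>x\<in>R. s x - x \<in> Q"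
    using inertia_nontrivial[OF yR _ _ algebraic_int_of_int _ _ rp(2)] by blast
  then obtain x where x: "x \<in> V n" "s x \<noteq> x" by blast
  have sV: "s v \<in> V n" "s v - v \<in> Q" if "v \<in> V n" for v
    using V_stable[OF s(1) that] s(3) V_subset_R that by blast+
  \<comment> \<open>A moved root and its image are distinct but congruent modulo \<open>Q\<close>,
    hence both reduce to \<open>C\<close>. Only two roots do, so \<open>s\<close> can only exchange
    these two.\<close>
  have near: "v - C \<in> Q" "s v - C \<in> Q" if v: "v \<in> V n" "s v \<noteq> v" for v
  proof -
    show "s v - C \<in> Q" by (rule double[OF sV(1)[OF v(1)] v(1) v(2) sV(2)[OF v(1)]])
    have "v - s v \<in> Q" using minus_in[OF sV(2)[OF v(1)]] by simp
    then show "v - C \<in> Q" using double[OF v(1) sV(1)[OF v(1)]] v(2) by metis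
  qed
  define y where "y = s x"
  have yV: "y \<in> V n" "y \<noteq> x" "y - C \<in> Q" using sV x near by (auto simp: y_def)
  have only: "v = x \<or> v = y" if v: "v \<in> V n" "v - C \<in> Q" for v
    using triple[OF v(1) x(1) yV(1) v(2) near(1)[OF x] yV(3)] yV(2) by blast
  have "s y \<noteq> y"
  proof
    assume "s y = y"
    then have "s y = s x" by (simp add: y_def)
    then have "y = x"
      using qbar_aut_inj[OF s(1), of y x] V_algebraic_int yV(1) x(1) by blast
    then show False using yV(2) by simp
  qed
  then have "s y = x" using only[OF sV(1)[OF yV(1)] near(2)[OF yV(1)]] by blast
  moreover have "s v = v" if "v \<in> V n" "v \<noteq> x" "v \<noteq> y" for v
    using only[OF that(1)] near(1)[OF that(1)] that by blast
  ultimately show ?thesis using s(1) x(1) yV(1,2) y_def by metis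
qed

end

section \<open>The Galois action on the tree\<close>

context phi_family
begin

lemma g_V: "x \<in> V (Suc n) \<Longrightarrow> g x \<in> V n"
  by (simp add: V_iff funpow_swap1)

lemma V_Suc_iff: "x \<in> V (Suc n) \<longleftrightarrow> g x \<in> V n"
  by (simp add: V_iff funpow_swap1)

lemma V_0: "V 0 = {0}"
  by (auto simp: V_iff)

lemma V_algebraic: "x \<in> V n \<Longrightarrow> algebraic x"
  using V_algebraic_int by blast

lemma qbar_aut_g: "qbar_aut s \<Longrightarrow> algebraic x \<Longrightarrow> s (g x) = g (s x)"
  unfolding g_def by (rule qbar_aut_poly)

text \<open>For \<open>x\<close> above \<alpha>, the derivative of \<open>f\<close> at
  \<open>x\<close> is the first factor of the derivative of the iterate of index
  \<open>Suc n\<close> at its root \<open>x\<close>, which is nonzero.\<close>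

lemma card_fibre:
  assumes "\<alpha> \<in> V n"
  shows "finite {x. g x = \<alpha>}" "card {x. g x = \<alpha>} = p"
proof -
  let ?q = "map_poly of_int f - [:\<alpha>:] :: complex poly"
  have d: "degree ?q = p"
    using degree_f p2 degree_add_eq_left[of "- [:\<alpha>:]" "map_poly of_int f"]
    unfolding diff_conv_add_uminus by simp
  have q0: "?q \<noteq> 0" using d p2 by auto
  have root: "poly ?q x = 0 \<longleftrightarrow> g x = \<alpha>" for x by (simp add: g_def)
  show fin: "finite {x. g x = \<alpha>}" using poly_roots_finite[OF q0] unfolding root .
  have "poly (pderiv ?q) x \<noteq> 0" if "poly ?q x = 0" for x
  proof -
    have "g x = \<alpha>" using that unfolding root .
    then have "x \<in> V (Suc n)" using assms by (simp add: V_Suc_iff)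
    from V_separable[OF this] have "ipoly (pderiv f) ((g ^^ 0) x) \<noteq> 0"
      unfolding pderiv_F prod_zero_iff[OF finite_lessThan] by blast
    moreover have "pderiv ?q = map_poly of_int (pderiv f)"
      by (simp add: pderiv_diff pderiv_pCons of_int_hom.map_poly_pderiv)
    ultimately show ?thesis by simp
  qed
  then have "rsquarefree ?q" unfolding rsquarefree_roots by blast
  from complex_poly_decompose_rsquarefree[OF this]
  have "degree ?q = degree (\<Prod>z\<in>{x. g x = \<alpha>}. [:- z, 1:])"
    using q0 unfolding root by (metis degree_smult_eq leading_coeff_0_iff)
  also have "\<dots> = card {x. g x = \<alpha>}" by (subst degree_prod_sum_eq) auto
  finally show "card {x. g x = \<alpha>} = p" using d by simp
qed

lemma fibre_subset: "\<alpha> \<in> V n \<Longrightarrow> {x. g x = \<alpha>} \<subseteq> V (Suc n)"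
  by (auto simp: V_Suc_iff)

lemma fibre_nonempty: "\<alpha> \<in> V n \<Longrightarrow> \<exists>x\<in>V (Suc n). g x = \<alpha>"
proof -
  assume a: "\<alpha> \<in> V n"
  have "{x. g x = \<alpha>} \<noteq> {}" using card_fibre(2)[OF a] p2 by (metis card.empty not_numeral_le_zero)
  then show ?thesis using fibre_subset[OF a] by blast
qed

section \<open>Transpositions and fibre permutations in the Galois group\<close>

definition swaps :: "nat \<Rightarrow> complex \<Rightarrow> complex \<Rightarrow> (complex \<Rightarrow> complex) \<Rightarrow> bool" where
  "swaps n x y s \<longleftrightarrow> qbar_aut s \<and> s x = y \<and> s y = x \<and> (\<forall>v\<in>V n. v \<noteq> x \<longrightarrow> v \<noteq> y \<longrightarrow> s v = v)"

lemma swaps_fixes: "swaps n x y s \<Longrightarrow> v \<in> V n \<Longrightarrow> v \<noteq> x \<Longrightarrow> v \<noteq> y \<Longrightarrow> s v = v"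
  unfolding swaps_def by blast

text \<open>For distinct points: the transposition (x y) belongs to the Galois group of level
  \<open>n\<close>. Allowing equality makes this an equivalence relation on the level.\<close>

definition linked :: "nat \<Rightarrow> complex \<Rightarrow> complex \<Rightarrow> bool" where
  "linked n x y \<longleftrightarrow> (\<exists>s. swaps n x y s)"

lemma linked_refl: "linked n x x"
  unfolding linked_def swaps_def using qbar_aut_id by (intro exI[of _ id]) auto

lemma linked_sym: "linked n x y \<Longrightarrow> linked n y x"
  unfolding linked_def swaps_def by metis

text \<open>For three distinct points, (x y)(y z)(x y) = (x z).\<close>

lemma linked_trans:
  assumes V: "x \<in> V n" "y \<in> V n" "z \<in> V n" and xy: "linked n x y" and yz: "linked n y z"
  shows "linked n x z"
proof (cases "x = y \<or> y = z \<or> x = z")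
  case True
  then show ?thesis using xy yz linked_refl by blast
next
  case False
  obtain s where s: "swaps n x y s" using xy unfolding linked_def by blast
  obtain t where t: "swaps n y z t" using yz unfolding linked_def by blast
  have "swaps n x z (s \<circ> (t \<circ> s))"
    unfolding swaps_def
  proof (intro conjI ballI impI)
    have st: "s x = y" "s y = x" "t y = z" "t z = y" "qbar_aut s" "qbar_aut t"
      using s t unfolding swaps_def by blast+
    show "qbar_aut (s \<circ> (t \<circ> s))" by (intro qbar_aut_comp st)
    have ne: "x \<noteq> y" "x \<noteq> z" "z \<noteq> x" "z \<noteq> y" using False by auto
    have sz: "s z = z" by (rule swaps_fixes[OF s V(3) ne(3,4)])
    have tx: "t x = x" by (rule swaps_fixes[OF t V(1) ne(1,2)])
    show "(s \<circ> (t \<circ> s)) x = z" "(s \<circ> (t \<circ> s)) z = x" using st sz tx by simp_all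
    fix v assume v: "v \<in> V n" "v \<noteq> x" "v \<noteq> z"
    show "(s \<circ> (t \<circ> s)) v = v"
    proof (cases "v = y")
      case True
      then show ?thesis using st tx by simp
    next
      case False
      then have "s v = v" "t v = v" using swaps_fixes[OF s v(1,2)] swaps_fixes[OF t v(1) _ v(3)] by blast+
      then show ?thesis by simp
    qed
  qed
  then show ?thesis unfolding linked_def by blast
qed

lemma linked_conj:
  assumes V: "x \<in> V n" "y \<in> V n" and xy: "linked n x y" and r: "qbar_aut r"
  shows "linked n (r x) (r y)"
proof -
  obtain s where s: "swaps n x y s" using xy unfolding linked_def by blast
  obtain r' where r': "qbar_aut r'" "\<And>x. algebraic x \<Longrightarrow> r' (r x) = x" "\<And>x. algebraic x \<Longrightarrow> r (r' x) = x"
    using qbar_aut_inverse[OF r] by blast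
  have "r (s (r' v)) = v" if v: "v \<in> V n" "v \<noteq> r x" "v \<noteq> r y" for v
  proof -
    have "r' v \<in> V n" by (rule V_stable[OF r'(1) v(1)])
    moreover have "r' v \<noteq> x" "r' v \<noteq> y" using r'(3)[OF V_algebraic[OF v(1)]] v by auto
    ultimately have "s (r' v) = r' v" by (rule swaps_fixes[OF s])
    then show ?thesis using r'(3)[OF V_algebraic[OF v(1)]] by simp
  qed
  moreover have "qbar_aut (r \<circ> (s \<circ> r'))"
    using s unfolding swaps_def by (intro qbar_aut_comp r r'(1)) simp
  moreover have "r (s (r' (r x))) = r y" "r (s (r' (r y))) = r x"
    using s r'(2)[OF V_algebraic[OF V(1)]] r'(2)[OF V_algebraic[OF V(2)]] unfolding swaps_def by simp_all
  ultimately have "swaps n (r x) (r y) (r \<circ> (s \<circ> r'))"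
    unfolding swaps_def comp_apply by blast
  then show ?thesis unfolding linked_def by blast
qed

text \<open>Take a sibling \<open>z\<close> of \<open>x\<close>. If \<open>y\<close> were in another
  fibre, the swap would fix \<open>z\<close>, hence also the common parent \<open>g x\<close>; yet
  it sends \<open>g x\<close> to \<open>g y\<close>.\<close>

lemma linked_same_fibre:
  assumes V: "x \<in> V (Suc n)" "y \<in> V (Suc n)" and xy: "linked (Suc n) x y"
  shows "g x = g y"
proof (rule ccontr)
  assume ne: "g x \<noteq> g y"
  obtain s where s: "swaps (Suc n) x y s" using xy unfolding linked_def by blast
  have "\<not> {z. g z = g x} \<subseteq> {x}"
  proof
    assume "{z. g z = g x} \<subseteq> {x}"
    then have "card {z. g z = g x} \<le> card {x}" by (intro card_mono) auto
    then show False using card_fibre(2)[OF g_V[OF V(1)]] p2 by simp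
  qed
  then obtain z where z: "g z = g x" "z \<noteq> x" by blast
  have zV: "z \<in> V (Suc n)" using z V(1) by (simp add: V_Suc_iff)
  have "z \<noteq> y" using z ne by auto
  then have "s z = z" by (rule swaps_fixes[OF s zV z(2)])
  have aut: "qbar_aut s" "s x = y" using s unfolding swaps_def by auto
  have "g z = g (s z)" using \<open>s z = z\<close> by simp
  also have "\<dots> = s (g z)" using qbar_aut_g[OF aut(1) V_algebraic[OF zV]] by simp
  also have "\<dots> = s (g x)" using z by simp
  also have "\<dots> = g y" using qbar_aut_g[OF aut(1) V_algebraic[OF V(1)]] aut(2) by simp
  finally show False using z ne by simp
qed

text \<open>The link classes are permuted transitively by the Galois group, so their common
  cardinality divides the prime \<open>p\<close>; it is not 1, hence a class is a whole fibre.\<close>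
lemma linked_if_same_fibre:
  assumes V: "x \<in> V (Suc n)" "y \<in> V (Suc n)" and xy: "g x = g y"
  shows "linked (Suc n) x y"
proof -
  let ?V = "V (Suc n)"
  define cls where "cls = (\<lambda>u. {v \<in> ?V. linked (Suc n) u v})"
  have fin: "finite (cls u)" for u unfolding cls_def using finite_V by simp
  have le: "card (cls u) \<le> card (cls v)" if uv: "u \<in> ?V" "v \<in> ?V" for u v
  proof -
    obtain r where r: "qbar_aut r" "r u = v" by (rule V_transitive[OF uv]) simp
    show ?thesis
    proof (rule card_inj_on_le)
      show "inj_on r (cls u)"
      proof (rule inj_onI)
        fix a b assume ab: "a \<in> cls u" "b \<in> cls u" "r a = r b"
        then have "a \<in> ?V" "b \<in> ?V" by (auto simp: cls_def)
        then show "a = b" using qbar_aut_inj[OF r(1) V_algebraic V_algebraic, of a _ b] ab(3) by blast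
      qed
      show "r ` cls u \<subseteq> cls v"
      proof
        fix w assume "w \<in> r ` cls u"
        then obtain w' where w': "w = r w'" "w' \<in> ?V" "linked (Suc n) u w'" unfolding cls_def by blast
        then show "w \<in> cls v"
          using linked_conj[OF uv(1) w'(2,3) r(1)] V_stable[OF r(1) w'(2)] r(2) by (simp add: cls_def)
      qed
      show "finite (cls v)" by (rule fin)
    qed
  qed
  define M where "M = card (cls x)"
  have M: "card (cls u) = M" if "u \<in> ?V" for u
    unfolding M_def using le[OF that V(1)] le[OF V(1) that] by simp
  obtain s a b where sab: "qbar_aut s" "a \<in> ?V" "b \<in> ?V" "a \<noteq> b" "s a = b" "s b = a"
    "\<forall>v\<in>?V. v \<noteq> a \<longrightarrow> v \<noteq> b \<longrightarrow> s v = v"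
    using transposition_exists[of "Suc n"] by auto
  have "linked (Suc n) a b" using sab unfolding linked_def swaps_def by blast
  then have "{a, b} \<subseteq> cls a" using sab linked_refl by (auto simp: cls_def)
  then have "card {a, b} \<le> M" using card_mono[OF fin] M[OF sab(2)] by metis
  then have M2: "M \<ge> 2" using sab(4) by simp
  define X where "X = {v. g v = g x}"
  have XV: "X \<subseteq> ?V" unfolding X_def by (rule fibre_subset[OF g_V[OF V(1)]])
  have cX: "card X = p" "finite X" using card_fibre[OF g_V[OF V(1)]] by (simp_all add: X_def)
  have cls_X: "cls u \<subseteq> X" if "u \<in> X" for u
  proof
    fix w assume w: "w \<in> cls u"
    have "g u = g w" by (rule linked_same_fibre[of u n w]) (use w that XV in \<open>auto simp: cls_def\<close>)
    then show "w \<in> X" using that by (simp add: X_def)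
  qed
  have Un: "\<Union>(cls ` X) = X"
  proof
    show "\<Union>(cls ` X) \<subseteq> X" using cls_X by blast
    have "v \<in> cls v" if "v \<in> X" for v using that XV linked_refl by (auto simp: cls_def)
    then show "X \<subseteq> \<Union>(cls ` X)" by blast
  qed
  have disj: "cls u = cls v" if uv: "u \<in> X" "v \<in> X" "w \<in> cls u" "w \<in> cls v" for u v w
  proof -
    have w: "w \<in> ?V" "linked (Suc n) u w" "linked (Suc n) v w" using uv by (auto simp: cls_def)
    have u: "u \<in> ?V" "v \<in> ?V" using uv XV by auto
    have "linked (Suc n) u v" by (rule linked_trans[OF u(1) w(1) u(2) w(2) linked_sym[OF w(3)]])
    then have "linked (Suc n) u z \<longleftrightarrow> linked (Suc n) v z" if "z \<in> ?V" for z
      using linked_trans[OF u(1,2) that] linked_trans[OF u(2,1) that] linked_sym by blast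
    then show ?thesis by (auto simp: cls_def)
  qed
  have "M * card (cls ` X) = card (\<Union>(cls ` X))"
  proof (rule card_partition)
    show "finite (cls ` X)" "finite (\<Union>(cls ` X))" using cX Un by auto
    show "card c = M" if "c \<in> cls ` X" for c using that M XV by auto
    show "c1 \<inter> c2 = {}" if "c1 \<in> cls ` X" "c2 \<in> cls ` X" "c1 \<noteq> c2" for c1 c2
      using that disj by blast
  qed
  then have "M dvd p" unfolding Un cX(1) by (metis dvd_triv_left)
  then have "M = p" using p M2 by (auto simp: prime_nat_iff)
  have xX: "x \<in> X" by (simp add: X_def)
  have "cls x = X"
    by (rule card_subset_eq[OF cX(2) cls_X[OF xX]]) (simp add: cX(1) \<open>M = p\<close> M_def[symmetric])
  moreover have "y \<in> X" using xy by (simp add: X_def)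
  ultimately show ?thesis by (auto simp: cls_def)
qed

text \<open>Induction on the number of moved points: \<open>x\<close> and its image share a fibre,
  and the realised transposition exchanging them, composed after the permutation, fixes
  \<open>x\<close> and moves no new point.\<close>

lemma fibre_permutation_realised:
  assumes "bij_betw \<pi> (V (Suc n)) (V (Suc n))" "\<And>v. v \<in> V (Suc n) \<Longrightarrow> g (\<pi> v) = g v"
  shows "\<exists>s. qbar_aut s \<and> (\<forall>v\<in>V (Suc n). s v = \<pi> v)"
  using assms
proof (induction "card {v \<in> V (Suc n). \<pi> v \<noteq> v}" arbitrary: \<pi> rule: less_induct)
  case less
  let ?V = "V (Suc n)"
  show ?case
  proof (cases "\<forall>v\<in>?V. \<pi> v = v")
    case True
    then show ?thesis using qbar_aut_id by (intro exI[of _ id]) auto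
  next
    case False
    then obtain x where x: "x \<in> ?V" "\<pi> x \<noteq> x" by blast
    define y where "y = \<pi> x"
    have inj: "inj_on \<pi> ?V" and img: "\<pi> ` ?V = ?V" using less.prems(1) by (auto simp: bij_betw_def)
    have y: "y \<in> ?V" "y \<noteq> x" using x img by (auto simp: y_def)
    have py: "\<pi> y \<noteq> y" using inj_onD[OF inj, of y x] x y by (auto simp: y_def)
    have gxy: "g x = g y" using less.prems(2)[OF x(1)] by (simp add: y_def)
    obtain \<tau> where \<tau>: "swaps (Suc n) x y \<tau>"
      using linked_if_same_fibre[OF x(1) y(1) gxy] unfolding linked_def by blast
    then have \<tau>': "qbar_aut \<tau>" "\<tau> x = y" "\<tau> y = x" "\<And>v. v \<in> ?V \<Longrightarrow> v \<noteq> x \<Longrightarrow> v \<noteq> y \<Longrightarrow> \<tau> v = v"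
      unfolding swaps_def by auto
    have \<tau>\<tau>: "\<tau> (\<tau> v) = v" if "v \<in> ?V" for v
      using \<tau>' that by (cases "v = x"; cases "v = y") simp_all
    have \<tau>V: "\<tau> v \<in> ?V" if "v \<in> ?V" for v by (rule V_stable[OF \<tau>'(1) that])
    have \<tau>g: "g (\<tau> v) = g v" if "v \<in> ?V" for v
      using \<tau>' gxy that by (cases "v = x"; cases "v = y") simp_all
    have \<tau>bij: "bij_betw \<tau> ?V ?V"
      by (rule bij_betwI[where g = \<tau>]) (use \<tau>V \<tau>\<tau> in auto)
    define \<pi>' where "\<pi>' = \<tau> \<circ> \<pi>"
    have piV: "\<pi> v \<in> ?V" if "v \<in> ?V" for v using img that by blast
    have "{v \<in> ?V. \<pi>' v \<noteq> v} \<subset> {v \<in> ?V. \<pi> v \<noteq> v}"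
    proof
      show "{v \<in> ?V. \<pi>' v \<noteq> v} \<subseteq> {v \<in> ?V. \<pi> v \<noteq> v}"
      proof safe
        fix v assume v: "v \<in> ?V" "\<pi>' v \<noteq> v" "\<pi> v = v"
        then have "v \<noteq> x" "v \<noteq> y" using x py by auto
        then show False using v \<tau>'(4) by (simp add: \<pi>'_def)
      qed
      have "\<pi>' x = x" using \<tau>' by (simp add: \<pi>'_def y_def)
      then show "{v \<in> ?V. \<pi>' v \<noteq> v} \<noteq> {v \<in> ?V. \<pi> v \<noteq> v}" using x by blast
    qed
    then have smaller: "card {v \<in> ?V. \<pi>' v \<noteq> v} < card {v \<in> ?V. \<pi> v \<noteq> v}"
      using finite_V by (intro psubset_card_mono) auto
    have "bij_betw \<pi>' ?V ?V" unfolding \<pi>'_def by (rule bij_betw_trans[OF less.prems(1) \<tau>bij])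
    moreover have "g (\<pi>' v) = g v" if "v \<in> ?V" for v
      using \<tau>g[OF piV[OF that]] less.prems(2)[OF that] by (simp add: \<pi>'_def)
    ultimately obtain s where s: "qbar_aut s" "\<forall>v\<in>?V. s v = \<pi>' v"
      using less.hyps[OF smaller] by blast
    have "(\<tau> \<circ> s) v = \<pi> v" if "v \<in> ?V" for v
      using s(2) \<tau>\<tau>[OF piV[OF that]] that by (simp add: \<pi>'_def)
    then show ?thesis using qbar_aut_comp[OF \<tau>'(1) s(1)] by blast
  qed
qed

section \<open>Automorphisms of the infinite tree\<close>

lemma tree_verts_iff: "(n, a) \<in> tree_verts f \<longleftrightarrow> a \<in> V n"
  by (simp add: tree_verts_def V_def iter_poly_eq F_def)

lemma tree_edge_iff:
  "tree_edge f (n, a) (m, b) \<longleftrightarrow> (m = Suc n \<and> g b = a) \<or> (n = Suc m \<and> g a = b)"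
  by (simp add: tree_edge_def cpoly_def g_def)

definition nbrs :: "nat \<times> complex \<Rightarrow> (nat \<times> complex) set" where
  "nbrs u = {v \<in> tree_verts f. tree_edge f u v}"

lemma nbrs_root: "nbrs (0, 0) = Pair 1 ` {b. g b = 0}"
  by (auto simp: nbrs_def tree_verts_iff tree_edge_iff V_Suc_iff V_0)

lemma nbrs_Suc:
  assumes "a \<in> V (Suc n)"
  shows "nbrs (Suc n, a) = insert (n, g a) (Pair (Suc (Suc n)) ` {b. g b = a})"
  using assms by (auto simp: nbrs_def tree_verts_iff tree_edge_iff V_Suc_iff)

lemma card_nbrs_root: "card (nbrs (0, 0)) = p"
  unfolding nbrs_root using card_fibre(2)[of 0 0] by (subst card_image) (auto simp: V_0 inj_on_def)

lemma card_nbrs_Suc: "a \<in> V (Suc n) \<Longrightarrow> card (nbrs (Suc n, a)) = Suc p"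
  unfolding nbrs_Suc using card_fibre[of a "Suc n"]
  by (subst card_insert_disjoint) (auto simp: card_image inj_on_def)

lemma card_nbrs_tree_aut:
  assumes t: "tree_aut f t" and u: "u \<in> tree_verts f"
  shows "card (nbrs (t u)) = card (nbrs u)"
proof -
  have bij: "bij_betw t (tree_verts f) (tree_verts f)" using t by (simp add: tree_aut_def)
  have edge: "tree_edge f u v \<longleftrightarrow> tree_edge f (t u) (t v)" if "v \<in> tree_verts f" for v
    using t u that by (simp add: tree_aut_def)
  have "t ` nbrs u = nbrs (t u)"
  proof
    show "t ` nbrs u \<subseteq> nbrs (t u)"
      using bij edge unfolding nbrs_def bij_betw_def by auto
    show "nbrs (t u) \<subseteq> t ` nbrs u"
    proof
      fix w assume w: "w \<in> nbrs (t u)"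
      then have "w \<in> t ` tree_verts f" using bij by (simp add: nbrs_def bij_betw_def)
      then obtain v where v: "v \<in> tree_verts f" "w = t v" by (rule imageE) simp
      then show "w \<in> t ` nbrs u" using w edge by (auto simp: nbrs_def)
    qed
  qed
  moreover have "inj_on t (nbrs u)"
    using bij unfolding bij_betw_def nbrs_def by (auto intro: inj_on_subset)
  ultimately show ?thesis by (metis card_image)
qed

text \<open>\<open>tree_aut\<close> mentions adjacency only, so levels have to be recovered. The
  root is recognised by its degree \<open>p\<close>; all other vertices have \<open>p\<close>
  children and a parent.\<close>

lemma tree_aut_root:
  assumes t: "tree_aut f t"
  shows "t (0, 0) = (0, 0)"
proof -
  have r: "(0, 0) \<in> tree_verts f" by (simp add: tree_verts_iff V_0)
  have "t (0, 0) \<in> tree_verts f" using t r unfolding tree_aut_def bij_betw_def by blast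
  moreover obtain n a where na: "t (0, 0) = (n, a)" by fastforce
  ultimately have a: "a \<in> V n" by (simp add: tree_verts_iff)
  have "n = 0"
  proof (rule ccontr)
    assume "n \<noteq> 0"
    then obtain m where "n = Suc m" using not0_implies_Suc by blast
    then show False
      using card_nbrs_tree_aut[OF t r] card_nbrs_root card_nbrs_Suc[of a m] a na by simp
  qed
  then show ?thesis using a na by (simp add: V_0)
qed

text \<open>By induction, since the image of a vertex is adjacent to the image of its parent: it is
  either a child of that image, as wanted, or its parent.\<close>

lemma tree_aut_level:
  assumes t: "tree_aut f t" and a: "a \<in> V n"
  shows "fst (t (n, a)) = n \<and> (\<forall>m. n = Suc m \<longrightarrow> t (m, g a) = (m, g (snd (t (n, a)))))"
  using a
proof (induction n arbitrary: a)
  case 0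
  then show ?case using tree_aut_root[OF t] by (simp add: V_0)
next
  case (Suc n)
  obtain b where b: "t (n, g a) = (n, b)" using Suc.IH[OF g_V[OF Suc.prems]] by (metis prod.collapse)
  obtain m c where c: "t (Suc n, a) = (m, c)" by fastforce
  have u: "(Suc n, a) \<in> tree_verts f" "(n, g a) \<in> tree_verts f"
    using Suc.prems g_V by (simp_all add: tree_verts_iff)
  have "tree_edge f (n, g a) (Suc n, a)" by (simp add: tree_edge_iff)
  then have "tree_edge f (n, b) (m, c)"
    using t u b c unfolding tree_aut_def by metis
  then consider "m = Suc n" "g c = b" | "n = Suc m" "g b = c" unfolding tree_edge_iff by blast
  then show ?case
  proof cases
    case 1
    then show ?thesis using b c by simp
  next
    case 2
    \<comment> \<open>The parent of the image is already the image of the grandparent, so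
      injectivity of \<open>t\<close> excludes this case.\<close>
    have "t (m, g (g a)) = (m, g b)"
      using Suc.IH[OF g_V[OF Suc.prems]] 2(1) b by simp
    then have "t (m, g (g a)) = t (Suc n, a)" using c 2 by simp
    moreover have "(m, g (g a)) \<in> tree_verts f"
      using g_V g_V[OF Suc.prems] 2(1) by (simp add: tree_verts_iff)
    moreover have "inj_on t (tree_verts f)" using t unfolding tree_aut_def bij_betw_def by blast
    ultimately have "(m, g (g a)) = (Suc n, a)" using u(1) by (blast dest: inj_onD)
    then show ?thesis using 2(1) by simp
  qed
qed

lemma arboreal_surjective_f: "arboreal_surjective f"
  unfolding arboreal_surjective_def
proof (intro conjI allI impI)
  show "iterates_separable f"
    unfolding iterates_separable_def using F_rsquarefree by (simp add: iter_poly_eq F_def)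
  fix t assume t: "tree_aut f t"
  define \<theta> where "\<theta> = (\<lambda>n a. snd (t (n, a)))"
  have t\<theta>: "t (n, a) = (n, \<theta> n a)" if "a \<in> V n" for n a
    using tree_aut_level[OF t that] unfolding \<theta>_def by (metis prod.collapse)
  have bij: "inj_on t (tree_verts f)" "t ` tree_verts f = tree_verts f"
    using t unfolding tree_aut_def bij_betw_def by auto
  have \<theta>V: "\<theta> n a \<in> V n" if "a \<in> V n" for n a
  proof -
    have "t (n, a) \<in> tree_verts f" using bij(2) that by (auto simp: tree_verts_iff[symmetric])
    then show ?thesis by (simp add: t\<theta>[OF that] tree_verts_iff)
  qed
  have \<theta>inj: "a = b" if "a \<in> V n" "b \<in> V n" "\<theta> n a = \<theta> n b" for n a b
  proof -
    have "t (n, a) = t (n, b)" using that by (simp add: t\<theta>)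
    then have "(n, a) = (n, b)" using bij(1) that(1,2) by (auto simp: tree_verts_iff dest: inj_onD)
    then show ?thesis by simp
  qed
  have \<theta>g: "g (\<theta> (Suc n) a) = \<theta> n (g a)" if "a \<in> V (Suc n)" for n a
  proof -
    have "t (n, g a) = (n, g (\<theta> (Suc n) a))"
      using tree_aut_level[OF t that] unfolding \<theta>_def by blast
    then show ?thesis using t\<theta>[OF g_V[OF that]] by (metis prod.inject)
  qed
  define realises where "realises = (\<lambda>n s. qbar_aut s \<and> (\<forall>a\<in>V n. s a = \<theta> n a))"
  \<comment> \<open>Every vertex of level \<open>n\<close> has a child, and the action on the child
    determines the action on it.\<close>
  have down: "realises n s" if "realises (Suc n) s" for n s
    unfolding realises_def
  proof (intro conjI ballI)
    show s: "qbar_aut s" using that by (simp add: realises_def)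
    fix a assume a: "a \<in> V n"
    then obtain b where b: "b \<in> V (Suc n)" "g b = a" using fibre_nonempty by blast
    then have "s a = g (s b)" using qbar_aut_g[OF s V_algebraic[OF b(1)]] by simp
    also have "s b = \<theta> (Suc n) b" using that b by (simp add: realises_def)
    finally show "s a = \<theta> n a" using \<theta>g[OF b(1)] b(2) by simp
  qed
  have "\<exists>s. realises n s" for n
  proof (induction n)
    case 0
    show ?case
      unfolding realises_def using qbar_aut_id tree_aut_root[OF t] by (intro exI[of _ id]) (simp add: V_0 \<theta>_def)
  next
    case (Suc n)
    then obtain s where s: "qbar_aut s" "\<And>a. a \<in> V n \<Longrightarrow> s a = \<theta> n a" unfolding realises_def by blast
    obtain s' where s': "qbar_aut s'" "\<And>x. algebraic x \<Longrightarrow> s' (s x) = x" "\<And>x. algebraic x \<Longrightarrow> s (s' x) = x"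
      using qbar_aut_inverse[OF s(1)] by blast
    \<comment> \<open>The discrepancy at level \<open>Suc n\<close> of an automorphism
      \<open>s\<close> that is right at level \<open>n\<close>. It preserves every fibre, so some
      \<open>r\<close> realises it, and \<open>s \<circ> r\<close> is right at level
      \<open>Suc n\<close>.\<close>
    define \<pi> where "\<pi> = (\<lambda>v. s' (\<theta> (Suc n) v))"
    have \<pi>V: "\<pi> v \<in> V (Suc n)" if "v \<in> V (Suc n)" for v
      unfolding \<pi>_def by (rule V_stable[OF s'(1) \<theta>V[OF that]])
    have "inj_on \<pi> (V (Suc n))"
    proof (rule inj_onI)
      fix u v assume uv: "u \<in> V (Suc n)" "v \<in> V (Suc n)" "\<pi> u = \<pi> v"
      then have "\<theta> (Suc n) u = \<theta> (Suc n) v"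
        using qbar_aut_inj[OF s'(1) V_algebraic[OF \<theta>V[OF uv(1)]] V_algebraic[OF \<theta>V[OF uv(2)]]]
        by (simp add: \<pi>_def)
      then show "u = v" by (rule \<theta>inj[OF uv(1,2)])
    qed
    moreover from this have "\<pi> ` V (Suc n) = V (Suc n)"
      by (intro endo_inj_surj finite_V) (use \<pi>V in auto)
    ultimately have "bij_betw \<pi> (V (Suc n)) (V (Suc n))" by (simp add: bij_betw_def)
    moreover have "g (\<pi> v) = g v" if v: "v \<in> V (Suc n)" for v
    proof -
      have "g (\<pi> v) = s' (g (\<theta> (Suc n) v))"
        unfolding \<pi>_def using qbar_aut_g[OF s'(1) V_algebraic[OF \<theta>V[OF v]]] by simp
      also have "\<dots> = s' (s (g v))" using \<theta>g[OF v] s(2)[OF g_V[OF v]] by simp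
      also have "\<dots> = g v" by (rule s'(2)[OF V_algebraic[OF g_V[OF v]]])
      finally show ?thesis .
    qed
    ultimately obtain r where r: "qbar_aut r" "\<forall>v\<in>V (Suc n). r v = \<pi> v"
      using fibre_permutation_realised by blast
    have "(s \<circ> r) v = \<theta> (Suc n) v" if "v \<in> V (Suc n)" for v
      using r(2) that s'(3)[OF V_algebraic[OF \<theta>V[OF that]]] by (simp add: \<pi>_def)
    then show ?case unfolding realises_def using qbar_aut_comp[OF s(1) r(1)] by blast
  qed
  then have "\<forall>n. \<exists>s. realises n s" by blast
  from choice[OF this] obtain S where S: "\<forall>n. realises n (S n)" ..
  \<comment> \<open>Hence on each fixed level the sequence \<open>S\<close> is eventually constant,
    which is what \<open>qbar_aut_limit\<close> requires.\<close>
  have Sm: "realises m (S n)" if "m \<le> n" for m n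
    using that by (induction m rule: inc_induct) (use S down in auto)
  have "qbar_aut (S n)" for n using S by (simp add: realises_def)
  from qbar_aut_limit[of S, OF this]
  obtain s where s: "qbar_aut s" "\<forall>x y N. algebraic x \<longrightarrow> (\<forall>n\<ge>N. S n x = y) \<longrightarrow> s x = y" by blast
  have "t v = (fst v, s (snd v))" if "v \<in> tree_verts f" for v
  proof -
    obtain m a where v: "v = (m, a)" by fastforce
    then have a: "a \<in> V m" using that by (simp add: tree_verts_iff)
    have "s a = \<theta> m a"
      using s(2) V_algebraic[OF a] Sm a unfolding realises_def by blast
    then show ?thesis using t\<theta>[OF a] v by simp
  qed
  then show "\<exists>s. qbar_aut s \<and> (\<forall>v\<in>tree_verts f. t v = (fst v, s (snd v)))" using s(1) by blast
qed

end

section \<open>Instances\<close>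

lemma square_mod_3: "(m::int)\<^sup>2 mod 3 \<noteq> 2"
proof -
  have "m mod 3 = 0 \<or> m mod 3 = 1 \<or> m mod 3 = 2" by presburger
  moreover have "m\<^sup>2 mod 3 = (m mod 3)\<^sup>2 mod 3" by (simp add: power_mod)
  ultimately show ?thesis by auto
qed

lemma square_mod_4: "(m::int)\<^sup>2 mod 4 \<noteq> 3"
proof -
  have "m mod 4 = 0 \<or> m mod 4 = 1 \<or> m mod 4 = 2 \<or> m mod 4 = 3" by presburger
  moreover have "m\<^sup>2 mod 4 = (m mod 4)\<^sup>2 mod 4" by (simp add: power_mod)
  ultimately show ?thesis by auto
qed

lemma square_mod_8: "(m::int)\<^sup>2 mod 8 \<noteq> 5"
proof -
  have "m mod 8 = 0 \<or> m mod 8 = 1 \<or> m mod 8 = 2 \<or> m mod 8 = 3 \<or> m mod 8 = 4 \<or> m mod 8 = 5 \<or> m mod 8 = 6 \<or> m mod 8 = 7"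
    by presburger
  moreover have "m\<^sup>2 mod 8 = (m mod 8)\<^sup>2 mod 8" by (simp add: power_mod)
  ultimately show ?thesis by auto
qed

text \<open>Removes the absolute value, so that congruences can decide. Since b_0 + p = 1, the first
  value is at least (p - 1)^2 - p, positive for p >= 3; from there on each value is at least the
  preceding one.\<close>

lemma critical_quotient_pos:
  assumes p: "p \<ge> 3" "odd p" and k: "k > 0" and n: "n > 0"
  shows "critical_quotient p k n > 0"
  using n
proof (induction n)
  case (Suc n)
  have k1: "int k ^ (p - 1) \<ge> 1" using k by (intro one_le_power) simp
  show ?case
  proof (cases "n = 0")
    case True
    have e: "even (p - 1)" using p by simp
    have "(- (int p - 1)) ^ (p - 1) = (int p - 1) ^ (p - 1)" using e by (rule power_minus_even)
    also have "\<dots> \<ge> (int p - 1) ^ 2" using p by (intro power_increasing) auto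
    finally have "(- (int p - 1)) ^ (p - 1) \<ge> (int p - 1)\<^sup>2" .
    then have "1 * (int p - 1)\<^sup>2 \<le> int k ^ (p - 1) * (- (int p - 1)) ^ (p - 1)"
      using k1 by (intro mult_mono) auto
    moreover have "critical_quotient p k (Suc n) = int k ^ (p - 1) * (- (int p - 1)) ^ (p - 1) - int p"
      using True by simp
    moreover have "int p < 1 * (int p - 1)\<^sup>2"
    proof -
      have "3 * int p \<le> int p * int p" using p by (intro mult_right_mono) auto
      then show ?thesis by (simp add: power2_eq_square algebra_simps)
    qed
    ultimately show ?thesis by linarith
  next
    case False
    let ?b = "critical_quotient p k n"
    have b: "?b > 0" using Suc False by simp
    then have "?b ^ (p - 1) \<ge> 1" by (intro one_le_power) simp
    then have "1 * 1 \<le> int k ^ (p - 1) * ?b ^ (p - 1)" using k1 by (intro mult_mono) auto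
    then have "1 * (?b + int p) \<le> int k ^ (p - 1) * ?b ^ (p - 1) * (?b + int p)"
      using b by (intro mult_right_mono) auto
    moreover have "0 < x - z" if "1 * (y + z) \<le> x" "y > 0" for x y z :: int
      using that by simp
    ultimately show ?thesis unfolding critical_quotient.simps(2) using b by blast
  qed
qed simp

text \<open>The residue 2 is preserved: k is 1 modulo 3 and p - 1 is even, so b = 2 leads to (2 + p)
  - p = 2.\<close>

lemma critical_quotient_mod_3:
  assumes p: "prime p" "p \<ge> 5" and k: "[k = 1] (mod 3)"
  shows "n > 0 \<Longrightarrow> critical_quotient p k n mod 3 = 2"
proof -
  have p3: "\<not> 3 dvd p" using p primes_dvd_imp_eq[of 3 p] by auto
  have e: "even (p - 1)" using p prime_odd_nat[OF p(1)] by simp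
  then obtain j where j: "p - 1 = 2 * j" by (elim evenE)
  have kc: "[int k = 1] (mod 3)" using k cong_int_iff[of k 1 3] by simp
  then have k1: "[int k ^ (p - 1) = 1] (mod 3)" using cong_pow[OF kc, of "p - 1"] by simp
  have step: "[critical_quotient p k (Suc n) = 2] (mod 3)" if "[critical_quotient p k n = 2] (mod 3)" for n
  proof -
    let ?b = "critical_quotient p k n"
    have "[?b ^ (p - 1) = 2 ^ (p - 1)] (mod 3)" by (rule cong_pow[OF that])
    moreover have "[(2::int) ^ (p - 1) = 1] (mod 3)"
      using cong_pow[of 4 1 "3::int" j] unfolding j power_mult by (simp add: cong_def)
    ultimately have "[?b ^ (p - 1) = 1] (mod 3)" by (rule cong_trans)
    then have "[int k ^ (p - 1) * ?b ^ (p - 1) * (?b + int p) - int p = 1 * 1 * (2 + int p) - int p] (mod 3)"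
      by (intro cong_diff cong_mult cong_add k1 that cong_refl)
    then show ?thesis by simp
  qed
  have "[critical_quotient p k (Suc n) = 2] (mod 3)" for n
  proof (induction n)
    case 0
    show ?case
    \<comment> \<open>For p = 1 modulo 3 the initial value vanishes and the next one is -p = 2; for
      p = 2 the initial value 1 - p is already 2.\<close>
    proof (cases "p mod 3 = 1")
      case True
      then obtain i where i: "p = 3 * i + 1" by (metis mult_div_mod_eq)
      have d: "3 dvd - (int p - 1)" using i by simp
      have "3 dvd (- (int p - 1)) ^ (p - 1)"
        using p by (intro dvd_trans[OF d dvd_power]) auto
      then have "3 dvd int k ^ (p - 1) * (- (int p - 1)) ^ (p - 1) * (- (int p - 1) + int p)"
        by (intro dvd_mult2 dvd_mult)
      moreover have "3 dvd int p + 2" using i by simp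
      ultimately have "3 dvd int k ^ (p - 1) * (- (int p - 1)) ^ (p - 1) * (- (int p - 1) + int p) - (int p + 2)"
        by (rule dvd_diff)
      then show ?thesis unfolding cong_iff_dvd_diff critical_quotient.simps by (simp only: diff_diff_eq)
    next
      case False
      then have "p mod 3 = 2" using p3 by presburger
      then obtain i where i: "p = 3 * i + 2" by (metis mult_div_mod_eq)
      then have "[critical_quotient p k 0 = 2] (mod 3)"
        unfolding cong_iff_dvd_diff by simp
      then show ?thesis by (rule step)
    qed
  next
    case (Suc n)
    then show ?case by (rule step)
  qed
  then show "n > 0 \<Longrightarrow> critical_quotient p k n mod 3 = 2"
    by (cases n) (auto simp: cong_def)
qed

text \<open>The recursion is 4 b^2 (b + 3) - 3 with b_1 = 13; once b is 5 modulo 8, b + 3 vanishes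
  modulo 8 and -3 = 5 remains.\<close>

lemma critical_quotient_3_2: "n > 0 \<Longrightarrow> critical_quotient 3 2 n mod 8 = 5"
proof (induction n)
  case (Suc n)
  let ?b = "critical_quotient 3 2 n"
  show ?case
  proof (cases "n = 0")
    case False
    then have "?b mod 8 = 5" using Suc by simp
    then obtain j where "?b = 8 * j + 5" by (metis mult_div_mod_eq)
    then have "critical_quotient 3 2 (Suc n) = 8 * (4 * (8 * j + 5)\<^sup>2 * j + 4 * (8 * j + 5)\<^sup>2 - 1) + 5"
      by (simp add: algebra_simps)
    then obtain z where "critical_quotient 3 2 (Suc n) = 8 * z + 5" by blast
    then show ?thesis by presburger
  qed simp
qed simp

text \<open>The values start -1, -5, 43: positivity begins only at index 2, whence the separate
  clause.\<close>

lemma critical_quotient_2_3: "n > 0 \<Longrightarrow> critical_quotient 2 3 n mod 4 = 3 \<and> (n > 1 \<longrightarrow> critical_quotient 2 3 n > 0)"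
proof (induction n)
  case (Suc n)
  let ?b = "critical_quotient 2 3 n"
  have b': "critical_quotient 2 3 (Suc n) = 3 * ?b * (?b + 2) - 2" by simp
  show ?case
  proof (cases "n = 0")
    case False
    then have IH: "?b mod 4 = 3" "n > 1 \<longrightarrow> ?b > 0" using Suc by auto
    then obtain j where j: "?b = 4 * j + 3" by (metis mult_div_mod_eq)
    have "critical_quotient 2 3 (Suc n) = 4 * (12 * (j * j) + 24 * j + 10) + 3"
      unfolding b' j by (simp add: algebra_simps)
    then obtain z where "critical_quotient 2 3 (Suc n) = 4 * z + 3" by blast
    then have "critical_quotient 2 3 (Suc n) mod 4 = 3" by presburger
    moreover have "critical_quotient 2 3 (Suc n) > 0"
    proof (cases "n = 1")
      case True
      then show ?thesis by (simp add: eval_nat_numeral)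
    next
      case False
      then have "?b \<ge> 1" using IH \<open>n \<noteq> 0\<close> by simp
      then have "3 * 1 * (1 + 2) \<le> 3 * ?b * (?b + 2)" by (intro mult_mono) auto
      then show ?thesis unfolding b' by simp
    qed
    ultimately show ?thesis by simp
  qed simp
qed simp

lemma not_abs_square:
  fixes b m r N :: int
  assumes "b > 0" "b mod N = r" "\<And>m::int. m\<^sup>2 mod N \<noteq> r"
  shows "\<bar>b\<bar> \<noteq> m\<^sup>2"
  using assms by auto

lemma arboreal_surjective_phi_pk: "phi_family p k \<Longrightarrow> arboreal_surjective (phi_pk p k) \<and> degree (phi_pk p k) = p"
  using phi_family.arboreal_surjective_f[of p k] phi_family.degree_f[of p k] phi_family.f_def[of p k] by simp

lemma phi_family_mod_3:
  assumes "prime p" "p \<ge> 5" "k > 0" "\<not> p dvd k" "[k = 1] (mod 3)"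
  shows "phi_family p k"
proof
  have "odd p" using assms prime_odd_nat[of p] by simp
  then show "\<bar>critical_quotient p k n\<bar> \<noteq> m\<^sup>2" if "n > 0" for n m
    using assms that
    by (intro not_abs_square[OF critical_quotient_pos critical_quotient_mod_3 square_mod_3]) auto
qed (use assms in auto)

lemma phi_family_3_2: "phi_family 3 2"
proof
  show "\<bar>critical_quotient 3 2 n\<bar> \<noteq> m\<^sup>2" if "n > 0" for n m
    using that by (intro not_abs_square[OF critical_quotient_pos critical_quotient_3_2 square_mod_8]) auto
qed auto

lemma phi_family_2_3: "phi_family 2 3"
proof
  show "\<bar>critical_quotient 2 3 n\<bar> \<noteq> m\<^sup>2" if n: "n > 0" for n m
  proof (cases "n = 1")
    case True
    \<comment> \<open>The one negative value at a positive index is -5, and its absolute value is 1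
      modulo 4, so modulus 8 is used here.\<close>
    have "(m::int)\<^sup>2 \<noteq> 5" using square_mod_8[of m] by auto
    with True show ?thesis by simp
  next
    case False
    then show ?thesis
      using critical_quotient_2_3[OF n] n by (intro not_abs_square[OF _ _ square_mod_4]) auto
  qed
qed auto

theorem theorem1p2:
  shows "(\<forall>p k. prime p \<and> p \<ge> 5 \<and> k > 0 \<and> \<not> p dvd k \<and> [k = 1] (mod 3)
            \<longrightarrow> arboreal_surjective (phi_pk p k))
       \<and> arboreal_surjective (phi_pk 3 2)
       \<and> (\<forall>l::nat. prime l \<longrightarrow> (\<exists>f::int poly. degree f = l \<and> arboreal_surjective f))"
proof (intro conjI allI impI)
  show "arboreal_surjective (phi_pk p k)"
    if "prime p \<and> p \<ge> 5 \<and> k > 0 \<and> \<not> p dvd k \<and> [k = 1] (mod 3)" for p k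
    using arboreal_surjective_phi_pk[OF phi_family_mod_3] that by blast
  show "arboreal_surjective (phi_pk 3 2)" using arboreal_surjective_phi_pk[OF phi_family_3_2] by blast
  fix l :: nat assume l: "prime l"
  have "l \<noteq> 4" using l by auto
  then consider "l = 2" | "l = 3" | "l \<ge> 5" using prime_ge_2_nat[OF l] by linarith
  then obtain k where "phi_family l k"
  proof cases
    case 1
    then show ?thesis using phi_family_2_3 that by blast
  next
    case 2
    then show ?thesis using phi_family_3_2 that by blast
  next
    case 3
    then have "phi_family l 1" using l by (intro phi_family_mod_3) auto
    then show ?thesis using that by blast
  qed
  from arboreal_surjective_phi_pk[OF this] show "\<exists>f::int poly. degree f = l \<and> arboreal_surjective f" by blast
qed

end
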